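(* Let $A,B$ be von Neumann algebras such that the atomic part $A_{at}=\bigoplus_\lambda B(H_\lambda)$ of $A$ is non-zero. Let $c\in soc(A)$ satisfy $\operatorname{rank}(\pi_\lambda(c))\le\dim(H_\lambda)-2$ for all $\lambda$, and let $\varphi:A\to B$ be a linear map having the product property at $c$. Then $\varphi$ preserves zero products ($ab=0\Rightarrow\varphi(a)\varphi(b)=0$). Moreover, if $\varphi$ is bounded and symmetric (respectively, bounded and surjective), then there exist $h\in B$ commuting with every element of $\varphi(A)$ and a $^*$-homomorphism (respectively, a surjective homomorphism) $\rho:A\to B$ such that $\varphi(a)=h\rho(a)$ for all $a\in A$.
   Context: For a von Neumann algebra $A$ with non-zero minimal partial isometries, $A=A_{at}\oplus A_d$ with weak$^*$-closed ideals, where $A_{at}$ is the weak$^*$-closed span of the non-zero minimal partial isometries (partial isometries $u$ with $uu^*Au^*u=\mathbb{C}u$), identified with $\bigoplus_\lambda B(H_\lambda)$; $\pi_\lambda$ is the projection onto $B(H_\lambda)$. $soc(A)$ is the linear span of the minimal projections of $A$. $\varphi$ is symmetric if $\varphi(a^* )=\varphi(a)^*$. A linear map $\varphi:A\to B$ has the product property at $c$ if there is a linear $T:A\to B$ with $\varphi(a)\varphi(b)=T(ab)$ for all $a,b\in A$ with $ab=c$. *)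

theory Defs
  imports "HOL-Analysis.Analysis" "HOL-Library.Extended_Nat"
begin

class complex_vector = real_vector +
  fixes scaleC :: "complex \<Rightarrow> 'a \<Rightarrow> 'a"
  assumes scaleC_add_right: "scaleC c (x + y) = scaleC c x + scaleC c y"
    and scaleC_add_left: "scaleC (c + d) x = scaleC c x + scaleC d x"
    and scaleC_scaleC: "scaleC c (scaleC d x) = scaleC (c * d) x"
    and scaleC_one: "scaleC 1 x = x"
    and scaleR_scaleC: "scaleR r x = scaleC (complex_of_real r) x"

class complex_inner = complex_vector + real_normed_vector +
  fixes cinner :: "'a \<Rightarrow> 'a \<Rightarrow> complex"
  assumes cinner_commute: "cinner x y = cnj (cinner y x)"
    and cinner_add_right: "cinner x (y + z) = cinner x y + cinner x z"
    and cinner_scaleC_right: "cinner x (scaleC c y) = c * cinner x y"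
    and cinner_self_real: "Im (cinner x x) = 0"
    and cinner_self_nonneg: "0 \<le> Re (cinner x x)"
    and cinner_self_eq_zero: "cinner x x = 0 \<longleftrightarrow> x = 0"
    and norm_eq_sqrt_cinner: "norm x = sqrt (Re (cinner x x))"

class chilbert = complex_inner + complete_space

definition clinear_map :: "('a::complex_vector \<Rightarrow> 'b::complex_vector) \<Rightarrow> bool" where
  "clinear_map f \<longleftrightarrow> (\<forall>x y. f (x + y) = f x + f y) \<and> (\<forall>c x. f (scaleC c x) = scaleC c (f x))"

definition BH :: "('h::chilbert \<Rightarrow> 'h) set" where
  "BH = {T. clinear_map T \<and> (\<exists>K. \<forall>x. norm (T x) \<le> norm x * K)}"

text \<open>Hilbert space adjoint (exists uniquely for bounded operators).\<close>
definition adj :: "('h::chilbert \<Rightarrow> 'h) \<Rightarrow> ('h \<Rightarrow> 'h)" where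
  "adj T = (SOME S. \<forall>x y. cinner (T x) y = cinner x (S y))"

definition commutant :: "('h::chilbert \<Rightarrow> 'h) set \<Rightarrow> ('h \<Rightarrow> 'h) set" where
  "commutant S = {T \<in> BH. \<forall>s\<in>S. T \<circ> s = s \<circ> T}"

text \<open>Von Neumann algebra: a self-adjoint set of bounded operators equal to its
  double commutant (von Neumann's bicommutant theorem characterisation, the standard definition).\<close>
definition von_neumann_algebra :: "('h::chilbert \<Rightarrow> 'h) set \<Rightarrow> bool" where
  "von_neumann_algebra M \<longleftrightarrow> M \<subseteq> BH \<and> (\<forall>a\<in>M. adj a \<in> M) \<and> commutant (commutant M) = M"

definition op_add :: "('h::complex_vector \<Rightarrow> 'h) \<Rightarrow> ('h \<Rightarrow> 'h) \<Rightarrow> ('h \<Rightarrow> 'h)" where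
  "op_add a b = (\<lambda>x. a x + b x)"

definition op_scale :: "complex \<Rightarrow> ('h::complex_vector \<Rightarrow> 'h) \<Rightarrow> ('h \<Rightarrow> 'h)" where
  "op_scale c a = (\<lambda>x. scaleC c (a x))"

definition op_zero :: "'h::complex_vector \<Rightarrow> 'h" where
  "op_zero = (\<lambda>x. 0)"

definition linear_on :: "('h::chilbert \<Rightarrow> 'h) set \<Rightarrow> ('k::chilbert \<Rightarrow> 'k) set
    \<Rightarrow> (('h \<Rightarrow> 'h) \<Rightarrow> ('k \<Rightarrow> 'k)) \<Rightarrow> bool" where
  "linear_on A B \<phi> \<longleftrightarrow> \<phi> ` A \<subseteq> B \<and>
     (\<forall>a\<in>A. \<forall>b\<in>A. \<phi> (op_add a b) = op_add (\<phi> a) (\<phi> b)) \<and>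
     (\<forall>a\<in>A. \<forall>c. \<phi> (op_scale c a) = op_scale c (\<phi> a))"

definition homomorphism_on :: "('h::chilbert \<Rightarrow> 'h) set \<Rightarrow> ('k::chilbert \<Rightarrow> 'k) set
    \<Rightarrow> (('h \<Rightarrow> 'h) \<Rightarrow> ('k \<Rightarrow> 'k)) \<Rightarrow> bool" where
  "homomorphism_on A B \<rho> \<longleftrightarrow> linear_on A B \<rho> \<and> (\<forall>a\<in>A. \<forall>b\<in>A. \<rho> (a \<circ> b) = \<rho> a \<circ> \<rho> b)"

definition star_homomorphism_on :: "('h::chilbert \<Rightarrow> 'h) set \<Rightarrow> ('k::chilbert \<Rightarrow> 'k) set
    \<Rightarrow> (('h \<Rightarrow> 'h) \<Rightarrow> ('k \<Rightarrow> 'k)) \<Rightarrow> bool" where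
  "star_homomorphism_on A B \<rho> \<longleftrightarrow> homomorphism_on A B \<rho> \<and> (\<forall>a\<in>A. \<rho> (adj a) = adj (\<rho> a))"

definition product_property_at :: "('h::chilbert \<Rightarrow> 'h) set \<Rightarrow> ('k::chilbert \<Rightarrow> 'k) set
    \<Rightarrow> (('h \<Rightarrow> 'h) \<Rightarrow> ('k \<Rightarrow> 'k)) \<Rightarrow> ('h \<Rightarrow> 'h) \<Rightarrow> bool" where
  "product_property_at A B \<phi> c \<longleftrightarrow>
     (\<exists>T. linear_on A B T \<and> (\<forall>a\<in>A. \<forall>b\<in>A. a \<circ> b = c \<longrightarrow> \<phi> a \<circ> \<phi> b = T (a \<circ> b)))"

definition preserves_zero_products :: "('h::chilbert \<Rightarrow> 'h) set
    \<Rightarrow> (('h \<Rightarrow> 'h) \<Rightarrow> ('k::chilbert \<Rightarrow> 'k)) \<Rightarrow> bool" where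
  "preserves_zero_products A \<phi> \<longleftrightarrow>
     (\<forall>a\<in>A. \<forall>b\<in>A. a \<circ> b = op_zero \<longrightarrow> \<phi> a \<circ> \<phi> b = op_zero)"

definition bounded_on :: "('h::chilbert \<Rightarrow> 'h) set \<Rightarrow> (('h \<Rightarrow> 'h) \<Rightarrow> ('k::chilbert \<Rightarrow> 'k)) \<Rightarrow> bool" where
  "bounded_on A \<phi> \<longleftrightarrow> (\<exists>K. \<forall>a\<in>A. onorm (\<phi> a) \<le> K * onorm a)"

definition symmetric_on :: "('h::chilbert \<Rightarrow> 'h) set \<Rightarrow> (('h \<Rightarrow> 'h) \<Rightarrow> ('k::chilbert \<Rightarrow> 'k)) \<Rightarrow> bool" where
  "symmetric_on A \<phi> \<longleftrightarrow> (\<forall>a\<in>A. \<phi> (adj a) = adj (\<phi> a))"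

definition is_proj :: "('h::chilbert \<Rightarrow> 'h) set \<Rightarrow> ('h \<Rightarrow> 'h) \<Rightarrow> bool" where
  "is_proj A p \<longleftrightarrow> p \<in> A \<and> p \<circ> p = p \<and> adj p = p"

definition minimal_partial_isometry :: "('h::chilbert \<Rightarrow> 'h) set \<Rightarrow> ('h \<Rightarrow> 'h) \<Rightarrow> bool" where
  "minimal_partial_isometry A u \<longleftrightarrow> u \<in> A \<and> u \<noteq> op_zero \<and> u \<circ> adj u \<circ> u = u \<and>
     {u \<circ> adj u \<circ> a \<circ> adj u \<circ> u | a. a \<in> A} = {op_scale \<mu> u | \<mu>. True}"

definition minimal_projection :: "('h::chilbert \<Rightarrow> 'h) set \<Rightarrow> ('h \<Rightarrow> 'h) \<Rightarrow> bool" where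
  "minimal_projection A p \<longleftrightarrow> is_proj A p \<and> p \<noteq> op_zero \<and>
     {p \<circ> a \<circ> p | a. a \<in> A} = {op_scale \<mu> p | \<mu>. True}"

definition soc :: "('h::chilbert \<Rightarrow> 'h) set \<Rightarrow> ('h \<Rightarrow> 'h) set" where
  "soc A = {c. \<exists>P \<mu>. finite P \<and> (\<forall>p\<in>P. minimal_projection A p) \<and>
                  c = (\<lambda>x. \<Sum>p\<in>P. scaleC (\<mu> p) (p x))}"

definition central_projection :: "('h::chilbert \<Rightarrow> 'h) set \<Rightarrow> ('h \<Rightarrow> 'h) \<Rightarrow> bool" where
  "central_projection A z \<longleftrightarrow> is_proj A z \<and> (\<forall>a\<in>A. z \<circ> a = a \<circ> z)"

text \<open>Central support of a projection e: least central projection z with z e = e.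
  For a minimal projection e this is the unit of the summand B(H_\<lambda>) of A_at containing e,
  i.e. the central projection with \<pi>_\<lambda>(x) = z x.\<close>
definition central_support :: "('h::chilbert \<Rightarrow> 'h) set \<Rightarrow> ('h \<Rightarrow> 'h) \<Rightarrow> ('h \<Rightarrow> 'h)" where
  "central_support A e = (THE z. central_projection A z \<and> z \<circ> e = e \<and>
      (\<forall>w. central_projection A w \<and> w \<circ> e = e \<longrightarrow> z \<circ> w = z))"

definition range_projection :: "('h::chilbert \<Rightarrow> 'h) set \<Rightarrow> ('h \<Rightarrow> 'h) \<Rightarrow> ('h \<Rightarrow> 'h)" where
  "range_projection A x = (THE p. is_proj A p \<and> p \<circ> x = x \<and>
      (\<forall>q. is_proj A q \<and> q \<circ> x = x \<longrightarrow> p \<circ> q = p))"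

text \<open>Atomic dimension below a projection q: the supremum (in enat) of sizes of families
  of mutually orthogonal minimal projections of A below q.  For q = unit of B(H_\<lambda>)
  this is dim(H_\<lambda>); for q the range projection of \<pi>_\<lambda>(x) this is rank(\<pi>_\<lambda>(x)).\<close>
definition atomic_dim :: "('h::chilbert \<Rightarrow> 'h) set \<Rightarrow> ('h \<Rightarrow> 'h) \<Rightarrow> enat" where
  "atomic_dim A q = (SUP F \<in> {F. finite F \<and> (\<forall>p\<in>F. minimal_projection A p \<and> p \<circ> q = p) \<and>
                              (\<forall>p\<in>F. \<forall>p'\<in>F. p \<noteq> p' \<longrightarrow> p \<circ> p' = op_zero)}. enat (card F))"

text \<open>Summands B(H_\<lambda>) of A_at are indexed by their units z_\<lambda> = central supports of minimal projections.\<close>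
definition dim_H :: "('h::chilbert \<Rightarrow> 'h) set \<Rightarrow> ('h \<Rightarrow> 'h) \<Rightarrow> enat" where
  "dim_H A z = atomic_dim A z"

definition rank_pi :: "('h::chilbert \<Rightarrow> 'h) set \<Rightarrow> ('h \<Rightarrow> 'h) \<Rightarrow> ('h \<Rightarrow> 'h) \<Rightarrow> enat" where
  "rank_pi A z x = atomic_dim A (range_projection A (z \<circ> x))"

end

theory Submission
  imports Defs
begin

text \<open>
  Write \<open>ab = 0\<close> as \<open>a = ae\<close>, \<open>b = (1 - e)b\<close> with a projection \<open>e\<close> of the algebra. If \<open>p \<le> e\<close> and
  \<open>q \<le> 1 - e\<close> leave enough room, that is, if \<open>c = xy\<close> with \<open>py = 0\<close> and \<open>xq = 0\<close>, then all four
  products \<open>(\<epsilon>ap + x)(\<delta>qb + y)\<close> with \<open>\<epsilon>, \<delta> \<in> {0, 1}\<close> equal \<open>c\<close>, and the product property at \<open>c\<close>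
  gives \<open>\<phi>(ap)\<phi>(qb) = 0\<close>. Removing at most two minimal projections from a summand \<open>B(H\<^sub>\<lambda>)\<close> still
  leaves \<open>rank(\<pi>\<^sub>\<lambda>(c))\<close> orthogonal ones, through which \<open>\<pi>\<^sub>\<lambda>(c)\<close> factors; hence \<open>e\<close> and \<open>1 - e\<close> are
  finite sums of such pieces.

  If \<open>\<phi>\<close> is bounded, then \<open>\<phi>(ap)\<phi>(b) = \<phi>(a)\<phi>(pb)\<close> for projections \<open>p\<close> extends to the norm closed
  span of the projections, which is the whole algebra, so \<open>\<phi>(a)\<phi>(b) = h\<phi>(ab)\<close> with \<open>h = \<phi>(1)\<close>
  commuting with the range of \<open>\<phi>\<close>. If \<open>\<phi>\<close> is surjective, \<open>h\<close> is invertible. If \<open>\<phi>\<close> is symmetric,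
  iterating \<open>\<parallel>\<phi>(a)v\<parallel>\<^sup>2 = \<langle>hv, \<phi>(a\<^sup>*a)v\<rangle>\<close> yields \<open>\<parallel>\<phi>(a)v\<parallel> \<le> \<parallel>a\<parallel> \<parallel>hv\<parallel>\<close>, so \<open>\<phi>(a)\<close> factors through \<open>h\<close>
  by Douglas' lemma.
\<close>


section \<open>Complex Hilbert spaces\<close>

text \<open>In the first claim \<open>\<phi>\<close> is only linear, so \<open>e\<close> and
  \<open>1 - e\<close> have to be cut into finitely many pieces, although finitely many minimal
  projections cannot exhaust an infinite-dimensional summand. The way out is to admit a large
  remainder as one more piece. It is harmless because it is non-zero only after enough minimal
  projections have been split off, and these carry the factors \<open>x\<close> and \<open>y\<close>
  of \<open>c\<close>. One piece of \<open>e\<close> and one piece of \<open>1 - e\<close> block at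
  most two of them, which is the origin of the 2 in the rank condition. Only the finitely many
  summands met by \<open>c\<close> need this care; off them one piece of \<open>e\<close> and one of
  \<open>1 - e\<close> suffice.

  In the symmetric case \<open>h\<close> need not be invertible. The quotient of
  \<open>\<phi>(a)\<close> by \<open>h\<close> is therefore supported on the range projection of
  \<open>h\<close>, and its algebraic properties, as well as its membership in \<open>B\<close>, are
  obtained by cancelling \<open>h\<close> there.\<close>

instance chilbert \<subseteq> banach ..

lemma scaleC_zero_right [simp]: "scaleC c (0::'a::complex_vector) = 0"
  using scaleC_add_right[of c 0 "0::'a"] by simp

lemma scaleC_zero_left [simp]: "scaleC 0 (x::'a::complex_vector) = 0"
  using scaleC_add_left[of 0 0 x] by simp

lemma scaleC_minus_right [simp]: "scaleC c (- (x::'a::complex_vector)) = - scaleC c x"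
  using scaleC_add_right[of c x "- x"] by (simp add: eq_neg_iff_add_eq_0 add.commute)

lemma scaleC_minus_left [simp]: "scaleC (- c) (x::'a::complex_vector) = - scaleC c x"
  using scaleC_add_left[of c "- c" x] by (simp add: eq_neg_iff_add_eq_0 add.commute)

lemma scaleC_diff_right: "scaleC c (x - y) = scaleC c x - scaleC c (y::'a::complex_vector)"
  using scaleC_add_right[of c x "- y"] by simp

lemma scaleC_diff_left: "scaleC (c - d) x = scaleC c x - scaleC d (x::'a::complex_vector)"
  using scaleC_add_left[of c "- d" x] by simp

lemma scaleC_eq_0_iff: "scaleC c (x::'a::complex_vector) = 0 \<longleftrightarrow> c = 0 \<or> x = 0"
proof
  assume a: "scaleC c x = 0"
  show "c = 0 \<or> x = 0"
  proof (rule ccontr)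
    assume "\<not> ?thesis"
    then have "x = scaleC (inverse c) (scaleC c x)" by (simp add: scaleC_scaleC scaleC_one)
    with a \<open>\<not> ?thesis\<close> show False by simp
  qed
qed auto

lemma cinner_zero_right [simp]: "cinner x 0 = 0"
  using cinner_add_right[of x 0 0] by simp

lemma cinner_zero_left [simp]: "cinner 0 x = 0"
  by (subst cinner_commute) simp

lemma cinner_add_left: "cinner (x + y) z = cinner x z + cinner y z"
  by (metis cinner_add_right cinner_commute complex_cnj_add)

lemma cinner_scaleC_left: "cinner (scaleC c x) y = cnj c * cinner x y"
  by (metis cinner_commute cinner_scaleC_right complex_cnj_mult)

lemma cinner_minus_right [simp]: "cinner x (- y) = - cinner x y"
  using cinner_add_right[of x y "- y"] by (simp add: eq_neg_iff_add_eq_0 add.commute)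

lemma cinner_minus_left [simp]: "cinner (- x) y = - cinner x y"
  using cinner_add_left[of x "- x" y] by (simp add: eq_neg_iff_add_eq_0 add.commute)

lemma cinner_diff_right: "cinner x (y - z) = cinner x y - cinner x z"
  using cinner_add_right[of x y "- z"] by simp

lemma cinner_diff_left: "cinner (x - y) z = cinner x z - cinner y z"
  using cinner_add_left[of x "- y" z] by simp

lemma cinner_scaleR_right: "cinner x (scaleR r y) = of_real r * cinner x y"
  by (simp add: scaleR_scaleC cinner_scaleC_right)

lemma cinner_scaleR_left: "cinner (scaleR r x) y = of_real r * cinner x y"
  by (simp add: scaleR_scaleC cinner_scaleC_left)

lemma cinner_sum_right: "cinner x (\<Sum>i\<in>I. f i) = (\<Sum>i\<in>I. cinner x (f i))"
  by (induction I rule: infinite_finite_induct) (auto simp: cinner_add_right)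

lemma Re_cinner_self: "Re (cinner x x) = (norm x)\<^sup>2"
  by (simp add: norm_eq_sqrt_cinner cinner_self_nonneg)

lemma cinner_self: "cinner x x = of_real ((norm x)\<^sup>2)"
  by (simp add: complex_eq_iff Re_cinner_self cinner_self_real)

lemma Re_cinner_commute: "Re (cinner x y) = Re (cinner y x)"
  by (subst cinner_commute) simp

lemma norm_diff_sq: "(norm (x - y))\<^sup>2 = (norm x)\<^sup>2 - 2 * Re (cinner x y) + (norm (y::'a::complex_inner))\<^sup>2"
  by (simp add: Re_cinner_self[symmetric] cinner_diff_left cinner_diff_right Re_cinner_commute[of y x])

lemma norm_add_sq: "(norm (x + y))\<^sup>2 = (norm x)\<^sup>2 + 2 * Re (cinner x y) + (norm (y::'a::complex_inner))\<^sup>2"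
  by (simp add: Re_cinner_self[symmetric] cinner_add_left cinner_add_right Re_cinner_commute[of y x])

lemma complex_parallelogram:
  "(norm (x + y))\<^sup>2 + (norm (x - y))\<^sup>2 = 2 * (norm x)\<^sup>2 + 2 * (norm (y::'a::complex_inner))\<^sup>2"
  by (simp add: norm_add_sq norm_diff_sq)

lemma norm_scaleC: "norm (scaleC c (x::'a::complex_inner)) = cmod c * norm x"
proof -
  have "cinner (scaleC c x) (scaleC c x) = of_real ((cmod c)\<^sup>2 * (norm x)\<^sup>2)"
    using complex_norm_square[of c] cinner_self[of x]
    by (simp add: cinner_scaleC_left cinner_scaleC_right mult_ac)
  then have "(norm (scaleC c x))\<^sup>2 = (cmod c * norm x)\<^sup>2"
    by (metis Re_complex_of_real Re_cinner_self power_mult_distrib)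
  then show ?thesis by (simp add: power2_eq_iff_nonneg)
qed

text \<open>The exact defect serves twice: nonnegativity of the left side is Cauchy-Schwarz, and
  minimality of a distance forces the subtracted term to vanish.\<close>

lemma norm_diff_projection_sq:
  fixes s w :: "'a::complex_inner"
  assumes "s \<noteq> 0"
  shows "(norm (w - scaleC (cinner s w / of_real ((norm s)\<^sup>2)) s))\<^sup>2
    = (norm w)\<^sup>2 - (cmod (cinner s w))\<^sup>2 / (norm s)\<^sup>2"
proof -
  let ?c = "cinner s w / of_real ((norm s)\<^sup>2)"
  have n: "norm s \<noteq> 0" using assms by simp
  have c: "cmod ?c = cmod (cinner s w) / (norm s)\<^sup>2"
    by (simp add: norm_divide norm_power)
  have "cinner w s * cinner s w = of_real ((cmod (cinner s w))\<^sup>2)"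
    by (metis cinner_commute complex_norm_square mult.commute of_real_power)
  then have "cinner w (scaleC ?c s) = of_real ((cmod (cinner s w))\<^sup>2 / (norm s)\<^sup>2)"
    by (simp add: cinner_scaleC_right mult.commute)
  then have "Re (cinner w (scaleC ?c s)) = (cmod (cinner s w))\<^sup>2 / (norm s)\<^sup>2"
    by (simp only: Re_complex_of_real)
  moreover have "(norm (scaleC ?c s))\<^sup>2 = (cmod (cinner s w))\<^sup>2 / (norm s)\<^sup>2"
    unfolding norm_scaleC c using n by (simp add: power2_eq_square)
  ultimately show ?thesis by (simp only: norm_diff_sq)
qed

lemma complex_Cauchy_Schwarz: "cmod (cinner x y) \<le> norm x * norm (y::'a::complex_inner)"
proof (cases "x = 0")
  case False
  have "0 \<le> (norm y)\<^sup>2 - (cmod (cinner x y))\<^sup>2 / (norm x)\<^sup>2"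
    by (metis norm_diff_projection_sq[OF False] zero_le_power2)
  then have "(cmod (cinner x y))\<^sup>2 \<le> (norm x * norm y)\<^sup>2"
    using False by (simp add: field_simps power_mult_distrib)
  then show ?thesis by (rule power2_le_imp_le) simp
qed simp

lemma bounded_linear_cinner_right: "bounded_linear (cinner (x::'a::complex_inner))"
  by (rule bounded_linear_intro[where K = "norm x"])
    (auto simp: cinner_add_right cinner_scaleR_right scaleR_conv_of_real complex_Cauchy_Schwarz
      mult.commute[of _ "norm x"])

lemma tendsto_cinner_right: "(f \<longlongrightarrow> l) F \<Longrightarrow> ((\<lambda>n. cinner (x::'a::complex_inner) (f n)) \<longlongrightarrow> cinner x l) F"
  by (rule bounded_linear.tendsto[OF bounded_linear_cinner_right])

section \<open>Orthogonal projection, Riesz representation and adjoints\<close>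

definition csubspace :: "'a::complex_vector set \<Rightarrow> bool" where
  "csubspace S \<longleftrightarrow> 0 \<in> S \<and> (\<forall>x\<in>S. \<forall>y\<in>S. x + y \<in> S) \<and> (\<forall>c. \<forall>x\<in>S. scaleC c x \<in> S)"

lemma csubspace_diff: "csubspace S \<Longrightarrow> x \<in> S \<Longrightarrow> y \<in> S \<Longrightarrow> x - y \<in> S"
  unfolding csubspace_def
  by (metis diff_conv_add_uminus scaleC_minus_left scaleC_one)

lemma csubspace_closure:
  fixes S :: "'a::complex_inner set"
  assumes S: "csubspace S"
  shows "csubspace (closure S)"
proof -
  have "scaleC c x \<in> closure S" if x: "x \<in> closure S" for c x
  proof -
    obtain f where f: "\<And>n. f n \<in> S" "f \<longlonglongrightarrow> x" using x by (auto simp: closure_sequential)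
    have "bounded_linear (scaleC c :: 'a \<Rightarrow> 'a)"
      by (rule bounded_linear_intro[where K = "cmod c"])
        (auto simp: scaleC_add_right scaleR_scaleC scaleC_scaleC mult.commute norm_scaleC)
    then have "(\<lambda>n. scaleC c (f n)) \<longlonglongrightarrow> scaleC c x"
      by (rule bounded_linear.tendsto[OF _ f(2)])
    moreover have "scaleC c (f n) \<in> S" for n using S f(1) by (auto simp: csubspace_def)
    ultimately show ?thesis unfolding closure_sequential
      by (intro exI[of _ "\<lambda>n. scaleC c (f n)"]) auto
  qed
  moreover have "x + y \<in> closure S" if xy: "x \<in> closure S" "y \<in> closure S" for x y
  proof -
    obtain f where f: "\<And>n. f n \<in> S" "f \<longlonglongrightarrow> x"
      using xy(1) by (auto simp: closure_sequential)
    obtain g where g: "\<And>n. g n \<in> S" "g \<longlonglongrightarrow> y"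
      using xy(2) by (auto simp: closure_sequential)
    have "(\<lambda>n. f n + g n) \<longlonglongrightarrow> x + y" by (rule tendsto_add[OF f(2) g(2)])
    moreover have "f n + g n \<in> S" for n using S f(1) g(1) by (auto simp: csubspace_def)
    ultimately show ?thesis unfolding closure_sequential
      by (intro exI[of _ "\<lambda>n. f n + g n"]) auto
  qed
  ultimately show ?thesis using S closure_subset[of S] by (auto simp: csubspace_def)
qed

text \<open>A minimizing sequence is Cauchy by the parallelogram law, since midpoints stay in
  \<open>S\<close> and so keep distance at least \<open>d\<close> from \<open>x\<close>. At the
  limit no move along a vector of \<open>S\<close> comes closer to \<open>x\<close>, which forces
  orthogonality.\<close>

lemma orthogonal_projection_exists:
  fixes S :: "'a::chilbert set"
  assumes S: "csubspace S" and cl: "closed S"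
  shows "\<exists>y\<in>S. \<forall>s\<in>S. cinner s (x - y) = 0"
proof -
  have ne: "S \<noteq> {}" using S by (auto simp: csubspace_def)
  define d where "d = infdist x S"
  have d0: "0 \<le> d" by (simp add: d_def infdist_nonneg)
  have dle: "d \<le> norm (x - s)" if "s \<in> S" for s
    using infdist_le[OF that, of x] by (simp add: d_def dist_norm)
  have "\<exists>s\<in>S. norm (x - s) < d + inverse (real (Suc n))" for n
  proof (rule ccontr)
    assume "\<not> ?thesis"
    then have "d + inverse (real (Suc n)) \<le> infdist x S"
      using ne by (auto simp: infdist_notempty dist_norm not_less intro!: cINF_greatest)
    then show False by (simp add: d_def)
  qed
  then obtain s where s: "\<And>n. s n \<in> S" "\<And>n. norm (x - s n) < d + inverse (real (Suc n))"
    by metis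
  have half: "d \<le> norm (x - scaleR (1/2) (s n + s m))" for n m
    by (rule dle) (use S s(1) in \<open>auto simp: csubspace_def scaleR_scaleC\<close>)
  \<comment> \<open>Each squared distance exceeds \<open>d\<^sup>2\<close> by at most
    \<open>2 * d + 1\<close> times the inverse. In the parallelogram law both enter with factor 2,
    and the lower bound \<open>(2 * d)\<^sup>2\<close> for the sum cancels the terms in
    \<open>d\<^sup>2\<close>.\<close>
  have est: "(norm (s n - s m))\<^sup>2 \<le> 4 * (2 * d + 1) * inverse (real (Suc N))"
    if "N \<le> n" "N \<le> m" for n m N
  proof -
    let ?e = "inverse (real (Suc N))"
    have e: "0 < ?e" "?e \<le> 1" by (auto simp: field_simps)
    have bound: "(norm (x - s k))\<^sup>2 \<le> d\<^sup>2 + (2 * d + 1) * ?e" if "N \<le> k" for k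
    proof -
      have "inverse (real (Suc k)) \<le> ?e" using that by simp
      with s(2)[of k] have "norm (x - s k) \<le> d + ?e" by linarith
      then have "(norm (x - s k))\<^sup>2 \<le> (d + ?e)\<^sup>2" by (rule power_mono) simp
      also have "\<dots> = d\<^sup>2 + 2 * d * ?e + ?e * ?e" by (simp add: power2_eq_square algebra_simps)
      also have "?e * ?e \<le> ?e" using mult_left_le[of ?e ?e] e by simp
      finally show ?thesis by (simp add: algebra_simps)
    qed
    have "(norm ((x - s n) + (x - s m)))\<^sup>2 + (norm ((x - s n) - (x - s m)))\<^sup>2
        = 2 * (norm (x - s n))\<^sup>2 + 2 * (norm (x - s m))\<^sup>2"
      by (rule complex_parallelogram)
    moreover have "(x - s n) + (x - s m) = scaleR 2 (x - scaleR (1/2) (s n + s m))"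
      by (simp add: scaleR_2 scaleR_right_diff_distrib)
    then have "norm ((x - s n) + (x - s m)) = 2 * norm (x - scaleR (1/2) (s n + s m))"
      by simp
    then have "2 * d \<le> norm ((x - s n) + (x - s m))" using half[of n m] by linarith
    then have "(2 * d)\<^sup>2 \<le> (norm ((x - s n) + (x - s m)))\<^sup>2" using d0 by (intro power_mono) auto
    moreover have "norm ((x - s n) - (x - s m)) = norm (s n - s m)"
      by (simp add: norm_minus_commute)
    ultimately show ?thesis using bound[OF that(1)] bound[OF that(2)]
      by (simp add: power_mult_distrib algebra_simps)
  qed
  have "Cauchy s"
  proof (rule CauchyI)
    fix e :: real assume e: "0 < e"
    then have "0 < e\<^sup>2 / (4 * (2 * d + 1))" using d0 by simp
    then obtain N where N: "inverse (real (Suc N)) < e\<^sup>2 / (4 * (2 * d + 1))"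
      using reals_Archimedean by blast
    have lt: "4 * (2 * d + 1) * inverse (real (Suc N)) < e\<^sup>2"
    proof -
      have "0 < 4 * (2 * d + 1)" using d0 by simp
      from N[unfolded pos_less_divide_eq[OF this]] show ?thesis by (simp only: mult.commute)
    qed
    have "norm (s m - s n) < e" if "m \<ge> N" "n \<ge> N" for m n
    proof -
      have "(norm (s m - s n))\<^sup>2 < e\<^sup>2" using est[OF that] lt by linarith
      then show ?thesis using e by (simp add: power_less_imp_less_base)
    qed
    then show "\<exists>M. \<forall>m\<ge>M. \<forall>n\<ge>M. norm (s m - s n) < e" by blast
  qed
  then obtain y where y: "s \<longlonglongrightarrow> y" by (auto simp: Cauchy_convergent_iff convergent_def)
  have yS: "y \<in> S" using cl s(1) y by (auto simp: closed_sequential_limits)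
  have "(\<lambda>n. norm (x - s n)) \<longlonglongrightarrow> norm (x - y)" by (intro tendsto_intros y)
  moreover have "(\<lambda>n. d + inverse (real (Suc n))) \<longlonglongrightarrow> d + 0"
    by (intro tendsto_intros LIMSEQ_inverse_real_of_nat)
  ultimately have le: "norm (x - y) \<le> d"
    using s(2) by (intro LIMSEQ_le[of "\<lambda>n. norm (x - s n)" _ "\<lambda>n. d + inverse (real (Suc n))"])
      (auto intro: less_imp_le)
  have "cinner t (x - y) = 0" if t: "t \<in> S" for t
  proof (cases "t = 0")
    case False
    let ?c = "cinner t (x - y) / of_real ((norm t)\<^sup>2)"
    have "norm (x - y) \<le> norm (x - (y + scaleC ?c t))"
      using le dle[of "y + scaleC ?c t"] S yS t by (auto simp: csubspace_def)
    then have "(norm (x - y))\<^sup>2 \<le> (norm ((x - y) - scaleC ?c t))\<^sup>2"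
      by (simp add: diff_diff_add)
    then have "(cmod (cinner t (x - y)))\<^sup>2 / (norm t)\<^sup>2 \<le> 0"
      using norm_diff_projection_sq[OF False, of "x - y"] by linarith
    then show ?thesis using False by (simp add: divide_le_0_iff)
  qed simp
  with yS show ?thesis by blast
qed

lemma BH_bounded_linear: "T \<in> BH \<Longrightarrow> bounded_linear T"
  unfolding BH_def clinear_map_def
  by (force intro: bounded_linear_intro simp: scaleR_scaleC)

text \<open>The kernel is closed, so some \<open>u\<close> orthogonal to it has
  \<open>f u \<noteq> 0\<close>. The vector \<open>scaleC (f u) x - scaleC (f x) u\<close> lies in
  the kernel; its product with \<open>u\<close> vanishes, and solving for \<open>f x\<close> gives
  the representing multiple of \<open>u\<close>.\<close>

lemma riesz_representation:
  fixes f :: "'a::chilbert \<Rightarrow> complex"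
  assumes add: "\<And>x y. f (x + y) = f x + f y" and scale: "\<And>c x. f (scaleC c x) = c * f x"
    and K: "\<And>x. cmod (f x) \<le> K * norm x"
  shows "\<exists>y. \<forall>x. f x = cinner y x"
proof (cases "\<forall>x. f x = 0")
  case True
  then show ?thesis by (intro exI[of _ 0]) auto
next
  case False
  then obtain a where a: "f a \<noteq> 0" by auto
  have bl: "bounded_linear f"
    by (rule bounded_linear_intro[where K = K])
      (auto simp: add scale scaleR_scaleC scaleR_conv_of_real mult.commute[of _ K] K)
  have f0: "f 0 = 0" using scale[of 0 0] by simp
  define S where "S = {x. f x = 0}"
  have "closed S" unfolding S_def
    by (intro closed_Collect_eq continuous_on_const linear_continuous_on bl)
  moreover have "csubspace S" by (auto simp: csubspace_def S_def add scale f0)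
  ultimately obtain y where y: "f y = 0" "\<And>s. f s = 0 \<Longrightarrow> cinner s (a - y) = 0"
    using orthogonal_projection_exists[of S a] by (auto simp: S_def)
  define u where "u = a - y"
  have fu: "f u = f a" using add[of u y] y by (simp add: u_def)
  then have u0: "u \<noteq> 0" using a f0 by auto
  have "f x = cinner (scaleC (cnj (f u) / of_real ((norm u)\<^sup>2)) u) x" for x
  proof -
    define w where "w = scaleC (f u) x - scaleC (f x) u"
    have "f w + f (scaleC (f x) u) = f (scaleC (f u) x)" by (simp add: w_def flip: add)
    then have "f w = 0" by (simp add: scale)
    then have "cinner w u = 0" using y(2)[of w] by (simp add: u_def)
    then have "cinner u w = 0" by (metis cinner_commute complex_cnj_zero)
    then have "f u * cinner u x = f x * of_real ((norm u)\<^sup>2)"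
      by (simp add: w_def cinner_diff_right cinner_scaleC_right cinner_self)
    then show ?thesis using u0 by (simp add: cinner_scaleC_left field_simps)
  qed
  then show ?thesis by blast
qed

lemma adjoint_exists:
  fixes T :: "'a::chilbert \<Rightarrow> 'a"
  assumes "T \<in> BH"
  shows "\<exists>S. \<forall>x y. cinner (T x) y = cinner x (S y)"
proof -
  obtain K where T: "\<And>x y. T (x + y) = T x + T y" "\<And>c x. T (scaleC c x) = scaleC c (T x)"
    and K: "\<And>x. norm (T x) \<le> norm x * K" using assms by (auto simp: BH_def clinear_map_def)
  have "\<exists>z. \<forall>x. cinner y (T x) = cinner z x" for y
  proof (rule riesz_representation[where K = "norm y * K"])
    fix x
    have "cmod (cinner y (T x)) \<le> norm y * norm (T x)" by (rule complex_Cauchy_Schwarz)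
    also have "\<dots> \<le> norm y * (norm x * K)" by (intro mult_left_mono K) simp
    finally show "cmod (cinner y (T x)) \<le> norm y * K * norm x" by (simp add: mult_ac)
  qed (auto simp: T cinner_add_right cinner_scaleC_right)
  then obtain S where "\<And>y x. cinner y (T x) = cinner (S y) x" by metis
  then have "cinner (T x) y = cinner x (S y)" for x y by (metis cinner_commute)
  then show ?thesis by blast
qed

lemma adj_adjoint: "T \<in> BH \<Longrightarrow> cinner (T x) y = cinner x (adj T y)"
  unfolding adj_def using someI_ex[OF adjoint_exists[of T]] by blast

lemma cinner_ext:
  fixes y z :: "'a::complex_inner"
  assumes "\<And>x. cinner x y = cinner x z"
  shows "y = z"
proof -
  have "cinner (y - z) (y - z) = 0" using assms[of "y - z"] by (simp add: cinner_diff_right)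
  then show ?thesis by (simp add: cinner_self_eq_zero)
qed

lemma adj_BH:
  assumes "T \<in> BH"
  shows "adj T \<in> BH"
proof -
  obtain K where K: "\<And>x. norm (T x) \<le> norm x * K" using assms by (auto simp: BH_def)
  have "norm (adj T y) \<le> norm y * K" for y
  proof (cases "adj T y = 0")
    case True
    have "0 \<le> norm y * K" using K[of y] norm_ge_zero[of "T y"] by linarith
    then show ?thesis by (simp add: True)
  next
    case False
    have "(norm (adj T y))\<^sup>2 = Re (cinner (T (adj T y)) y)"
      by (simp add: adj_adjoint[OF assms] Re_cinner_self)
    also have "\<dots> \<le> cmod (cinner (T (adj T y)) y)" by (rule complex_Re_le_cmod)
    also have "\<dots> \<le> norm (T (adj T y)) * norm y" by (rule complex_Cauchy_Schwarz)
    also have "\<dots> \<le> norm (adj T y) * K * norm y" by (intro mult_right_mono K) simp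
    finally show ?thesis using False by (simp add: power2_eq_square mult_ac)
  qed
  moreover have "adj T (x + y) = adj T x + adj T y" for x y
    by (rule cinner_ext) (simp add: cinner_add_right flip: adj_adjoint[OF assms])
  moreover have "adj T (scaleC c x) = scaleC c (adj T x)" for c x
    by (rule cinner_ext) (simp add: cinner_scaleC_right flip: adj_adjoint[OF assms])
  ultimately show ?thesis by (auto simp: BH_def clinear_map_def)
qed

section \<open>The algebra of bounded operators\<close>

text \<open>As a type the bounded operators form a ring, so operator identities can be left to ring
  simplification, and boundedness is carried by the type.\<close>

typedef (overloaded) 'a bop = "BH :: ('a::chilbert \<Rightarrow> 'a) set" morphisms app Bop
  by (rule exI[of _ "\<lambda>_. 0"]) (auto simp: BH_def clinear_map_def intro!: exI[of _ 0])

setup_lifting type_definition_bop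

lemma app_add: "app T (x + y) = app T x + app T y"
  using app[of T] by (simp add: BH_def clinear_map_def)

lemma app_scaleC: "app T (scaleC c x) = scaleC c (app T x)"
  using app[of T] by (simp add: BH_def clinear_map_def)

lemma app_bounded_linear: "bounded_linear (app T)"
  by (rule BH_bounded_linear[OF app])

lemma app_zero [simp]: "app T 0 = 0"
  by (rule linear_0[OF bounded_linear.linear[OF app_bounded_linear]])

lemma app_diff: "app T (x - y) = app T x - app T y"
  by (rule linear_diff[OF bounded_linear.linear[OF app_bounded_linear]])

lemma app_tendsto: "(f \<longlongrightarrow> l) F \<Longrightarrow> ((\<lambda>n. app T (f n)) \<longlongrightarrow> app T l) F"
  by (rule bounded_linear.tendsto[OF app_bounded_linear])

lemma app_bound: "\<exists>K\<ge>0. \<forall>x. norm (app T x) \<le> K * norm x"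
  using bounded_linear.nonneg_bounded[OF app_bounded_linear, of T] by (auto simp: mult.commute)

lemma bop_eqI: "(\<And>x. app S x = app T x) \<Longrightarrow> S = T"
  by (metis app_inject ext)

lemma BH_I:
  assumes "\<And>x y. T (x + y) = T x + T y" "\<And>c x. T (scaleC c x) = scaleC c (T x)"
    "\<And>x. norm (T x) \<le> K * norm x"
  shows "T \<in> BH"
  using assms by (auto simp: BH_def clinear_map_def mult.commute intro!: exI[of _ K])

text \<open>The class \<open>ring_1\<close> would demand \<open>0 \<noteq> 1\<close>, which fails on
  the zero space; hence \<open>ring\<close> together with \<open>monoid_mult\<close>.\<close>

instantiation bop :: (chilbert) "{ring, monoid_mult}"
begin

lift_definition zero_bop :: "'a bop" is "\<lambda>_. 0"
  by (rule BH_I[where K = 0]) auto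

lift_definition one_bop :: "'a bop" is "\<lambda>x. x"
  by (rule BH_I[where K = 1]) auto

lift_definition plus_bop :: "'a bop \<Rightarrow> 'a bop \<Rightarrow> 'a bop" is "\<lambda>S T x. S x + T x"
proof -
  fix S T :: "'a \<Rightarrow> 'a" assume "S \<in> BH" "T \<in> BH"
  then obtain K L where *: "clinear_map S" "clinear_map T" "\<And>x. norm (S x) \<le> norm x * K"
    "\<And>x. norm (T x) \<le> norm x * L" unfolding BH_def by blast
  have "norm (S x + T x) \<le> (K + L) * norm x" for x
    using norm_triangle_ineq[of "S x" "T x"] *(3)[of x] *(4)[of x] by (simp add: algebra_simps)
  then show "(\<lambda>x. S x + T x) \<in> BH"
    using *(1,2) by (intro BH_I[where K = "K + L"]) (auto simp: clinear_map_def scaleC_add_right)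
qed

lift_definition uminus_bop :: "'a bop \<Rightarrow> 'a bop" is "\<lambda>T x. - T x"
proof -
  fix T :: "'a \<Rightarrow> 'a" assume "T \<in> BH"
  then obtain K where *: "clinear_map T" "\<And>x. norm (T x) \<le> norm x * K" unfolding BH_def by blast
  show "(\<lambda>x. - T x) \<in> BH"
    by (rule BH_I[where K = K]) (use * in \<open>auto simp: clinear_map_def mult.commute[of K]\<close>)
qed

definition minus_bop :: "'a bop \<Rightarrow> 'a bop \<Rightarrow> 'a bop" where "minus_bop S T = S + - T"

lift_definition times_bop :: "'a bop \<Rightarrow> 'a bop \<Rightarrow> 'a bop" is "\<lambda>S T x. S (T x)"
proof -
  fix S T :: "'a \<Rightarrow> 'a" assume *: "S \<in> BH" "T \<in> BH"
  have "bounded_linear (\<lambda>x. S (T x))"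
    using bounded_linear_compose[OF BH_bounded_linear[OF *(1)] BH_bounded_linear[OF *(2)]] .
  then obtain K where "\<And>x. norm (S (T x)) \<le> norm x * K"
    using bounded_linear.bounded by blast
  then show "(\<lambda>x. S (T x)) \<in> BH"
    using * by (auto simp: BH_def clinear_map_def)
qed

instance
proof
  fix a b c :: "'a bop"
  show "a + b + c = a + (b + c)" by transfer (simp add: add.assoc)
  show "a + b = b + a" by transfer (simp add: add.commute)
  show "0 + a = a" by transfer simp
  show "- a + a = 0" by transfer simp
  show "a - b = a + - b" by (simp add: minus_bop_def)
  show "a * b * c = a * (b * c)" by transfer simp
  show "(a + b) * c = a * c + b * c" by transfer simp
  show "a * (b + c) = a * b + a * c" by transfer (simp add: BH_def clinear_map_def)
  show "1 * a = a" "a * 1 = a" by (transfer, simp)+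
qed

end

instantiation bop :: (chilbert) complex_vector
begin

lift_definition scaleC_bop :: "complex \<Rightarrow> 'a bop \<Rightarrow> 'a bop" is "\<lambda>c T x. scaleC c (T x)"
proof -
  fix c and T :: "'a \<Rightarrow> 'a" assume "T \<in> BH"
  then obtain K where *: "clinear_map T" "\<And>x. norm (T x) \<le> norm x * K" by (auto simp: BH_def)
  have "norm (scaleC c (T x)) \<le> (cmod c * K) * norm x" for x
    using mult_left_mono[OF *(2)[of x], of "cmod c"] by (simp add: norm_scaleC mult_ac)
  then show "(\<lambda>x. scaleC c (T x)) \<in> BH"
    using *(1) by (intro BH_I[where K = "cmod c * K"])
      (auto simp: clinear_map_def scaleC_add_right scaleC_scaleC mult.commute)
qed

definition scaleR_bop :: "real \<Rightarrow> 'a bop \<Rightarrow> 'a bop" where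
  "scaleR_bop r T = scaleC (complex_of_real r) T"

instance
proof
  fix r s :: real and c d :: complex and a b :: "'a bop"
  show [simp]: "scaleR r a = scaleC (complex_of_real r) a" for r and a :: "'a bop"
    by (simp add: scaleR_bop_def)
  show 1: "scaleC c (a + b) = scaleC c a + scaleC c b" for c by transfer (simp add: scaleC_add_right)
  show 2: "scaleC (c + d) a = scaleC c a + scaleC d a" for c d by transfer (simp add: scaleC_add_left)
  show 3: "scaleC c (scaleC d a) = scaleC (c * d) a" for c d by transfer (simp add: scaleC_scaleC)
  show 4: "scaleC 1 a = a" by transfer (simp add: scaleC_one)
  show "scaleR r (a + b) = scaleR r a + scaleR r b" by (simp add: 1)
  show "scaleR (r + s) a = scaleR r a + scaleR s a" by (simp add: 2)
  show "scaleR r (scaleR s a) = scaleR (r * s) a" by (simp add: 3)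
  show "scaleR 1 a = a" by (simp add: 4)
qed

end

lift_definition star :: "'a::chilbert bop \<Rightarrow> 'a bop" is adj
  by (rule adj_BH)

lemma app_simps [simp]:
  "app 0 x = 0" "app 1 x = x" "app (S + T) x = app S x + app T x" "app (- T) x = - app T x"
  "app (S * T) x = app S (app T x)" "app (scaleC c T) x = scaleC c (app T x)"
  by (transfer, simp)+

lemma app_minus_bop [simp]: "app (S - T) x = app S x - app T x"
  unfolding minus_bop_def by (simp only: app_simps) simp

lemma app_sum: "app (\<Sum>i\<in>I. f i) x = (\<Sum>i\<in>I. app (f i) x)"
  by (induction I rule: infinite_finite_induct) auto

lemma scaleC_mult_left [simp]: "scaleC c S * T = scaleC c (S * (T::'a::chilbert bop))"
  by transfer simp

lemma scaleC_mult_right [simp]: "S * scaleC c T = scaleC c (S * (T::'a::chilbert bop))"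
  by (rule bop_eqI) (simp add: app_scaleC)

lemma cinner_star: "cinner (app T x) y = cinner x (app (star T) y)"
  by transfer (rule adj_adjoint)

lemma cinner_star': "cinner x (app T y) = cinner (app (star T) x) y"
  by (metis cinner_commute cinner_star)

lemma star_unique: "(\<And>x y. cinner (app T x) y = cinner x (app S y)) \<Longrightarrow> star T = S"
  by (rule bop_eqI, rule cinner_ext) (metis cinner_star)

lemma star_star [simp]: "star (star T) = T"
  by (rule star_unique) (simp flip: cinner_star')

lemma star_simps [simp]:
  "star (S * T) = star T * star S" "star (S + T) = star S + star T"
  "star (S - T) = star S - star T" "star (- T) = - star T"
  "star (scaleC c T) = scaleC (cnj c) (star T)" "star 0 = 0" "star 1 = 1"
  by (rule star_unique;
      simp add: cinner_star cinner_add_left cinner_add_right cinner_diff_left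
        cinner_diff_right cinner_scaleC_left cinner_scaleC_right)+

lemma star_sum: "star (\<Sum>i\<in>I. f i) = (\<Sum>i\<in>I. star (f i))"
  by (induction I rule: infinite_finite_induct) auto

lemma cinner_star_mult: "cinner x (app (star T * T) x) = of_real ((norm (app T x))\<^sup>2)"
  by (simp add: cinner_self flip: cinner_star)

lemma star_mult_eq_0: "star T * T = 0 \<Longrightarrow> T = 0"
  by (rule bop_eqI) (metis app_simps(1) cinner_star_mult cinner_zero_right norm_eq_zero
      of_real_eq_0_iff power_eq_0_iff)

section \<open>Projections in von Neumann algebras\<close>

definition isproj :: "'a::chilbert bop \<Rightarrow> bool" where
  "isproj p \<longleftrightarrow> p * p = p \<and> star p = p"

lemma isproj_one [simp]: "isproj 1"
  by (simp add: isproj_def)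

lemma isproj_le_commute: "isproj p \<Longrightarrow> isproj q \<Longrightarrow> p * q = p \<Longrightarrow> q * p = p"
  by (metis isproj_def star_simps(1))

lemma isproj_diff: "isproj p \<Longrightarrow> isproj q \<Longrightarrow> p * q = p \<Longrightarrow> isproj (q - p)"
  using isproj_le_commute[of p q] by (auto simp: isproj_def left_diff_distrib right_diff_distrib)

lemma isproj_norm_sq: "isproj p \<Longrightarrow> (norm (app p x))\<^sup>2 = Re (cinner x (app p x))"
  by (metis Re_cinner_self app_simps(5) cinner_star isproj_def)

lemma isproj_norm_le: "isproj p \<Longrightarrow> norm (app p x) \<le> norm x"
proof -
  assume p: "isproj p"
  have "(norm (app p x))\<^sup>2 \<le> norm x * norm (app p x)"
    unfolding isproj_norm_sq[OF p]
    using complex_Re_le_cmod[of "cinner x (app p x)"] complex_Cauchy_Schwarz[of x "app p x"] by linarith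
  then show ?thesis
    by (cases "app p x = 0") (auto simp: power2_eq_square)
qed

definition projects_onto :: "'a::chilbert bop \<Rightarrow> 'a set \<Rightarrow> bool" where
  "projects_onto p S \<longleftrightarrow> isproj p \<and> (\<forall>x. app p x \<in> S) \<and> (\<forall>x\<in>S. app p x = x)"

lemma projects_onto_exists:
  fixes S :: "'a::chilbert set"
  assumes S: "csubspace S" and cl: "closed S"
  shows "\<exists>p. projects_onto p S"
proof -
  obtain f where f: "\<And>x. f x \<in> S" "\<And>x s. s \<in> S \<Longrightarrow> cinner s (x - f x) = 0"
    using orthogonal_projection_exists[OF S cl] by metis
  have uniq: "f x = y" if y: "y \<in> S" "\<And>s. s \<in> S \<Longrightarrow> cinner s (x - y) = 0" for x y
  proof -
    have d: "f x - y \<in> S" using S f(1) y(1) by (rule csubspace_diff)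
    have "cinner (f x - y) ((x - y) - (x - f x)) = 0"
      using f(2)[OF d, of x] y(2)[OF d] by (simp add: cinner_diff_right)
    then show ?thesis by (simp add: cinner_self_eq_zero)
  qed
  have fS: "f x = x" if "x \<in> S" for x using that by (intro uniq) auto
  have "f \<in> BH"
  proof (rule BH_I[where K = 1])
    fix x y :: 'a and c
    show "f (x + y) = f x + f y"
    proof (rule uniq)
      show "f x + f y \<in> S" using S f(1) by (auto simp: csubspace_def)
      show "cinner s (x + y - (f x + f y)) = 0" if "s \<in> S" for s
        using f(2)[OF that, of x] f(2)[OF that, of y]
        by (simp add: cinner_diff_right cinner_add_right)
    qed
    show "f (scaleC c x) = scaleC c (f x)"
    proof (rule uniq)
      show "scaleC c (f x) \<in> S" using S f(1) by (auto simp: csubspace_def)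
      show "cinner s (scaleC c x - scaleC c (f x)) = 0" if "s \<in> S" for s
        using f(2)[OF that, of x] by (simp add: cinner_scaleC_right flip: scaleC_diff_right)
    qed
    have "(norm x)\<^sup>2 = (norm (f x + (x - f x)))\<^sup>2" by simp
    also have "\<dots> = (norm (f x))\<^sup>2 + (norm (x - f x))\<^sup>2"
      unfolding norm_add_sq using f(2)[OF f(1), of x x] by simp
    finally have "(norm (f x))\<^sup>2 \<le> (norm x)\<^sup>2" by simp
    then show "norm (f x) \<le> 1 * norm x" using power2_le_imp_le[of "norm (f x)" "norm x"] by simp
  qed
  then have appf: "app (Bop f) = f" by (rule Bop_inverse)
  have 1: "cinner (f x) y = cinner (f x) (f y)" for x y
    using f(2)[OF f(1), of x y] by (simp add: cinner_diff_right)
  have "cinner (f x) y = cinner x (f y)" for x y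
    using 1[of x y] 1[of y x] by (metis cinner_commute)
  then have "star (Bop f) = Bop f" by (intro star_unique) (simp add: appf)
  moreover have "Bop f * Bop f = Bop f"
    by (rule bop_eqI) (simp add: appf fS f(1))
  ultimately show ?thesis
    by (intro exI[of _ "Bop f"]) (auto simp: projects_onto_def isproj_def appf fS f(1))
qed

text \<open>Invariance of \<open>S\<close> under \<open>t\<close> reads
  \<open>p * t * p = t * p\<close>; invariance under \<open>star t\<close> reads, after taking
  adjoints, \<open>p * t * p = p * t\<close>.\<close>

lemma projects_onto_commute:
  assumes p: "projects_onto p S" and t: "\<And>x. x \<in> S \<Longrightarrow> app t x \<in> S" "\<And>x. x \<in> S \<Longrightarrow> app (star t) x \<in> S"
  shows "t * p = p * t"
proof -
  have 1: "p * (t * p) = t * p" and 2: "p * (star t * p) = star t * p"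
    using p t by (auto intro!: bop_eqI simp: projects_onto_def)
  have "star (p * (star t * p)) = star (star t * p)" using 2 by simp
  then have "p * t * p = p * t" using p by (simp add: projects_onto_def isproj_def)
  with 1 show ?thesis by (simp add: mult.assoc)
qed

lemma closed_app_vimage: "closed S \<Longrightarrow> closed {x. app t x \<in> S}"
  using continuous_closed_vimage[of S "app t"] linear_continuous_at[OF app_bounded_linear, of _ t]
  by (simp add: vimage_def)

lemma csubspace_app_vimage: "csubspace S \<Longrightarrow> csubspace {x. app t x \<in> S}"
  by (auto simp: csubspace_def app_add app_scaleC)

lemma csubspace_range_app: "csubspace (range (app t))"
proof -
  have "app t x + app t y \<in> range (app t)" for x y unfolding app_add[symmetric] by (rule rangeI)
  moreover have "scaleC c (app t x) \<in> range (app t)" for c x unfolding app_scaleC[symmetric] by (rule rangeI)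
  moreover have "0 \<in> range (app t)" using rangeI[of "app t" 0] by simp
  ultimately show ?thesis unfolding csubspace_def by blast
qed

lemma csubspace_zero: "csubspace {0}"
  by (auto simp: csubspace_def)

definition cmt :: "'a::chilbert bop set \<Rightarrow> 'a bop set" where
  "cmt S = {t. \<forall>s\<in>S. t * s = s * t}"

locale vna =
  fixes M :: "'a::chilbert bop set"
  assumes star_mem: "a \<in> M \<Longrightarrow> star a \<in> M"
    and bicommutant: "cmt (cmt M) = M"
begin

lemma memI: "(\<And>t. t \<in> cmt M \<Longrightarrow> a * t = t * a) \<Longrightarrow> a \<in> M"
  using bicommutant by (auto simp: cmt_def)

lemma cmtD: "t \<in> cmt M \<Longrightarrow> a \<in> M \<Longrightarrow> a * t = t * a"
  by (auto simp: cmt_def)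

lemma star_cmt: "t \<in> cmt M \<Longrightarrow> star t \<in> cmt M"
  unfolding cmt_def mem_Collect_eq by (metis star_mem star_simps(1) star_star)

lemma mem_simps [simp, intro]:
  "0 \<in> M" "1 \<in> M" "a \<in> M \<Longrightarrow> b \<in> M \<Longrightarrow> a + b \<in> M" "a \<in> M \<Longrightarrow> b \<in> M \<Longrightarrow> a - b \<in> M"
  "a \<in> M \<Longrightarrow> - a \<in> M" "a \<in> M \<Longrightarrow> scaleC c a \<in> M"
  by (rule memI; simp add: cmtD algebra_simps)+

lemma mult_mem [simp, intro]: "a \<in> M \<Longrightarrow> b \<in> M \<Longrightarrow> a * b \<in> M"
  by (rule memI) (metis cmtD mult.assoc)

lemma sum_mem: "(\<And>i. i \<in> I \<Longrightarrow> f i \<in> M) \<Longrightarrow> (\<Sum>i\<in>I. f i) \<in> M"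
  by (induction I rule: infinite_finite_induct) auto

text \<open>The commutant is closed under \<open>star\<close>, so invariance of \<open>S\<close>
  under it makes \<open>p\<close> commute with all of it; the bicommutant property does the
  rest.\<close>

lemma projects_onto_mem:
  assumes p: "projects_onto p S" and inv: "\<And>t x. t \<in> cmt M \<Longrightarrow> x \<in> S \<Longrightarrow> app t x \<in> S"
  shows "p \<in> M"
  by (rule memI) (metis projects_onto_commute[OF p] inv star_cmt)

definition is_rproj :: "'a bop \<Rightarrow> 'a bop \<Rightarrow> bool" where
  "is_rproj x r \<longleftrightarrow> r \<in> M \<and> isproj r \<and> r * x = x \<and>
     (\<forall>q\<in>M. isproj q \<longrightarrow> q * x = x \<longrightarrow> r * q = r)"

text \<open>\<open>r\<close> projects onto the closed range of \<open>x\<close>, which inherits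
  invariance under the commutant. The last clause, that whatever kills \<open>x\<close> kills
  \<open>r\<close>, turns a zero product into a relation with projections.\<close>

lemma rproj_exists:
  assumes x: "x \<in> M"
  shows "\<exists>r. is_rproj x r \<and> (\<forall>s. s * x = 0 \<longrightarrow> s * r = 0)"
proof -
  let ?S = "closure (range (app x))"
  have S: "csubspace ?S" "closed ?S" by (auto simp: csubspace_closure csubspace_range_app)
  obtain r where r: "projects_onto r ?S" using projects_onto_exists[OF S] by blast
  have min: "?S \<subseteq> T" if "closed T" "\<And>v. app x v \<in> T" for T
    using that by (intro closure_minimal) auto
  have inS: "app x v \<in> ?S" for v using closure_subset[of "range (app x)"] by blast
  have rM: "r \<in> M"
  proof (rule projects_onto_mem[OF r])
    fix t v assume t: "t \<in> cmt M" and v: "v \<in> ?S"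
    have "?S \<subseteq> {v. app t v \<in> ?S}"
    proof (rule min[OF closed_app_vimage[OF S(2)]])
      fix v
      have "app t (app x v) = app x (app t v)"
        using cmtD[OF t x] by (metis app_simps(5))
      then show "app x v \<in> {v. app t v \<in> ?S}" using inS by simp
    qed
    with v show "app t v \<in> ?S" by blast
  qed
  have rx: "r * x = x"
    using r inS by (auto intro!: bop_eqI simp: projects_onto_def)
  have supp: "s * r = 0" if "s * x = 0" for s
  proof -
    have "?S \<subseteq> {v. app s v \<in> {0}}"
      by (rule min[OF closed_app_vimage]) (use that in \<open>auto simp flip: app_simps(5)\<close>)
    then show ?thesis using r by (auto intro!: bop_eqI simp: projects_onto_def)
  qed
  have "r * q = r" if "q \<in> M" "isproj q" "q * x = x" for q
  proof -
    have "(q - 1) * r = 0" by (rule supp) (simp add: left_diff_distrib that)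
    then have "q * r = r" by (simp add: left_diff_distrib)
    then show ?thesis using r that(2) by (metis isproj_def projects_onto_def star_simps(1))
  qed
  then have "is_rproj x r" using rM rx r by (auto simp: is_rproj_def projects_onto_def)
  with supp show ?thesis by blast
qed

definition is_cproj :: "'a bop \<Rightarrow> bool" where
  "is_cproj z \<longleftrightarrow> z \<in> M \<and> isproj z \<and> (\<forall>a\<in>M. z * a = a * z)"

definition is_csupp :: "'a bop \<Rightarrow> 'a bop \<Rightarrow> bool" where
  "is_csupp e z \<longleftrightarrow> is_cproj z \<and> z * e = e \<and> (\<forall>w. is_cproj w \<longrightarrow> w * e = e \<longrightarrow> z * w = z)"

lemma csupp_unique: "is_csupp e z \<Longrightarrow> is_csupp e w \<Longrightarrow> z = w"
  unfolding is_csupp_def is_cproj_def by metis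

text \<open>\<open>z\<close> projects onto the closed subspace generated by the ranges of all
  \<open>a * e\<close>. This subspace is invariant under \<open>M\<close> and under its commutant,
  so \<open>z\<close> is central, and an operator killing every \<open>a * e\<close> kills the
  subspace.\<close>

lemma csupp_exists':
  assumes e: "e \<in> M"
  shows "\<exists>z. is_csupp e z \<and> (\<forall>q. (\<forall>a\<in>M. q * a * e = 0) \<longrightarrow> q * z = 0)"
proof -
  define S where "S = \<Inter>{T. closed T \<and> csubspace T \<and> (\<forall>a\<in>M. \<forall>v. app a (app e v) \<in> T)}"
  have cl: "closed S" unfolding S_def by (rule closed_Inter) blast
  have sub: "csubspace S" unfolding csubspace_def S_def Inter_iff by (simp add: csubspace_def)
  have gen: "app a (app e v) \<in> S" if "a \<in> M" for a v using that unfolding S_def by blast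
  have min: "S \<subseteq> T" if "closed T" "csubspace T" "\<And>a v. a \<in> M \<Longrightarrow> app a (app e v) \<in> T" for T
    using that unfolding S_def by blast
  obtain z where z: "projects_onto z S" using projects_onto_exists[OF sub cl] by blast
  have inv: "app t v \<in> S" if t: "\<And>a v. a \<in> M \<Longrightarrow> app t (app a (app e v)) \<in> S" and v: "v \<in> S" for t v
    using min[OF closed_app_vimage[OF cl] csubspace_app_vimage[OF sub], of t] t v by blast
  have zM: "z \<in> M"
  proof (rule projects_onto_mem[OF z inv])
    fix t a v assume "t \<in> cmt M" "a \<in> M"
    then have "app t (app a (app e v)) = app a (app e (app t v))"
      using cmtD[of t "a * e"] e by (metis app_simps(5) mult_mem)
    then show "app t (app a (app e v)) \<in> S" using gen \<open>a \<in> M\<close> by simp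
  qed
  have "z * b = b * z" if "b \<in> M" for b
  proof (rule projects_onto_commute[OF z, symmetric])
    have "app c v \<in> S" if "c \<in> M" "v \<in> S" for c v
      by (rule inv[OF _ that(2)]) (metis app_simps(5) gen mult_mem that(1))
    then show "app b x \<in> S" "app (star b) x \<in> S" if "x \<in> S" for x
      using that \<open>b \<in> M\<close> star_mem by auto
  qed
  then have "is_cproj z" using zM z by (auto simp: is_cproj_def projects_onto_def)
  moreover have supp: "q * z = 0" if "\<And>a. a \<in> M \<Longrightarrow> q * a * e = 0" for q
  proof -
    have "app q (app a (app e v)) = 0" if "a \<in> M" for a v
      using \<open>\<And>a. a \<in> M \<Longrightarrow> q * a * e = 0\<close>[OF that] by (metis app_simps(1,5))
    then have "S \<subseteq> {v. app q v \<in> {0}}"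
      by (intro min closed_app_vimage csubspace_app_vimage csubspace_zero) auto
    then show ?thesis using z by (auto intro!: bop_eqI simp: projects_onto_def)
  qed
  moreover have "z * e = e"
    using z gen[of 1] by (auto intro!: bop_eqI simp: projects_onto_def)
  moreover have "z * w = z" if w: "is_cproj w" "w * e = e" for w
  proof -
    have "(w - 1) * a * e = 0" if "a \<in> M" for a
    proof -
      have "w * a * e = a * (w * e)" using w(1) that by (metis is_cproj_def mult.assoc)
      then show ?thesis by (simp add: w(2) left_diff_distrib)
    qed
    then have "(w - 1) * z = 0" by (intro supp)
    then have "w * z = z" by (simp add: left_diff_distrib)
    then show ?thesis using w zM by (metis is_cproj_def)
  qed
  ultimately show ?thesis by (auto simp: is_csupp_def)
qed

lemma csupp_exists: "e \<in> M \<Longrightarrow> \<exists>z. is_csupp e z"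
  using csupp_exists' by blast

text \<open>This is the source of the partial isometries between minimal projections: a
  \<open>q\<close> not killed by the central support of \<open>e\<close> is linked to
  \<open>e\<close> by an element of the algebra.\<close>

lemma csupp_separates:
  assumes "is_csupp e z" "e \<in> M" "q * z \<noteq> 0"
  shows "\<exists>a\<in>M. q * a * e \<noteq> 0"
  using csupp_exists'[OF assms(2)] csupp_unique[OF assms(1)] assms(3) by blast

section \<open>Minimal projections\<close>

definition mp :: "'a bop \<Rightarrow> bool" where
  "mp p \<longleftrightarrow> p \<in> M \<and> isproj p \<and> p \<noteq> 0 \<and> (\<forall>a\<in>M. \<exists>\<mu>. p * a * p = scaleC \<mu> p)"

lemma mpD: "mp p \<Longrightarrow> p \<in> M" "mp p \<Longrightarrow> p * p = p" "mp p \<Longrightarrow> star p = p" "mp p \<Longrightarrow> p \<noteq> 0"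
  "mp p \<Longrightarrow> isproj p"
  by (auto simp: mp_def isproj_def)

text \<open>By minimality of \<open>g\<close>, the element \<open>star b * b\<close> of
  \<open>g M g\<close> is a multiple of \<open>g\<close>, and the factor is positive. Dividing
  \<open>b\<close> by its square root gives a partial isometry that carries the minimality of
  \<open>g\<close> over to \<open>v * star v\<close>.\<close>

lemma mp_transport:
  assumes g: "mp g" and b: "b \<in> M" "b * g = b" "b \<noteq> 0"
  shows "\<exists>v\<in>M. star v * v = g \<and> v * g = v \<and> mp (v * star v) \<and> (\<exists>c. v = scaleC c b)"
proof -
  have "star b * b = g * (star b * b) * g"
    using b(2) g by (metis mpD(3) mult.assoc star_simps(1))
  moreover have "star b * b \<in> M" using b(1) star_mem by simp
  then obtain \<mu> where "g * (star b * b) * g = scaleC \<mu> g"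
    using g unfolding mp_def by blast
  ultimately have \<mu>: "star b * b = scaleC \<mu> g" by simp
  obtain x where x: "app b x \<noteq> 0" using b(3) by (metis app_simps(1) bop_eqI)
  have "complex_of_real ((norm (app b x))\<^sup>2) = \<mu> * of_real ((norm (app g x))\<^sup>2)"
    using cinner_star_mult[of x b] cinner_star_mult[of x g] mpD(2,3)[OF g]
    by (simp add: \<mu> cinner_scaleC_right)
  moreover have gx: "app g x \<noteq> 0" using x b(2) by (metis app_simps(5) app_zero)
  ultimately have "\<mu> = of_real ((norm (app b x))\<^sup>2 / (norm (app g x))\<^sup>2)"
    by (simp add: field_simps)
  then obtain m :: real where m: "\<mu> = of_real m" "m > 0"
    using x gx by (metis divide_pos_pos zero_less_norm_iff zero_less_power)
  define v where "v = scaleC (of_real (1 / sqrt m)) b"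
  have vM: "v \<in> M" using b by (simp add: v_def)
  have vg: "v * g = v" by (simp add: v_def b(2))
  have sv: "star v * v = g"
    using m(2) by (simp add: v_def \<mu> m(1) scaleC_scaleC scaleC_one flip: of_real_mult)
  have vv: "v * star v * (v * star v) = v * star v"
    by (metis mult.assoc sv vg)
  have "isproj (v * star v)" by (simp add: isproj_def vv)
  moreover have "v * star v \<noteq> 0"
  proof
    assume "v * star v = 0"
    then have "star v = 0" using star_mult_eq_0[of "star v"] by simp
    then show False using sv mpD(4)[OF g] by simp
  qed
  moreover have "\<exists>\<nu>. v * star v * a * (v * star v) = scaleC \<nu> (v * star v)" if "a \<in> M" for a
  proof -
    have "star v * a * v \<in> M" using vM that star_mem by simp
    then obtain \<nu> where \<nu>: "g * (star v * a * v) * g = scaleC \<nu> g"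
      using g unfolding mp_def by blast
    have gv: "g * star v = star v" using arg_cong[OF vg, of star] mpD(3)[OF g] by simp
    have "v * star v * a * (v * star v) = v * (g * (star v * a * v) * g) * star v"
      by (metis vg gv mult.assoc)
    also have "\<dots> = scaleC \<nu> (v * star v)" by (simp add: \<nu> vg)
    finally show ?thesis by blast
  qed
  ultimately have "mp (v * star v)" using vM by (auto simp: mp_def star_mem)
  with vM vg sv v_def show ?thesis by blast
qed

lemma mp_below:
  assumes g: "mp g" and q: "q \<in> M" "isproj q" and a: "a \<in> M" "q * a * g \<noteq> 0"
  shows "\<exists>v\<in>M. star v * v = g \<and> v * g = v \<and> mp (v * star v) \<and> q * v = v"
proof -
  have "q * a * g * g = q * a * g" by (simp add: mult.assoc mpD(2)[OF g])
  then obtain v c where v: "v \<in> M" "star v * v = g" "v * g = v" "mp (v * star v)"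
    and c: "v = scaleC c (q * a * g)"
    using mp_transport[OF g, of "q * a * g"] q a mpD(1)[OF g] by blast
  have "q * v = v" using q(2) by (simp add: c isproj_def flip: mult.assoc)
  with v show ?thesis by blast
qed

lemma mp_le_mp:
  assumes "mp u" "mp f" "f * u = u"
  shows "u = f"
proof -
  have "u = f * u * f" using assms isproj_le_commute by (metis mpD(3) star_simps(1))
  then obtain \<mu> where \<mu>: "u = scaleC \<mu> f" using assms(1,2) unfolding mp_def by metis
  have "scaleC (\<mu> * \<mu> - \<mu>) f = 0"
    using mpD(2)[OF assms(1)] mpD(2)[OF assms(2)] by (simp add: \<mu> scaleC_scaleC scaleC_diff_left)
  then have "\<mu> * \<mu> = \<mu>" using mpD(4)[OF assms(2)] by (simp add: scaleC_eq_0_iff)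
  moreover have "\<mu> \<noteq> 0" using mpD(4)[OF assms(1)] \<mu> by auto
  ultimately show ?thesis by (simp add: \<mu> scaleC_one)
qed

text \<open>If \<open>z * p\<close> is non-zero, some partial isometry \<open>v\<close> starts at
  \<open>p\<close> and ends below \<open>z\<close>; centrality pulls \<open>z\<close> out of
  \<open>p = star v * (z * v)\<close>.\<close>

lemma mp_central:
  assumes "mp p" "is_cproj z"
  shows "z * p = p \<or> z * p = 0"
proof (rule disjCI)
  assume n: "z * p \<noteq> 0"
  then have "z * 1 * p \<noteq> 0" by simp
  then obtain v where v: "v \<in> M" "star v * v = p" "v * p = v" "z * v = v"
    using mp_below[of p z 1] assms by (auto simp: is_cproj_def)
  have "p = star v * (z * v)" using v by simp
  also have "\<dots> = z * (star v * v)" using star_mem[OF v(1)] assms(2) by (metis is_cproj_def mult.assoc)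
  finally show "z * p = p" using v(2) by simp
qed

text \<open>The units of the summands \<open>B(H\<^sub>\<lambda>)\<close> of the atomic part.\<close>
definition cclass :: "'a bop \<Rightarrow> bool" where
  "cclass z \<longleftrightarrow> (\<exists>g. mp g \<and> is_csupp g z)"

lemma cclass_cproj: "cclass z \<Longrightarrow> is_cproj z"
  by (auto simp: cclass_def is_csupp_def)

lemma cclassD: "cclass z \<Longrightarrow> z \<in> M" "cclass z \<Longrightarrow> isproj z" "cclass z \<Longrightarrow> a \<in> M \<Longrightarrow> z * a = a * z"
  "cclass z \<Longrightarrow> z * z = z"
  using cclass_cproj by (auto simp: is_cproj_def isproj_def)

text \<open>Each of the two minimal projections is either contained in the other central support or
  killed by it. Containment makes the supports comparable. If both are killed, then
  \<open>z * a * q = a * (z * q) = 0\<close> for all \<open>a\<close>, and separation gives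
  \<open>z * w = 0\<close>.\<close>

lemma cclass_orthogonal:
  assumes "cclass z" "cclass w" "z \<noteq> w"
  shows "z * w = 0"
proof -
  obtain p q where p: "mp p" "is_csupp p z" and q: "mp q" "is_csupp q w"
    using assms by (auto simp: cclass_def)
  note c = cclassD[OF assms(1)] cclassD[OF assms(2)]
  have main: "z = w \<or> z * w = 0" if zw: "z * w = z" and p: "is_csupp p z" and q: "is_csupp q w" "mp q"
    and z: "cclass z" and w: "cclass w" for z w p q
  proof -
    from mp_central[OF q(2) cclass_cproj[OF z]] show ?thesis
    proof
      assume "z * q = q"
      then have "w * z = w" using q(1) cclass_cproj[OF z] by (auto simp: is_csupp_def)
      then show ?thesis using zw cclassD(3)[OF z] cclassD(1)[OF w] by metis
    next
      assume zq: "z * q = 0"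
      have "w * z = z" using zw cclassD(3)[OF z] cclassD(1)[OF w] by metis
      \<comment> \<open>With \<open>z\<close> below \<open>w\<close> and \<open>z * q = 0\<close>,
        the smaller central projection \<open>w - z\<close> still contains \<open>q\<close>, so
        minimality of the central support \<open>w\<close> forces \<open>w * z = 0\<close>.\<close>
      have "(w - z) * a = a * (w - z)" if "a \<in> M" for a
        using cclassD(3)[OF z that] cclassD(3)[OF w that]
        by (simp only: left_diff_distrib right_diff_distrib)
      then have "is_cproj (w - z)"
        using isproj_diff[OF cclassD(2)[OF z] cclassD(2)[OF w] zw] cclassD(1)[OF z] cclassD(1)[OF w]
        by (auto simp: is_cproj_def)
      moreover have "(w - z) * q = q" using q(1) zq by (simp add: left_diff_distrib is_csupp_def)
      ultimately have "w * (w - z) = w" using q(1) by (auto simp: is_csupp_def)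
      then have "w * z = 0" by (simp add: right_diff_distrib cclassD(4)[OF w])
      then show ?thesis using \<open>w * z = z\<close> zw by simp
    qed
  qed
  from mp_central[OF p(1) cclass_cproj[OF assms(2)]] show ?thesis
  proof
    assume "w * p = p"
    then have "z * w = z" using p(2) cclass_cproj[OF assms(2)] by (auto simp: is_csupp_def)
    then show ?thesis using main p q assms by blast
  next
    assume wp: "w * p = 0"
    from mp_central[OF q(1) cclass_cproj[OF assms(1)]] show ?thesis
    proof
      assume "z * q = q"
      then have "w * z = w" using q(2) cclass_cproj[OF assms(1)] by (auto simp: is_csupp_def)
      then show ?thesis using main[of w z q p] p q assms c by metis
    next
      assume "z * q = 0"
      show ?thesis
      proof (rule ccontr)
        assume "z * w \<noteq> 0"
        then obtain a where a: "a \<in> M" "z * a * q \<noteq> 0"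
          using csupp_separates[OF q(2) mpD(1)[OF q(1)]] by blast
        have "z * a * q = a * (z * q)" using c(3)[OF a(1)] by (simp add: mult.assoc)
        then show False using a(2) \<open>z * q = 0\<close> by simp
      qed
    qed
  qed
qed

text \<open>Atomicity of a summand: an element linking \<open>g\<close> to \<open>q\<close>
  transports the minimality of \<open>g\<close> below \<open>q\<close>.\<close>

lemma cclass_subprojection:
  assumes "cclass z" "q \<in> M" "isproj q" "q * z = q" "q \<noteq> 0"
  shows "\<exists>u. mp u \<and> q * u = u"
proof -
  obtain g where g: "mp g" "is_csupp g z" using assms(1) by (auto simp: cclass_def)
  obtain a where a: "a \<in> M" "q * a * g \<noteq> 0"
    using csupp_separates[OF g(2) mpD(1)[OF g(1)], of q] assms by auto
  obtain v where "mp (v * star v)" "q * v = v" using mp_below[OF g(1) assms(2,3) a] by blast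
  then show ?thesis by (intro exI[of _ "v * star v"]) (simp flip: mult.assoc)
qed

text \<open>Both projections are equivalent to the minimal \<open>g\<close> that defines the class:
  a transported copy of \<open>g\<close> below a minimal \<open>f\<close> must be \<open>f\<close>
  itself. The two partial isometries are then composed through \<open>g\<close>.\<close>

lemma cclass_equiv:
  assumes z: "cclass z" and l: "mp l" "z * l = l" and k: "mp k" "z * k = k"
  shows "\<exists>v\<in>M. v * star v = l \<and> star v * v = k"
proof -
  obtain g where g: "mp g" "is_csupp g z" using z by (auto simp: cclass_def)
  have *: "\<exists>v\<in>M. star v * v = g \<and> v * star v = f \<and> v * g = v" if f: "mp f" "z * f = f" for f
  proof -
    have "f * z \<noteq> 0" using f cclassD(3)[OF z] mpD(1,4) by metis
    then obtain a where a: "a \<in> M" "f * a * g \<noteq> 0"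
      using csupp_separates[OF g(2) mpD(1)[OF g(1)], of f] by auto
    obtain v where v: "v \<in> M" "star v * v = g" "v * g = v" "mp (v * star v)" "f * v = v"
      using mp_below[OF g(1) mpD(1)[OF f(1)] mpD(5)[OF f(1)] a] by blast
    have "f * (v * star v) = v * star v" using v(5) by (simp flip: mult.assoc)
    then have "v * star v = f" using mp_le_mp[OF v(4) f(1)] by simp
    with v show ?thesis by blast
  qed
  obtain v w where v: "v \<in> M" "star v * v = g" "v * star v = l" "v * g = v"
    and w: "w \<in> M" "star w * w = g" "w * star w = k" "w * g = w" using *[OF l] *[OF k] by metis
  have "v * star w * star (v * star w) = l" 
    using v w by (metis mult.assoc star_simps(1) star_star)
  moreover have "star (v * star w) * (v * star w) = k"
    using v w by (metis mult.assoc star_simps(1) star_star)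
  ultimately show ?thesis using v(1) w(1) star_mem by (intro bexI[of _ "v * star w"]) auto
qed

end

section \<open>Finite orthogonal families, splitting and the zero product theorem\<close>

context vna
begin

text \<open>These are the families whose sizes \<open>atomic_dim\<close> takes the supremum of; rank
  and dimension are handled through them.\<close>

definition fam :: "'a bop \<Rightarrow> 'a bop set \<Rightarrow> bool" where
  "fam q F \<longleftrightarrow> finite F \<and> (\<forall>p\<in>F. mp p \<and> p * q = p) \<and> (\<forall>p\<in>F. \<forall>p'\<in>F. p \<noteq> p' \<longrightarrow> p * p' = 0)"

lemma famD: "fam q F \<Longrightarrow> finite F" "fam q F \<Longrightarrow> p \<in> F \<Longrightarrow> mp p" "fam q F \<Longrightarrow> p \<in> F \<Longrightarrow> p * q = p"
  "fam q F \<Longrightarrow> p \<in> F \<Longrightarrow> p' \<in> F \<Longrightarrow> p \<noteq> p' \<Longrightarrow> p * p' = 0"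
  unfolding fam_def by blast+

lemma fam_subset: "fam q F \<Longrightarrow> G \<subseteq> F \<Longrightarrow> fam q G"
  unfolding fam_def by (meson finite_subset subsetD)

lemma fam_mono: "fam q F \<Longrightarrow> q * q' = q \<Longrightarrow> fam q' F"
  unfolding fam_def by (metis mult.assoc)

lemma fam_mult_sum:
  assumes "fam q F" "p \<in> F"
  shows "p * \<Sum>F = p" "\<Sum>F * p = p"
proof -
  have "p * \<Sum>F = (\<Sum>p'\<in>F. if p' = p then p else 0)"
    unfolding sum_distrib_left using famD(4)[OF assms(1,2)] mpD(2)[OF famD(2)[OF assms]]
    by (intro sum.cong) auto
  then show "p * \<Sum>F = p" using assms(2) famD(1)[OF assms(1)] by simp
  have "\<Sum>F * p = (\<Sum>p'\<in>F. if p' = p then p else 0)"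
    unfolding sum_distrib_right using famD(4)[OF assms(1) _ assms(2)] mpD(2)[OF famD(2)[OF assms]]
    by (intro sum.cong) auto
  then show "\<Sum>F * p = p" using assms(2) famD(1)[OF assms(1)] by simp
qed

lemma fam_sum_proj:
  assumes F: "fam q F"
  shows "\<Sum>F \<in> M" "isproj (\<Sum>F)" "\<Sum>F * q = \<Sum>F"
proof -
  show "\<Sum>F \<in> M" using famD(2)[OF F] mpD(1) by (intro sum_mem) auto
  have "\<Sum>F * \<Sum>F = \<Sum>F"
    unfolding sum_distrib_right using fam_mult_sum(1)[OF F] by (intro sum.cong) auto
  moreover have "star (\<Sum>F) = \<Sum>F"
    unfolding star_sum using mpD(3)[OF famD(2)[OF F]] by (intro sum.cong) auto
  ultimately show "isproj (\<Sum>F)" by (simp add: isproj_def)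
  show "\<Sum>F * q = \<Sum>F"
    unfolding sum_distrib_right using famD(3)[OF F] by (intro sum.cong) auto
qed

lemma fam_extend:
  assumes F: "fam q F" and q: "isproj q" and u: "mp u" "(q - \<Sum>F) * u = u"
  shows "fam q (insert u F)" "u \<notin> F"
proof -
  note S = fam_sum_proj[OF F]
  have qS: "q * \<Sum>F = \<Sum>F" using isproj_le_commute[OF S(2) q S(3)] .
  have Su: "\<Sum>F * u = 0"
  proof -
    have "\<Sum>F * u = \<Sum>F * ((q - \<Sum>F) * u)" using u(2) by simp
    also have "\<dots> = (\<Sum>F * q - \<Sum>F * \<Sum>F) * u" by (simp add: right_diff_distrib flip: mult.assoc)
    also have "\<dots> = 0" using S by (simp add: isproj_def)
    finally show ?thesis .
  qed
  then have qu: "q * u = u" using u(2) by (simp add: left_diff_distrib)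
  then have uq: "u * q = u" using q mpD(3)[OF u(1)] by (metis isproj_def star_simps(1))
  have pu: "p * u = 0" if "p \<in> F" for p
    using fam_mult_sum(1)[OF F that] Su by (metis mult.assoc mult_zero_right)
  have up: "u * p = 0" if "p \<in> F" for p
    using arg_cong[OF pu[OF that], of star] mpD(3)[OF u(1)] mpD(3)[OF famD(2)[OF F that]] by simp
  show "u \<notin> F" using pu[of u] mpD(2,4)[OF u(1)] by auto
  show "fam q (insert u F)" using F pu up uq u(1) unfolding fam_def by auto
qed

lemma mp_unit_vector: "mp p \<Longrightarrow> \<exists>u. app p u = u \<and> norm u = 1"
proof -
  assume p: "mp p"
  obtain x where x: "app p x \<noteq> 0" using mpD(4)[OF p] by (metis app_simps(1) bop_eqI)
  let ?u = "scaleR (1 / norm (app p x)) (app p x)"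
  have "app p (app p x) = app p x" using mpD(2)[OF p] by (metis app_simps(5))
  then have "app p ?u = ?u" by (simp add: scaleR_scaleC app_scaleC)
  moreover have "norm ?u = 1" using x by simp
  ultimately show ?thesis by blast
qed

text \<open>The trace of the product of two rank one projections does not depend on their order.\<close>
lemma mp_overlap_symmetric:
  assumes f: "mp f" and g: "mp g" and x: "app f x = x" "norm x = 1" and y: "app g y = y" "norm y = 1"
  shows "(norm (app g x))\<^sup>2 = (norm (app f y))\<^sup>2"
proof -
  obtain s where s: "f * g * f = scaleC s f" using f g mpD(1) unfolding mp_def by blast
  obtain t where t: "g * f * g = scaleC t g" using f g mpD(1) unfolding mp_def by blast
  have "app f (app g x) = scaleC s x" using arg_cong[OF s, of "\<lambda>a. app a x"] x by simp
  then have ns: "complex_of_real ((norm (app g x))\<^sup>2) = s"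
    using cinner_star_mult[of x g] mpD(2,3)[OF g] cinner_star[of f x "app g x"] mpD(3)[OF f] x
    by (simp add: cinner_scaleC_right cinner_self)
  have "app g (app f y) = scaleC t y" using arg_cong[OF t, of "\<lambda>a. app a y"] y by simp
  then have nt: "complex_of_real ((norm (app f y))\<^sup>2) = t"
    using cinner_star_mult[of y f] mpD(2,3)[OF f] cinner_star[of g y "app f y"] mpD(3)[OF g] y
    by (simp add: cinner_scaleC_right cinner_self)
  \<comment> \<open>The alternating word of length five is evaluated in two ways, by collapsing its
    inner triple and as a product of two triples. Starting from \<open>g\<close> this gives
    \<open>s * t = t * t\<close>, starting from \<open>f\<close> it gives
    \<open>t * s = s * s\<close>.\<close>
  have "scaleC (s * t) g = g * (f * g * f) * g" by (simp add: s t scaleC_scaleC)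
  also have "\<dots> = g * f * g * (g * f * g)" using mpD(2)[OF g] by (metis mult.assoc)
  also have "\<dots> = scaleC (t * t) g" by (simp add: t scaleC_scaleC mpD(2)[OF g])
  finally have "scaleC (s * t - t * t) g = 0" by (simp add: scaleC_diff_left)
  then have g1: "s * t = t * t" using mpD(4)[OF g] by (simp add: scaleC_eq_0_iff)
  have "scaleC (t * s) f = f * (g * f * g) * f" by (simp add: s t scaleC_scaleC)
  also have "\<dots> = f * g * f * (f * g * f)" using mpD(2)[OF f] by (metis mult.assoc)
  also have "\<dots> = scaleC (s * s) f" by (simp add: s scaleC_scaleC mpD(2)[OF f])
  finally have "scaleC (t * s - s * s) f = 0" by (simp add: scaleC_diff_left)
  then have "t * s = s * s" using mpD(4)[OF f] by (simp add: scaleC_eq_0_iff)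
  with g1 have "s = t" by (metis mult.commute mult_cancel_right)
  then show ?thesis using ns nt by (metis of_real_eq_iff)
qed

text \<open>A trace argument by double counting of squared overlaps of unit vectors. For each
  \<open>f\<close>, the sum over \<open>G\<close> is 1 because \<open>G\<close> fills
  \<open>z\<close>; for each \<open>g\<close>, the sum over \<open>F\<close> is at most 1 because
  \<open>\<Sum>F\<close> is a projection.\<close>

lemma fam_card_le:
  assumes G: "fam z G" "\<Sum>G = z" and F: "fam z F"
  shows "card F \<le> card G"
proof -
  obtain u where u: "\<And>p. mp p \<Longrightarrow> app p (u p) = u p \<and> norm (u p) = 1"
    using mp_unit_vector by metis
  have fin: "finite F" "finite G" using famD(1) F G by auto
  have sum_norm: "(\<Sum>p\<in>H. (norm (app p x))\<^sup>2) = (norm (app (\<Sum>H) x))\<^sup>2" if "fam z H" for H x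
  proof -
    have "(norm (app (\<Sum>H) x))\<^sup>2 = Re (cinner x (app (\<Sum>H) x))"
      by (rule isproj_norm_sq[OF fam_sum_proj(2)[OF that]])
    also have "\<dots> = Re (cinner x (\<Sum>p\<in>H. app p x))" by (simp add: app_sum)
    also have "\<dots> = (\<Sum>p\<in>H. (norm (app p x))\<^sup>2)"
      using mpD(5)[OF famD(2)[OF that]] by (simp add: cinner_sum_right isproj_norm_sq)
    finally show ?thesis by simp
  qed
  have "real (card F) = (\<Sum>f\<in>F. (norm (u f))\<^sup>2)"
    using u famD(2)[OF F] by simp
  also have "\<dots> = (\<Sum>f\<in>F. \<Sum>g\<in>G. (norm (app g (u f)))\<^sup>2)"
  proof (rule sum.cong[OF refl])
    fix f assume f: "f \<in> F"
    have "f * z = f" "star f = f" "star z = z"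
      using famD(3)[OF F f] mpD(3)[OF famD(2)[OF F f]] fam_sum_proj(2)[OF G(1)] G(2) by (auto simp: isproj_def)
    then have "z * f = f" by (metis star_simps(1))
    then have "app z (u f) = u f" using u[OF famD(2)[OF F f]] by (metis app_simps(5))
    then show "(norm (u f))\<^sup>2 = (\<Sum>g\<in>G. (norm (app g (u f)))\<^sup>2)"
      using sum_norm[OF G(1), of "u f"] G(2) by simp
  qed
  also have "\<dots> = (\<Sum>f\<in>F. \<Sum>g\<in>G. (norm (app f (u g)))\<^sup>2)"
    using u famD(2)[OF F] famD(2)[OF G(1)] by (intro sum.cong refl mp_overlap_symmetric) auto
  also have "\<dots> = (\<Sum>g\<in>G. \<Sum>f\<in>F. (norm (app f (u g)))\<^sup>2)" by (rule sum.swap)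
  also have "\<dots> \<le> (\<Sum>g\<in>G. 1)"
  proof (rule sum_mono)
    fix g assume g: "g \<in> G"
    have "norm (app (\<Sum>F) (u g)) \<le> 1"
      using isproj_norm_le[OF fam_sum_proj(2)[OF F], of "u g"] u[OF famD(2)[OF G(1) g]] by simp
    then show "(\<Sum>f\<in>F. (norm (app f (u g)))\<^sup>2) \<le> 1"
      unfolding sum_norm[OF F] by (simp add: power_le_one)
  qed
  finally show ?thesis by simp
qed

text \<open>As long as \<open>\<Sum>F\<close> differs from \<open>q\<close>, atomicity supplies one
  more minimal projection below the difference; the alternative \<open>\<Sum>F = q\<close> records
  an early stop.\<close>

lemma fam_exists:
  assumes z: "cclass z" and q: "q \<in> M" "isproj q" "q * z = q"
  shows "\<exists>F. fam q F \<and> (card F = n \<or> \<Sum>F = q)"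
proof (induction n)
  case 0
  show ?case by (intro exI[of _ "{}"]) (auto simp: fam_def)
next
  case (Suc n)
  then obtain F where F: "fam q F" "card F = n \<or> \<Sum>F = q" by blast
  show ?case
  proof (cases "\<Sum>F = q")
    case False
    note S = fam_sum_proj[OF F(1)]
    have "(q - \<Sum>F) * z = q - \<Sum>F"
      by (metis S(3) left_diff_distrib mult.assoc q(3))
    then obtain u where u: "mp u" "(q - \<Sum>F) * u = u"
      using cclass_subprojection[OF z, of "q - \<Sum>F"] False isproj_diff[OF S(2) q(2) S(3)] S(1) q(1) by auto
    have "card (insert u F) = Suc n"
      using F False fam_extend(2)[OF F(1) q(2) u] famD(1) by auto
    then show ?thesis using fam_extend(1)[OF F(1) q(2) u] by blast
  qed (use F in blast)
qed

text \<open>The pieces of \<open>e z\<close> and of \<open>(1 - e) z\<close> are minimal projections together with one remainder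
  each, which is non-zero only if plenty of minimal projections have been split off already.\<close>
lemma splitting:
  assumes z: "cclass z" and e: "e \<in> M" "isproj e" and G: "fam z G" "card G = N + 2"
  shows "\<exists>E F. finite E \<and> finite F \<and> E \<subseteq> M \<and> F \<subseteq> M \<and> \<Sum>E = e * z \<and> \<Sum>F = (1 - e) * z \<and>
    (\<forall>p\<in>E. z * p = p \<and> p * e = p) \<and> (\<forall>p\<in>F. z * p = p \<and> e * p = 0) \<and>
    (\<forall>p\<in>insert 0 E. \<forall>q\<in>insert 0 F. \<exists>K. fam z K \<and> card K = N \<and> (\<forall>k\<in>K. p * k = 0 \<and> k * q = 0))"
proof -
  note zM = cclassD(1)[OF z] and zc = cclassD(3)[OF z] and zz = cclassD(4)[OF z] and zp = cclassD(2)[OF z]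
  define f where "f = 1 - e"
  have f: "f \<in> M" "isproj f" using e isproj_diff[of e 1] by (auto simp: f_def)
  have ef: "e * f = 0" "f * e = 0" using e(2) by (simp_all add: f_def isproj_def left_diff_distrib right_diff_distrib)
  have pz: "isproj (p * z)" "p * z * z = p * z" "p * z \<in> M" if "p \<in> M" "isproj p" for p
  proof -
    have "p * z * (p * z) = p * p * (z * z)" using zc[OF that(1)] by (metis mult.assoc)
    then show "isproj (p * z)" using that zz zc[OF that(1)] zp by (simp add: isproj_def)
    show "p * z * z = p * z" "p * z \<in> M" using zz that zM by (simp_all add: mult.assoc)
  qed
  obtain E where E: "fam (e * z) E" "card E = N + 2 \<or> \<Sum>E = e * z"
    using fam_exists[OF z, of "e * z" "N + 2"] pz[OF e] by blast
  obtain F where F: "fam (f * z) F" "card F = N + 2 \<or> \<Sum>F = f * z"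
    using fam_exists[OF z, of "f * z" "N + 2"] pz[OF f] by blast
  have below: "z * p = p \<and> p * a = p \<and> a * p = p" if "fam (a * z) H" "p \<in> H" "a \<in> M" "isproj a" for a H p
  proof -
    have p: "p * (a * z) = p" "star p = p" "p \<in> M"
      using famD[OF that(1)] that(2) mpD by auto
    have pa: "p * a = p" using p zc[OF that(3)] that(4) by (metis isproj_def mult.assoc)
    moreover have "a * p = p" using arg_cong[OF pa, of star] p that(4) by (simp add: isproj_def)
    moreover have "z * p = p" using p zc[OF p(3)] zz by (metis mult.assoc)
    ultimately show ?thesis by blast
  qed
  have EF0: "p * q = 0" "q * p = 0" if "p \<in> E" "q \<in> F" for p q
  proof -
    have "p * q = (p * e) * (f * q)" "q * p = (q * f) * (e * p)"
      using below[OF E(1) that(1) e] below[OF F(1) that(2) f] by simp_all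
    then show "p * q = 0" "q * p = 0" by (metis ef mult.assoc mult_zero_left mult_zero_right)+
  qed
  have fE: "fam z E" and fF: "fam z F"
    using fam_mono[OF E(1) pz(2)[OF e]] fam_mono[OF F(1) pz(2)[OF f]] .
  have "p * p' = 0" if "p \<in> E \<union> F" "p' \<in> E \<union> F" "p \<noteq> p'" for p p'
    using that famD(4)[OF fE] famD(4)[OF fF] EF0 by blast
  moreover have "mp p \<and> p * z = p" if "p \<in> E \<union> F" for p
    using that famD(2,3)[OF fE] famD(2,3)[OF fF] by blast
  ultimately have famz: "fam z (E \<union> F)"
    using famD(1)[OF fE] famD(1)[OF fF] unfolding fam_def by simp
  have fin: "finite E" "finite F" using famD(1) E(1) F(1) by blast+
  have disj: "E \<inter> F = {}"
    by (metis disjoint_iff EF0(1) famD(2)[OF E(1)] mpD(2,4))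
  \<comment> \<open>If neither family reached \<open>N + 2\<close>, both exhaust their projections.
    Then \<open>E \<union> F\<close> sums to \<open>z\<close>, and by the double counting it is at
    least as large as \<open>G\<close>.\<close>
  have card: "N + 2 \<le> card (E \<union> F)"
  proof (cases "card E = N + 2 \<or> card F = N + 2")
    case True
    then show ?thesis
      using card_mono[of "E \<union> F" E] card_mono[of "E \<union> F" F] fin by auto
  next
    case False
    then have "\<Sum>(E \<union> F) = e * z + f * z"
      using E F fin disj by (simp add: sum.union_disjoint)
    also have "\<dots> = z" by (simp add: f_def left_diff_distrib)
    finally show ?thesis using fam_card_le[OF famz _ G(1)] G(2) by simp
  qed
  \<comment> \<open>The remainder joins as a further piece, possibly zero. It is orthogonal to every
    member of \<open>E\<close>, hence not a member itself, so the new sum is exactly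
    \<open>e * z\<close>.\<close>
  define E' where "E' = insert (e * z - \<Sum>E) E"
  define F' where "F' = insert (f * z - \<Sum>F) F"
  have rem: "r * p = 0" "p * r = 0" if "fam (a * z) H" "a \<in> M" "isproj a" "p \<in> H" "r = a * z - \<Sum>H" for a H p r
  proof -
    have "a * z * p = p" "p * (a * z) = p" using below[OF that(1,4,2,3)] famD(3)[OF that(1,4)] by (simp_all add: mult.assoc)
    then show "r * p = 0" "p * r = 0"
      using fam_mult_sum[OF that(1,4)] that(5) by (simp_all add: left_diff_distrib right_diff_distrib)
  qed
  have rem': "r \<notin> H" "z * r = r" "r * a = r" "a * r = r" "r \<in> M"
    if H: "fam (a * z) H" and a: "a \<in> M" "isproj a" and r: "r = a * z - \<Sum>H" for a H r
  proof -
    show "r \<notin> H" using rem(1)[OF H a _ r, of r] mpD(2,4) famD(2)[OF H] by metis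
    note S = fam_sum_proj[OF H]
    have aS: "a * \<Sum>H = \<Sum>H" "\<Sum>H * a = \<Sum>H" "z * \<Sum>H = \<Sum>H"
      unfolding sum_distrib_left sum_distrib_right using below[OF H _ a] by (auto intro!: sum.cong)
    have "a * z * a = a * z" "a * (a * z) = a * z" "z * (a * z) = a * z"
      using zc[OF a(1)] a(2) zz by (metis isproj_def mult.assoc)+
    then show "z * r = r" "r * a = r" "a * r = r"
      unfolding r using aS by (simp_all add: left_diff_distrib right_diff_distrib)
    show "r \<in> M" unfolding r using S(1) a(1) zM by simp
  qed
  note remE = rem[OF E(1) e _ refl] rem'[OF E(1) e refl]
  note remF = rem[OF F(1) f _ refl] rem'[OF F(1) f refl]
  have E'e: "z * p = p \<and> p * e = p \<and> p \<in> M" if "p \<in> insert 0 E'" for p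
    using that remE below[OF E(1) _ e] mpD(1)[OF famD(2)[OF E(1)]] by (auto simp: E'_def)
  have F'f: "z * p = p \<and> f * p = p \<and> p \<in> M" if "p \<in> insert 0 F'" for p
    using that remF below[OF F(1) _ f] mpD(1)[OF famD(2)[OF F(1)]] by (auto simp: F'_def)
  have pk: "p * k = 0" if p: "p \<in> insert 0 E'" and k: "k \<in> E \<union> F" "k \<noteq> p" for p k
    using k(1)
  proof
    assume "k \<in> F"
    then have "p * k = p * e * (f * k)" using E'e[OF p] below[OF F(1) _ f] by simp
    then show ?thesis using ef(1) by (metis mult.assoc mult_zero_left mult_zero_right)
  next
    assume "k \<in> E"
    then show ?thesis using p k(2) remE(1) famD(4)[OF E(1)] by (auto simp: E'_def)
  qed
  have kq: "k * p = 0" if p: "p \<in> insert 0 F'" and k: "k \<in> E \<union> F" "k \<noteq> p" for p k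
    using k(1)
  proof
    assume "k \<in> E"
    then have "k * p = k * e * (f * p)" using F'f[OF p] below[OF E(1) _ e] by simp
    then show ?thesis using ef(1) by (metis mult.assoc mult_zero_left mult_zero_right)
  next
    assume "k \<in> F"
    then show ?thesis using p k(2) remF(2) famD(4)[OF F(1)] by (auto simp: F'_def)
  qed
  \<comment> \<open>A member of \<open>E \<union> F\<close> different from \<open>p\<close> and
    \<open>q\<close> is orthogonal to both, so at most two members have to be dropped and at least
    \<open>N\<close> remain.\<close>
  have room: "\<exists>K. fam z K \<and> card K = N \<and> (\<forall>k\<in>K. p * k = 0 \<and> k * q = 0)"
    if p: "p \<in> insert 0 E'" and q: "q \<in> insert 0 F'" for p q
  proof -
    have "card {p, q} \<le> 2" by (simp add: card_insert_if)
    then have "N \<le> card (E \<union> F - {p, q})"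
      using card diff_card_le_card_Diff[of "{p, q}" "E \<union> F"] by simp
    then obtain K where K: "K \<subseteq> E \<union> F - {p, q}" "card K = N"
      using obtain_subset_with_card_n by metis
    then have "fam z K" using fam_subset[OF famz] by blast
    then show ?thesis using K pk[OF p] kq[OF q] by blast
  qed
  have "\<Sum>E' = e * z" "\<Sum>F' = (1 - e) * z"
    using remE(3) remF(3) fin by (simp_all add: E'_def F'_def f_def)
  moreover have "e * p = 0" if "p \<in> F'" for p
    using F'f[of p] that ef(1) by (metis insertCI mult.assoc mult_zero_left)
  ultimately show ?thesis
    using fin E'e F'f room by (intro exI[of _ E'] exI[of _ F']) (auto simp: E'_def F'_def)
qed

text \<open>The partial isometries \<open>v l\<close> relocate the intermediate space: the product
  passes through \<open>\<Sum>K\<close> instead of the sum of \<open>I\<close>, and \<open>K\<close>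
  can be placed away from given pieces.\<close>

lemma factor_through:
  assumes z: "cclass z" and I: "finite I" "\<And>l. l \<in> I \<Longrightarrow> mp l \<and> z * l = l \<and> d l \<in> M"
    and K: "fam z K" "card K = card I"
  shows "\<exists>x\<in>M. \<exists>y\<in>M. x * y = (\<Sum>l\<in>I. l * d l) \<and> x * \<Sum>K = x \<and> \<Sum>K * y = y"
proof -
  obtain k where k: "bij_betw k I K"
    using finite_same_card_bij[OF I(1) famD(1)[OF K(1)]] K(2) by auto
  have kK: "k l \<in> K" if "l \<in> I" for l using k that by (auto simp: bij_betw_def)
  have "\<exists>v\<in>M. v * star v = l \<and> star v * v = k l" if l: "l \<in> I" for l
  proof (rule cclass_equiv[OF z])
    show "mp l" "z * l = l" using I(2)[OF l] by auto
    show "mp (k l)" using famD(2)[OF K(1) kK[OF l]] .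
    then show "z * k l = k l"
      using famD(3)[OF K(1) kK[OF l]] cclassD(3)[OF z] mpD(1) by metis
  qed
  then obtain v where v: "\<And>l. l \<in> I \<Longrightarrow> v l \<in> M \<and> v l * star (v l) = l \<and> star (v l) * v l = k l"
    by metis
  have vk: "v l * k l = v l" if l: "l \<in> I" for l
  proof -
    have kk: "k l * k l = k l" "star (k l) = k l" using mpD[OF famD(2)[OF K(1) kK[OF l]]] by auto
    have "star (v l * (1 - k l)) * (v l * (1 - k l)) = (1 - k l) * (star (v l) * v l) * (1 - k l)"
      by (simp add: kk mult.assoc)
    also have "\<dots> = 0" using v[OF l] kk by (simp add: left_diff_distrib right_diff_distrib)
    finally have "v l * (1 - k l) = 0" by (rule star_mult_eq_0)
    then show ?thesis by (simp add: right_diff_distrib)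
  qed
  have kv: "k l * star (v l) = star (v l)" if "l \<in> I" for l
    using arg_cong[OF vk[OF that], of star] mpD(3)[OF famD(2)[OF K(1) kK[OF that]]] by simp
  have vv: "v l * star (v m) = (if l = m then l else 0)" if "l \<in> I" "m \<in> I" for l m
  proof (cases "l = m")
    case False
    then have "k l \<noteq> k m" using k that by (auto simp: bij_betw_def inj_on_def)
    then have "k l * k m = 0" using famD(4)[OF K(1)] kK that by blast
    moreover have "v l * star (v m) = v l * (k l * k m) * star (v m)"
      using vk[OF that(1)] kv[OF that(2)] by (metis mult.assoc)
    ultimately show ?thesis using False by simp
  qed (use v that in auto)
  define x where "x = (\<Sum>l\<in>I. v l)"
  define y where "y = (\<Sum>l\<in>I. star (v l) * d l)"
  have "x * y = (\<Sum>l\<in>I. \<Sum>m\<in>I. v l * (star (v m) * d m))"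
    by (simp add: x_def y_def sum_product)
  also have "\<dots> = (\<Sum>l\<in>I. \<Sum>m\<in>I. if l = m then l * d l else 0)"
    using vv by (intro sum.cong refl) (auto simp flip: mult.assoc)
  also have "\<dots> = (\<Sum>l\<in>I. l * d l)" using I(1) by simp
  finally have "x * y = (\<Sum>l\<in>I. l * d l)" .
  moreover have "x * \<Sum>K = x"
    unfolding x_def sum_distrib_right
    using vk fam_mult_sum(1)[OF K(1) kK] by (intro sum.cong refl) (metis mult.assoc)
  moreover have "\<Sum>K * y = y"
    unfolding y_def sum_distrib_left
    using kv fam_mult_sum(2)[OF K(1) kK] by (intro sum.cong refl) (metis mult.assoc)
  moreover have "x \<in> M" "y \<in> M"
    unfolding x_def y_def using v I(2) star_mem by (auto intro!: sum_mem)
  ultimately show ?thesis by blast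
qed

text \<open>If \<open>\<pi>\<^sub>z(c)\<close> has finite rank, decompose its range projection; otherwise the summand is
  infinite dimensional and the given representation of \<open>c\<close> is good enough.\<close>
lemma rank_decomposition:
  assumes z: "cclass z" and P: "finite P" "\<And>p. p \<in> P \<Longrightarrow> mp p" and c: "c = (\<Sum>p\<in>P. scaleC (\<mu> p) p)"
    and rank: "\<And>R F. is_rproj (z * c) R \<Longrightarrow> fam R F \<Longrightarrow> \<exists>G. fam z G \<and> card G = card F + 2"
  shows "\<exists>I d G. finite I \<and> (\<forall>l\<in>I. mp l \<and> z * l = l \<and> d l \<in> M) \<and> z * c = (\<Sum>l\<in>I. l * d l) \<and>
    fam z G \<and> card G = card I + 2"
proof -
  have cM: "c \<in> M" unfolding c using P(2) mpD(1) by (auto intro!: sum_mem)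
  have zcM: "z * c \<in> M" using cM cclassD(1)[OF z] by simp
  obtain R where R: "is_rproj (z * c) R" using rproj_exists[OF zcM] by blast
  then have RM: "R \<in> M" "isproj R" "R * (z * c) = z * c" by (auto simp: is_rproj_def)
  have "z * (z * c) = z * c" using cclassD(4)[OF z] by (metis mult.assoc)
  then have Rz: "R * z = R" using R cclassD(1,2)[OF z] unfolding is_rproj_def by blast
  let ?J = "{p \<in> P. z * p = p}"
  have zc: "z * c = (\<Sum>p\<in>?J. scaleC (\<mu> p) p)"
  proof -
    have "z * c = (\<Sum>p\<in>P. if z * p = p then scaleC (\<mu> p) p else 0)"
      unfolding c sum_distrib_left
    proof (rule sum.cong[OF refl])
      fix p assume "p \<in> P"
      then show "z * scaleC (\<mu> p) p = (if z * p = p then scaleC (\<mu> p) p else 0)"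
        using mp_central[OF P(2) cclass_cproj[OF z], of p] by auto
    qed
    then show ?thesis using P(1) by (simp add: sum.inter_filter)
  qed
  show ?thesis
  proof (cases "\<exists>n. \<forall>F. fam R F \<longrightarrow> card F \<le> n")
    case True
    then obtain n where n: "\<And>F. fam R F \<Longrightarrow> card F \<le> n" by blast
    have "fam R {}" by (simp add: fam_def)
    then obtain F where F: "fam R F" "\<And>F'. fam R F' \<Longrightarrow> card F' \<le> card F"
      using ex_has_greatest_nat[of "fam R" "{}" card "Suc n"] n by (metis less_Suc_eq_le)
    note S = fam_sum_proj[OF F(1)]
    \<comment> \<open>Otherwise some \<open>p\<close> in the representation of \<open>c\<close> is
      not killed by \<open>R - \<Sum>F\<close>; transporting \<open>p\<close> below this difference
      enlarges \<open>F\<close>, against its maximal size.\<close>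
    have "\<Sum>F * (z * c) = z * c"
    proof (rule ccontr)
      assume "\<not> ?thesis"
      then have "(R - \<Sum>F) * (z * c) \<noteq> 0" using RM(3) by (simp add: left_diff_distrib)
      then have "(\<Sum>p\<in>?J. scaleC (\<mu> p) ((R - \<Sum>F) * p)) \<noteq> 0"
        unfolding zc sum_distrib_left by simp
      then obtain p where p: "p \<in> P" "(R - \<Sum>F) * p \<noteq> 0"
        by (metis (no_types, lifting) mem_Collect_eq scaleC_zero_right sum.neutral)
      then have "(R - \<Sum>F) * 1 * p \<noteq> 0" by simp
      then obtain v where v: "mp (v * star v)" "(R - \<Sum>F) * v = v"
        using mp_below[OF P(2)[OF p(1)], of "R - \<Sum>F" 1] isproj_diff[OF S(2) RM(2) S(3)] S(1) RM(1) by auto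
      have "(R - \<Sum>F) * (v * star v) = v * star v" using v(2) by (simp flip: mult.assoc)
      note ext = fam_extend[OF F(1) RM(2) v(1) this]
      have "card (insert (v * star v) F) = Suc (card F)" using ext(2) famD(1)[OF F(1)] by simp
      then show False using F(2)[OF ext(1)] by simp
    qed
    then have "z * c = (\<Sum>l\<in>F. l * (z * c))" by (simp add: sum_distrib_right)
    moreover have "mp l \<and> z * l = l" if "l \<in> F" for l
    proof
      show l: "mp l" using famD(2)[OF F(1) that] .
      have "l * z = l" using famD(3)[OF F(1) that] Rz by (metis mult.assoc)
      then show "z * l = l" using cclassD(3)[OF z mpD(1)[OF l]] by simp
    qed
    moreover obtain G where "fam z G" "card G = card F + 2" using rank[OF R F(1)] by blast
    ultimately show ?thesis
      using zcM famD(1)[OF F(1)]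
      by (intro exI[of _ F] exI[of _ "\<lambda>_. z * c"] exI[of _ G] conjI ballI) blast+
  next
    case False
    then have "\<exists>F. fam R F \<and> card ?J \<le> card F" by (metis nle_le)
    then obtain F where F: "fam R F" "card ?J \<le> card F" by blast
    \<comment> \<open>A subfamily of exactly \<open>card ?J\<close> members makes the rank condition
      yield the required \<open>card ?J + 2\<close> projections below \<open>z\<close>.\<close>
    obtain F' where F': "F' \<subseteq> F" "card F' = card ?J"
      by (rule obtain_subset_with_card_n[OF F(2)])
    obtain G where "fam z G" "card G = card ?J + 2"
      using rank[OF R fam_subset[OF F(1) F'(1)]] unfolding F'(2) by blast
    moreover have "z * c = (\<Sum>p\<in>?J. p * scaleC (\<mu> p) 1)" unfolding zc by simp
    ultimately show ?thesis
      using P by (intro exI[of _ ?J] exI[of _ "\<lambda>p. scaleC (\<mu> p) 1"] exI[of _ G]) auto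
  qed
qed

text \<open>\<open>D\<close> stands for \<open>T c\<close>: the product property at a single
  \<open>c\<close> says that all factorizations of \<open>c\<close> give the same value. The rank
  condition, an inequality of possibly infinite numbers, is read as: every size reached below
  \<open>R\<close> is reached below \<open>z\<close> with two to spare.\<close>

theorem zero_products:
  fixes \<psi> :: "'a bop \<Rightarrow> 'b::chilbert bop"
  assumes P: "finite P" "\<And>p. p \<in> P \<Longrightarrow> mp p" and c: "c = (\<Sum>p\<in>P. scaleC (\<mu> p) p)"
    and rank: "\<And>z R F. cclass z \<Longrightarrow> is_rproj (z * c) R \<Longrightarrow> fam R F \<Longrightarrow> \<exists>G. fam z G \<and> card G = card F + 2"
    and add: "\<And>a b. a \<in> M \<Longrightarrow> b \<in> M \<Longrightarrow> \<psi> (a + b) = \<psi> a + \<psi> b"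
    and prod: "\<And>a b. a \<in> M \<Longrightarrow> b \<in> M \<Longrightarrow> a * b = c \<Longrightarrow> \<psi> a * \<psi> b = D"
    and ab: "a \<in> M" "b \<in> M" "a * b = 0"
  shows "\<psi> a * \<psi> b = 0"
proof -
  \<comment> \<open>\<open>e\<close> is the right support of \<open>a\<close>, and its second
    property turns \<open>star b * star a = 0\<close> into \<open>e * b = 0\<close>.\<close>
  obtain e where e: "is_rproj (star a) e" "\<And>s. s * star a = 0 \<Longrightarrow> s * e = 0"
    using rproj_exists[OF star_mem[OF ab(1)]] by blast
  have eM: "e \<in> M" "isproj e" and esa: "e * star a = star a" using e(1) by (auto simp: is_rproj_def)
  have ae: "a * e = a" using arg_cong[OF esa, of star] eM(2) by (simp add: isproj_def)
  have "star b * star a = 0" using arg_cong[OF ab(3), of star] by simp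
  then have be: "star b * e = 0" by (rule e(2))
  have eb: "e * b = 0" using arg_cong[OF be, of star] eM(2) by (simp add: isproj_def)
  obtain cs where cs: "\<And>p. p \<in> P \<Longrightarrow> is_csupp p (cs p)"
    using csupp_exists[OF mpD(1)[OF P(2)]] by metis
  \<comment> \<open>The finitely many summands that carry the given representation of
    \<open>c\<close>; their units are orthogonal, so \<open>c\<close> is the sum of its components
    \<open>z * c\<close>.\<close>
  define Z where "Z = cs ` P"
  have finZ: "finite Z" using P(1) by (simp add: Z_def)
  have Zc: "cclass z" if "z \<in> Z" for z using that cs P(2) by (auto simp: Z_def cclass_def)
  have ZM: "\<Sum>Z \<in> M" using Zc cclassD(1) by (auto intro!: sum_mem)
  have Zz: "w * z = (if w = z then z else 0)" if "z \<in> Z" "w \<in> Z" for z w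
    using cclass_orthogonal[OF Zc Zc] cclassD(4)[OF Zc] that by auto
  have sumZz: "z * \<Sum>Z = z" if "z \<in> Z" for z
  proof -
    have "z * \<Sum>Z = (\<Sum>w\<in>Z. if z = w then w else 0)"
      unfolding sum_distrib_left using Zz that by (intro sum.cong) auto
    then show ?thesis using finZ that by simp
  qed
  have "\<Sum>Z * p = p" if p: "p \<in> P" for p
  proof -
    have zp: "cs p * p = p" "cs p \<in> Z" using cs[OF p] p by (auto simp: is_csupp_def Z_def)
    have "\<Sum>Z * cs p = cs p * \<Sum>Z" using cclassD(3)[OF Zc[OF zp(2)] ZM] by simp
    then show ?thesis using sumZz[OF zp(2)] zp(1) by (metis mult.assoc)
  qed
  then have "\<Sum>Z * c = c" unfolding c sum_distrib_left by (intro sum.cong) auto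
  then have cZ: "c = (\<Sum>z\<in>Z. z * c)" by (simp add: sum_distrib_right)
  define decomposes where "decomposes z I d G \<longleftrightarrow> finite I \<and> (\<forall>l\<in>I. mp l \<and> z * l = l \<and> d l \<in> M) \<and>
    z * c = (\<Sum>l\<in>I. l * d l) \<and> fam z G \<and> card G = card I + 2" for z I d G
  have "\<exists>I d G. decomposes z I d G" if "z \<in> Z" for z
    unfolding decomposes_def using rank_decomposition[OF Zc[OF that] P c rank[OF Zc[OF that]]] .
  then obtain I d G where dec: "\<And>z. z \<in> Z \<Longrightarrow> decomposes z (I z) (d z) (G z)" by metis
  have I: "finite (I z)" "z * c = (\<Sum>l\<in>I z. l * d z l)" "fam z (G z)" "card (G z) = card (I z) + 2"
    and Il: "\<And>l. l \<in> I z \<Longrightarrow> mp l \<and> z * l = l \<and> d z l \<in> M" if "z \<in> Z" for z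
    using dec[OF that] unfolding decomposes_def by blast+
  define splits where "splits z E F \<longleftrightarrow> finite E \<and> finite F \<and> E \<subseteq> M \<and> F \<subseteq> M \<and> \<Sum>E = e * z \<and>
    \<Sum>F = (1 - e) * z \<and> (\<forall>p\<in>E. z * p = p \<and> p * e = p) \<and> (\<forall>p\<in>F. z * p = p \<and> e * p = 0) \<and>
    (\<forall>p\<in>insert 0 E. \<forall>q\<in>insert 0 F.
      \<exists>K. fam z K \<and> card K = card (I z) \<and> (\<forall>k\<in>K. p * k = 0 \<and> k * q = 0))" for z E F
  have "\<exists>E F. splits z E F" if "z \<in> Z" for z
    unfolding splits_def using splitting[OF Zc[OF that] eM I(3,4)[OF that]] .
  then obtain E F where sp: "\<And>z. z \<in> Z \<Longrightarrow> splits z (E z) (F z)" by metis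
  have EF: "finite (E z)" "finite (F z)" "E z \<subseteq> M" "F z \<subseteq> M" "\<Sum>(E z) = e * z" "\<Sum>(F z) = (1 - e) * z"
    and Ez: "\<And>p. p \<in> E z \<Longrightarrow> z * p = p \<and> p * e = p"
    and Fz: "\<And>p. p \<in> F z \<Longrightarrow> z * p = p \<and> e * p = 0"
    and room: "\<And>p q. p \<in> insert 0 (E z) \<Longrightarrow> q \<in> insert 0 (F z) \<Longrightarrow>
      \<exists>K. fam z K \<and> card K = card (I z) \<and> (\<forall>k\<in>K. p * k = 0 \<and> k * q = 0)" if "z \<in> Z" for z
    using sp[OF that] unfolding splits_def by blast+
  define pieceE where "pieceE p \<longleftrightarrow> p \<in> M \<and> p * e = p \<and> (\<forall>z\<in>Z. z * p \<in> insert 0 (E z))" for p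
  define pieceF where "pieceF p \<longleftrightarrow> p \<in> M \<and> e * p = 0 \<and> (\<forall>z\<in>Z. z * p \<in> insert 0 (F z))" for p
  have piece: "\<psi> (a * p) * \<psi> (q * b) = 0" if p: "pieceE p" and q: "pieceF q" for p q
  proof -
    have pM: "p \<in> M" "q \<in> M" using p q by (auto simp: pieceE_def pieceF_def)
    have pq: "p * q = 0" using p q unfolding pieceE_def pieceF_def by (metis mult.assoc mult_zero_right)
    \<comment> \<open>\<open>c\<close> is factored summand by summand and the factors are added up;
      \<open>x * z = x\<close> and \<open>z * y = y\<close> make the mixed products vanish.\<close>
    define fac where "fac z x y \<longleftrightarrow> x \<in> M \<and> y \<in> M \<and> x * y = z * c \<and> x * z = x \<and> z * y = y \<and>
      p * y = 0 \<and> x * q = 0" for z x y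
    have "\<exists>x y. fac z x y" if z: "z \<in> Z" for z
    proof -
      obtain K where K: "fam z K" "card K = card (I z)" "\<And>k. k \<in> K \<Longrightarrow> z * p * k = 0 \<and> k * (z * q) = 0"
        using room[OF z, of "z * p" "z * q"] p q z unfolding pieceE_def pieceF_def by blast
      obtain x y where xy: "x \<in> M" "y \<in> M" "x * y = z * c" "x * \<Sum>K = x" "\<Sum>K * y = y"
        using factor_through[OF Zc[OF z] I(1)[OF z] Il[OF z] K(1,2)] unfolding I(2)[OF z, symmetric] by blast
      have Kz: "\<Sum>K * z = \<Sum>K" using fam_sum_proj(3)[OF K(1)] .
      have xz: "x * z = x" using xy(4) Kz by (metis mult.assoc)
      have zK: "z * \<Sum>K = \<Sum>K" using Kz cclassD(3)[OF Zc[OF z] fam_sum_proj(1)[OF K(1)]] by simp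
      have zy: "z * y = y" using xy(5) zK by (metis mult.assoc)
      have "z * p * \<Sum>K = 0" "\<Sum>K * (z * q) = 0"
        unfolding sum_distrib_left sum_distrib_right using K(3) by auto
      moreover have "p * y = z * p * \<Sum>K * y"
        using cclassD(3)[OF Zc[OF z] pM(1)] zy xy(5) by (metis mult.assoc)
      moreover have "x * q = x * (\<Sum>K * (z * q))" using xz xy(4) by (metis mult.assoc)
      ultimately have "p * y = 0" "x * q = 0" by simp_all
      with xy xz zy show ?thesis unfolding fac_def by blast
    qed
    then obtain x y where fac: "\<And>z. z \<in> Z \<Longrightarrow> fac z (x z) (y z)" by metis
    have xy: "x z \<in> M \<and> y z \<in> M \<and> x z * y z = z * c \<and> x z * z = x z
        \<and> z * y z = y z \<and> p * y z = 0 \<and> x z * q = 0" if "z \<in> Z" for z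
      using fac[OF that] unfolding fac_def by blast
    define X where "X = (\<Sum>z\<in>Z. x z)"
    define Y where "Y = (\<Sum>z\<in>Z. y z)"
    have M: "X \<in> M" "Y \<in> M" unfolding X_def Y_def using xy by (auto intro!: sum_mem)
    have "x z * y w = (if z = w then z * c else 0)" if zw: "z \<in> Z" "w \<in> Z" for z w
    proof (cases "z = w")
      case False
      then have "z * w = 0" using Zz[of w z] zw by simp
      moreover have "x z * y w = x z * (z * w) * y w" using xy[OF zw(1)] xy[OF zw(2)] by (metis mult.assoc)
      ultimately show ?thesis using False by simp
    qed (use xy zw in auto)
    then have "X * Y = (\<Sum>z\<in>Z. \<Sum>w\<in>Z. if z = w then z * c else 0)"
      unfolding X_def Y_def sum_product by (intro sum.cong refl) auto
    also have "\<dots> = c" using finZ cZ by simp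
    finally have XY: "X * Y = c" .
    have pY: "p * Y = 0" unfolding Y_def sum_distrib_left using xy by (intro sum.neutral) auto
    have Xq: "X * q = 0" unfolding X_def sum_distrib_right using xy by (intro sum.neutral) auto
    have z1: "a * p * (q * b) = 0" "a * p * Y = 0" "X * (q * b) = 0"
      using pq pY Xq by (metis mult.assoc mult_zero_left mult_zero_right)+
    have apM: "a * p \<in> M" "q * b \<in> M" using pM ab by auto
    \<comment> \<open>After expansion by additivity, the alternating sum of these four equations
      leaves \<open>\<psi> (a * p) * \<psi> (q * b) = 0\<close>.\<close>
    have "\<psi> (a * p + X) * \<psi> (q * b + Y) = D" "\<psi> (a * p + X) * \<psi> Y = D" "\<psi> X * \<psi> (q * b + Y) = D" "\<psi> X * \<psi> Y = D"
      using apM M XY z1 by (auto intro!: prod simp: distrib_left distrib_right)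
    then show ?thesis using add[OF apM(1) M(1)] add[OF apM(2) M(2)]
      by (simp add: distrib_left distrib_right)
  qed
  have sumadd: "\<psi> 0 = 0" "\<And>J f. finite J \<Longrightarrow> (\<And>j. j \<in> J \<Longrightarrow> f j \<in> M) \<Longrightarrow> \<psi> (\<Sum>j\<in>J. f j) = (\<Sum>j\<in>J. \<psi> (f j))"
  proof -
    show 0: "\<psi> 0 = 0" using add[of 0 0] by simp
    show "\<psi> (\<Sum>j\<in>J. f j) = (\<Sum>j\<in>J. \<psi> (f j))" if "finite J" "\<And>j. j \<in> J \<Longrightarrow> f j \<in> M" for J and f :: "'c \<Rightarrow> 'a bop"
      using that by (induction J rule: finite_induct) (auto simp: 0 add sum_mem)
  qed
  have zp0: "w * p = 0" if "z \<in> Z" "w \<in> Z" "w \<noteq> z" "z * p = p" for w z p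
    using Zz[OF that(1,2)] that(3,4) by (metis mult.assoc mult_zero_left)
  have pE: "pieceE p" if "z \<in> Z" "p \<in> E z" for z p
    using that Ez[OF that] EF[OF that(1)] zp0[OF that(1)] unfolding pieceE_def by (metis insertCI subsetD)
  have pF: "pieceF p" if "z \<in> Z" "p \<in> F z" for z p
    using that Fz[OF that] EF[OF that(1)] zp0[OF that(1)] unfolding pieceF_def by (metis insertCI subsetD)
  \<comment> \<open>Off the summands in \<open>Z\<close> nothing of \<open>c\<close> needs room, so
    \<open>r * e\<close> and \<open>r * (1 - e)\<close> are pieces as a whole.\<close>
  define r where "r = 1 - \<Sum>Z"
  have rM: "r \<in> M" using ZM by (simp add: r_def)
  have zr: "z * (r * x) = 0" if "z \<in> Z" for z x
    using sumZz[OF that] by (simp add: r_def right_diff_distrib flip: mult.assoc)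
  have Zcomm: "\<Sum>Z * x = x * \<Sum>Z" if "x \<in> M" for x
    unfolding sum_distrib_left sum_distrib_right using cclassD(3)[OF Zc that] by (intro sum.cong) auto
  have re: "r * e * e = r * e" "e * (r * (1 - e)) = 0"
  proof -
    show "r * e * e = r * e" using eM(2) by (simp add: isproj_def mult.assoc)
    have "e * r = r * e" using Zcomm[OF eM(1)] by (simp add: r_def left_diff_distrib right_diff_distrib)
    then have "e * (r * (1 - e)) = r * (e * (1 - e))" by (metis mult.assoc)
    then show "e * (r * (1 - e)) = 0" using eM(2) by (simp add: isproj_def right_diff_distrib)
  qed
  have pEr: "pieceE (r * e)" unfolding pieceE_def using rM eM zr re by auto
  have pFr: "pieceF (r * (1 - e))" unfolding pieceF_def using rM eM zr re by auto
  have e_sum: "x = r * x + (\<Sum>z\<in>Z. x * z)" if "x \<in> M" for x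
    using Zcomm[OF that] by (simp add: r_def left_diff_distrib flip: sum_distrib_left)
  have A: "\<psi> a * \<psi> (q * b) = 0" if q: "pieceF q" for q
  proof -
    have "a = a * (r * e + (\<Sum>z\<in>Z. e * z))" using e_sum[OF eM(1)] ae by simp
    also have "\<dots> = a * (r * e) + (\<Sum>z\<in>Z. a * (\<Sum>(E z)))"
      using EF by (simp add: distrib_left sum_distrib_left)
    also have "\<dots> = a * (r * e) + (\<Sum>z\<in>Z. \<Sum>p\<in>E z. a * p)" by (simp add: sum_distrib_left)
    finally have "\<psi> a = \<psi> (a * (r * e) + (\<Sum>z\<in>Z. \<Sum>p\<in>E z. a * p))" by simp
    also have "\<dots> = \<psi> (a * (r * e)) + (\<Sum>z\<in>Z. \<Sum>p\<in>E z. \<psi> (a * p))"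
    proof -
      have 1: "(\<Sum>p\<in>E z. a * p) \<in> M" if "z \<in> Z" for z using EF[OF that] ab(1) by (auto intro!: sum_mem)
      have 2: "\<psi> (\<Sum>p\<in>E z. a * p) = (\<Sum>p\<in>E z. \<psi> (a * p))" if "z \<in> Z" for z
        using EF[OF that] ab(1) by (intro sumadd(2)) auto
      have "a * (r * e) \<in> M" using ab(1) rM eM(1) by simp
      then show ?thesis using 1 2 add[of "a * (r * e)"] sumadd(2)[OF finZ] by (simp add: sum_mem)
    qed
    finally show ?thesis
      using piece[OF pEr q] piece[OF pE q] by (simp add: distrib_right sum_distrib_right)
  qed
  have "b = (1 - e) * b" using eb by (simp add: left_diff_distrib)
  also have "\<dots> = (r * (1 - e) + (\<Sum>z\<in>Z. (1 - e) * z)) * b"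
    using e_sum[of "1 - e"] eM(1) by simp
  also have "\<dots> = r * (1 - e) * b + (\<Sum>z\<in>Z. \<Sum>(F z) * b)"
    unfolding distrib_right sum_distrib_right[of _ Z] using EF(6) by simp
  also have "\<dots> = r * (1 - e) * b + (\<Sum>z\<in>Z. \<Sum>q\<in>F z. q * b)" by (simp only: sum_distrib_right)
  finally have "\<psi> b = \<psi> (r * (1 - e) * b + (\<Sum>z\<in>Z. \<Sum>q\<in>F z. q * b))" by simp
  also have "\<dots> = \<psi> (r * (1 - e) * b) + (\<Sum>z\<in>Z. \<Sum>q\<in>F z. \<psi> (q * b))"
  proof -
    have 1: "(\<Sum>q\<in>F z. q * b) \<in> M" if "z \<in> Z" for z using EF[OF that] ab(2) by (auto intro!: sum_mem)
    have 2: "\<psi> (\<Sum>q\<in>F z. q * b) = (\<Sum>q\<in>F z. \<psi> (q * b))" if "z \<in> Z" for z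
      using EF[OF that] ab(2) by (intro sumadd(2)) auto
    have "r * (1 - e) * b \<in> M" using ab(2) rM eM(1) by simp
    then show ?thesis using 1 2 add[of "r * (1 - e) * b"] sumadd(2)[OF finZ] by (simp add: sum_mem)
  qed
  finally show ?thesis
    using A[OF pFr] A[OF pF] by (simp add: distrib_left sum_distrib_left)
qed

end

section \<open>Spectral approximation by projections\<close>

definition opbound :: "'a::chilbert bop \<Rightarrow> real \<Rightarrow> bool" where
  "opbound a K \<longleftrightarrow> (\<forall>x. norm (app a x) \<le> K * norm x)"

lemma opboundD: "opbound a K \<Longrightarrow> norm (app a x) \<le> K * norm x"
  by (simp add: opbound_def)

lemma opbound_exists: "\<exists>K>0. opbound a K"
proof -
  obtain K where "K \<ge> 0" "\<And>x. norm (app a x) \<le> K * norm x" using app_bound by blast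
  then have "opbound a (K + 1)" unfolding opbound_def by (smt (verit) mult_right_mono norm_ge_zero)
  then show ?thesis using \<open>K \<ge> 0\<close> by (intro exI[of _ "K + 1"]) auto
qed

lemma opbound_mult: "opbound a K \<Longrightarrow> opbound b L \<Longrightarrow> 0 \<le> K \<Longrightarrow> opbound (a * b) (K * L)"
  unfolding opbound_def
  by (smt (verit) app_simps(5) mult.assoc mult_left_mono)

lemma opbound_add: "opbound a K \<Longrightarrow> opbound b L \<Longrightarrow> opbound (a + b) (K + L)"
  unfolding opbound_def
  by (smt (verit) app_simps(3) distrib_right norm_triangle_ineq)

lemma opbound_scaleC: "opbound a K \<Longrightarrow> opbound (scaleC c a) (cmod c * K)"
  unfolding opbound_def by (simp add: norm_scaleC mult.assoc mult_left_mono)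

lemma opbound_star:
  assumes "opbound a K" "0 \<le> K"
  shows "opbound (star a) K"
  unfolding opbound_def
proof
  fix y
  show "norm (app (star a) y) \<le> K * norm y"
  proof (cases "app (star a) y = 0")
    case False
    have "(norm (app (star a) y))\<^sup>2 = Re (cinner (app a (app (star a) y)) y)"
      by (metis cinner_star Re_cinner_self)
    also have "\<dots> \<le> norm (app a (app (star a) y)) * norm y"
      using complex_Re_le_cmod complex_Cauchy_Schwarz by (rule order_trans)
    also have "\<dots> \<le> K * norm (app (star a) y) * norm y"
      by (intro mult_right_mono opboundD assms) simp
    finally show ?thesis using False by (simp add: power2_eq_square mult_ac)
  qed (use assms in simp)
qed

lemma Re_cinner_le: "Re (cinner x y) \<le> norm x * norm (y::'a::complex_inner)"
  using complex_Re_le_cmod complex_Cauchy_Schwarz by (rule order_trans)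

text \<open>Polarization: pairing \<open>app x v\<close> with a vector \<open>w\<close> in its own
  direction involves the quadratic form only at \<open>v + w\<close> and \<open>v - w\<close>.
  Giving \<open>w\<close> the norm of \<open>v\<close> lets the parallelogram law evaluate the bound
  without loss.\<close>

lemma selfadjoint_opbound:
  assumes x: "star x = x" and L: "0 \<le> L" "\<And>v. \<bar>Re (cinner v (app x v))\<bar> \<le> L * (norm v)\<^sup>2"
  shows "opbound x L"
  unfolding opbound_def
proof
  fix v
  show "norm (app x v) \<le> L * norm v"
  proof (cases "app x v = 0")
    case False
    then have v0: "norm v > 0" by auto
    define w where "w = scaleR (norm v / norm (app x v)) (app x v)"
    have nw: "norm w = norm v" using False by (simp add: w_def)
    have sym: "Re (cinner w (app x v)) = Re (cinner v (app x w))"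
      using x by (metis Re_cinner_commute cinner_star)
    have "4 * Re (cinner w (app x v)) = Re (cinner (v + w) (app x (v + w))) - Re (cinner (v - w) (app x (v - w)))"
      using sym by (simp add: app_add app_diff cinner_add_left cinner_add_right cinner_diff_left cinner_diff_right)
    also have "\<dots> \<le> L * (norm (v + w))\<^sup>2 + L * (norm (v - w))\<^sup>2"
      using L(2)[of "v + w"] L(2)[of "v - w"] by linarith
    also have "\<dots> = L * (4 * (norm v)\<^sup>2)"
      using complex_parallelogram[of v w] nw by (simp flip: distrib_left)
    finally have "Re (cinner w (app x v)) \<le> L * norm v * norm v" by (simp add: power2_eq_square)
    moreover have "Re (cinner w (app x v)) = norm v * norm (app x v)"
      using False by (simp add: w_def cinner_scaleR_left Re_cinner_self power2_eq_square)
    ultimately show ?thesis using v0 by (simp add: mult.commute)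
  qed (use L in simp)
qed

text \<open>The iteration \<open>y \<mapsto> (d + y\<^sup>2) / 2\<close> converges to a solution of \<open>(1 - y)\<^sup>2 = 1 - d\<close>; it is dominated
  by the same iteration for the number \<open>1\<close> in place of \<open>d\<close>.\<close>

primrec sqrt_iter :: "'a::chilbert bop \<Rightarrow> nat \<Rightarrow> 'a bop" where
  "sqrt_iter d 0 = 0"
| "sqrt_iter d (Suc k) = scaleC (1/2) (d + sqrt_iter d k * sqrt_iter d k)"

primrec sqrt_majorant :: "nat \<Rightarrow> real" where
  "sqrt_majorant 0 = 0"
| "sqrt_majorant (Suc k) = (1 + sqrt_majorant k * sqrt_majorant k) / 2"

lemma sqrt_majorant_bounds: "0 \<le> sqrt_majorant k \<and> sqrt_majorant k \<le> 1"
proof (induction k)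
  case (Suc k)
  then have "sqrt_majorant k * sqrt_majorant k \<le> 1" by (simp add: mult_le_one)
  then show ?case by simp
qed simp

lemma sqrt_majorant_mono: "sqrt_majorant k \<le> sqrt_majorant (Suc k)"
  using zero_le_square[of "1 - sqrt_majorant k"] by (simp add: algebra_simps)

lemma sqrt_iter_commute: "t * d = d * t \<Longrightarrow> t * sqrt_iter d k = sqrt_iter d k * t"
proof (induction k)
  case (Suc k)
  then have IH: "t * sqrt_iter d k = sqrt_iter d k * t" by blast
  have "t * (sqrt_iter d k * sqrt_iter d k) = sqrt_iter d k * sqrt_iter d k * t"
    using IH by (metis mult.assoc)
  then show ?case using Suc.prems by (simp add: distrib_left distrib_right)
qed simp

lemma star_sqrt_iter: "star d = d \<Longrightarrow> star (sqrt_iter d k) = sqrt_iter d k"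
  by (induction k) auto

lemma sqrt_iter_bound:
  assumes "opbound d 1"
  shows "opbound (sqrt_iter d k) (sqrt_majorant k)"
proof (induction k)
  case (Suc k)
  have "opbound (d + sqrt_iter d k * sqrt_iter d k) (1 + sqrt_majorant k * sqrt_majorant k)"
    using assms Suc sqrt_majorant_bounds[of k] by (intro opbound_add opbound_mult) auto
  then show ?case using opbound_scaleC[of _ _ "1/2"] by fastforce
qed (simp add: opbound_def)

text \<open>The iterates commute, so successive differences factor as
  \<open>(z + y) * (z - y)\<close>, and the majorant obeys the same identity for numbers. The
  resulting bounds telescope when summed.\<close>

lemma sqrt_iter_diff_bound:
  assumes "opbound d 1"
  shows "opbound (sqrt_iter d (Suc k) - sqrt_iter d k) (sqrt_majorant (Suc k) - sqrt_majorant k)"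
proof (induction k)
  case 0
  show ?case using opbound_scaleC[OF assms, of "1/2"] by simp
next
  case (Suc k)
  define y z where "y = sqrt_iter d k" and "z = sqrt_iter d (Suc k)"
  define r s where "r = sqrt_majorant k" and "s = sqrt_majorant (Suc k)"
  have "d * y = y * d" unfolding y_def by (rule sqrt_iter_commute) simp
  then have yz: "y * z = z * y" unfolding z_def by (intro sqrt_iter_commute) simp
  have z: "z = scaleC (1/2) (d + y * y)" by (simp add: y_def z_def)
  have "sqrt_iter d (Suc (Suc k)) - z = scaleC (1/2) (d + z * z) - scaleC (1/2) (d + y * y)"
    by (simp only: sqrt_iter.simps(2)[of d "Suc k"] z_def[symmetric] z[symmetric])
  also have "\<dots> = scaleC (1/2) (z * z - y * y)"
    by (simp add: scaleC_diff_right scaleC_add_right)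
  also have "z * z - y * y = (z + y) * (z - y)"
    using yz by (simp add: distrib_right right_diff_distrib)
  finally have 1: "sqrt_iter d (Suc (Suc k)) - z = scaleC (1/2) ((z + y) * (z - y))" .
  have zs: "opbound z s" and yr: "opbound y r"
    unfolding z_def y_def s_def r_def by (rule sqrt_iter_bound[OF assms])+
  have rs0: "0 \<le> s + r"
    unfolding s_def r_def using sqrt_majorant_bounds[of k] sqrt_majorant_bounds[of "Suc k"] by linarith
  have IH: "opbound (z - y) (s - r)" using Suc by (simp only: z_def y_def s_def r_def)
  have "opbound (scaleC (1/2) ((z + y) * (z - y))) (1/2 * ((s + r) * (s - r)))"
    using opbound_scaleC[OF opbound_mult[OF opbound_add[OF zs yr] IH rs0], of "1/2"] by simp
  moreover have "1/2 * ((s + r) * (s - r)) = (1 + s * s) / 2 - (1 + r * r) / 2"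
    by (simp add: field_simps)
  then have "1/2 * ((s + r) * (s - r)) = sqrt_majorant (Suc (Suc k)) - s"
    by (simp add: s_def r_def)
  ultimately have "opbound (sqrt_iter d (Suc (Suc k)) - z) (sqrt_majorant (Suc (Suc k)) - s)"
    using 1 by (simp only:)
  then show ?case unfolding z_def s_def .
qed

text \<open>\<open>s\<close> is the absolute value of \<open>x\<close>, obtained as
  \<open>1 - y\<close> from the limit \<open>y\<close> of the iteration for
  \<open>d = 1 - x * x\<close>. It is positive because \<open>y\<close> is a contraction, and
  commutation passes from the iterates to the limit.\<close>

lemma selfadjoint_abs_exists:
  fixes x :: "'a::chilbert bop"
  assumes x: "star x = x" and b: "opbound x 1"
  shows "\<exists>s. star s = s \<and> s * s = x * x \<and> (\<forall>v. 0 \<le> Re (cinner v (app s v))) \<and>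
    (\<forall>t. t * x = x * t \<longrightarrow> t * s = s * t)"
proof -
  define d where "d = 1 - x * x"
  have sd: "star d = d" by (simp add: d_def x)
  \<comment> \<open>In the expanded square, contractivity gives
    \<open>\<parallel>x\<^sup>2v\<parallel> \<le> \<parallel>xv\<parallel>\<close>, and the cross
    term \<open>-2\<parallel>xv\<parallel>\<^sup>2\<close> absorbs the last summand.\<close>
  have d1: "opbound d 1"
    unfolding opbound_def
  proof
    fix v
    have "Re (cinner v (app x (app x v))) = (norm (app x v))\<^sup>2"
      using x by (metis cinner_star Re_cinner_self)
    then have "(norm (app d v))\<^sup>2 = (norm v)\<^sup>2 - 2 * (norm (app x v))\<^sup>2 + (norm (app x (app x v)))\<^sup>2"
      by (simp add: d_def norm_diff_sq)
    moreover have "(norm (app x (app x v)))\<^sup>2 \<le> (norm (app x v))\<^sup>2"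
      using opboundD[OF b, of "app x v"] by (simp add: power_mono)
    ultimately have "(norm (app d v))\<^sup>2 \<le> (norm v)\<^sup>2" using zero_le_power2[of "norm (app x v)"] by linarith
    then have "norm (app d v) \<le> norm v" by (rule power2_le_imp_le) simp
    then show "norm (app d v) \<le> 1 * norm v" by simp
  qed
  let ?Y = "sqrt_iter d"
  have "convergent sqrt_majorant"
    using sqrt_majorant_bounds sqrt_majorant_mono
    by (intro Bseq_mono_convergent[OF BseqI'[of _ 1]]) (auto intro: lift_Suc_mono_le)
  then have cauchy: "Cauchy sqrt_majorant" by (rule convergent_Cauchy)
  have diff: "norm (app (?Y m) v - app (?Y n) v) \<le> (sqrt_majorant m - sqrt_majorant n) * norm v" if "n \<le> m" for m n v
    using that
  proof (induction m rule: dec_induct)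
    case (step m)
    have "app (?Y (Suc m)) v - app (?Y n) v = (app (?Y (Suc m)) v - app (?Y m) v) + (app (?Y m) v - app (?Y n) v)"
      by (simp del: sqrt_iter.simps)
    then have "norm (app (?Y (Suc m)) v - app (?Y n) v)
        \<le> norm (app (?Y (Suc m)) v - app (?Y m) v) + norm (app (?Y m) v - app (?Y n) v)"
      by (metis norm_triangle_ineq)
    also have "norm (app (?Y (Suc m)) v - app (?Y m) v) \<le> (sqrt_majorant (Suc m) - sqrt_majorant m) * norm v"
      using opboundD[OF sqrt_iter_diff_bound[OF d1, of m], of v] by (simp del: sqrt_iter.simps sqrt_majorant.simps)
    finally show ?case using step.IH by (simp add: algebra_simps del: sqrt_iter.simps sqrt_majorant.simps)
  qed simp
  have "Cauchy (\<lambda>k. app (?Y k) v)" for v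
  proof (rule CauchyI)
    fix e :: real assume e: "0 < e"
    then have "0 < e / (norm v + 1)" by (simp add: add_nonneg_pos)
    then obtain N where N: "\<And>m n. m \<ge> N \<Longrightarrow> n \<ge> N \<Longrightarrow> norm (sqrt_majorant m - sqrt_majorant n) < e / (norm v + 1)"
      using CauchyD[OF cauchy] by blast
    have *: "norm (app (?Y m) v - app (?Y n) v) < e" if "m \<ge> n" "n \<ge> N" for m n
    proof -
      have nn: "norm v + 1 > 0" by (simp add: add_nonneg_pos)
      have "(sqrt_majorant m - sqrt_majorant n) < e / (norm v + 1)" using N[of m n] that by auto
      then have "(sqrt_majorant m - sqrt_majorant n) * (norm v + 1) < e" using nn by (simp add: pos_less_divide_eq)
      moreover have "sqrt_majorant n \<le> sqrt_majorant m" using that(1) sqrt_majorant_mono by (rule lift_Suc_mono_le[rotated])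
      ultimately show ?thesis using diff[OF that(1), of v] by (simp add: algebra_simps)
    qed
    have "norm (app (?Y m) v - app (?Y n) v) < e" if "m \<ge> N" "n \<ge> N" for m n
      using *[of n m] *[of m n] that by (cases "n \<le> m") (auto simp: norm_minus_commute)
    then show "\<exists>M. \<forall>m\<ge>M. \<forall>n\<ge>M. norm (app (?Y m) v - app (?Y n) v) < e" by blast
  qed
  then have "\<exists>l. (\<lambda>k. app (?Y k) v) \<longlonglongrightarrow> l" for v by (simp add: Cauchy_convergent_iff convergent_def)
  then obtain f where f: "\<And>v. (\<lambda>k. app (?Y k) v) \<longlonglongrightarrow> f v" by metis
  have Y1: "norm (app (?Y k) v) \<le> norm v" for k v
    using opboundD[OF sqrt_iter_bound[OF d1, of k], of v] sqrt_majorant_bounds[of k]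
      mult_right_mono[of "sqrt_majorant k" 1 "norm v"] by simp
  have f1: "norm (f v) \<le> norm v" for v
    using Y1 by (intro LIMSEQ_le_const2[OF tendsto_norm[OF f]]) auto
  have "f \<in> BH"
  proof (rule BH_I[where K = 1])
    fix v w c
    have "(\<lambda>k. app (?Y k) (v + w)) \<longlonglongrightarrow> f v + f w" unfolding app_add by (intro tendsto_add f)
    then show "f (v + w) = f v + f w" using f LIMSEQ_unique by blast
    have "(\<lambda>k. app (scaleC c 1) (app (?Y k) v)) \<longlonglongrightarrow> app (scaleC c 1) (f v)" by (intro app_tendsto f)
    then have "(\<lambda>k. app (?Y k) (scaleC c v)) \<longlonglongrightarrow> scaleC c (f v)" by (simp add: app_scaleC)
    then show "f (scaleC c v) = scaleC c (f v)" using f LIMSEQ_unique by blast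
  qed (use f1 in simp)
  then obtain y where y: "\<And>v. (\<lambda>k. app (?Y k) v) \<longlonglongrightarrow> app y v" and y1: "\<And>v. norm (app y v) \<le> norm v"
    using f f1 Bop_inverse[of f] by metis
  have sy: "star y = y"
  proof (rule star_unique)
    fix v w
    have "(\<lambda>k. cnj (cinner w (app (?Y k) v))) \<longlonglongrightarrow> cnj (cinner w (app y v))"
      by (intro tendsto_cnj tendsto_cinner_right y)
    moreover have "cnj (cinner w (app (?Y k) v)) = cinner v (app (?Y k) w)" for k
      using star_sqrt_iter[OF sd, of k] by (metis cinner_commute cinner_star)
    ultimately have "(\<lambda>k. cinner v (app (?Y k) w)) \<longlonglongrightarrow> cinner (app y v) w"
      by (simp add: cinner_commute[of "app y v" w])
    then show "cinner (app y v) w = cinner v (app y w)"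
      using tendsto_cinner_right[OF y] LIMSEQ_unique by blast
  qed
  have yy: "app y (app y v) = scaleR 2 (app y v) - app d v" for v
  proof -
    \<comment> \<open>Convergence is available pointwise, so the product needs the uniform bound on
      the iterates to control \<open>?Y k\<close> applied to the error of \<open>?Y k\<close> at
      \<open>v\<close>.\<close>
    have lim: "(\<lambda>k. app (?Y k) (app (?Y k) v)) \<longlonglongrightarrow> app y (app y v)"
    proof -
      have "(\<lambda>k. norm (app (?Y k) v - app y v)) \<longlonglongrightarrow> 0"
        using tendsto_norm[OF LIM_zero[OF y]] by simp
      then have "(\<lambda>k. app (?Y k) (app (?Y k) v - app y v)) \<longlonglongrightarrow> 0"
        by (rule Lim_null_comparison[rotated]) (simp add: Y1)
      then have "(\<lambda>k. app (?Y k) (app (?Y k) v - app y v) + app (?Y k) (app y v)) \<longlonglongrightarrow> 0 + app y (app y v)"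
        by (intro tendsto_add y)
      then show ?thesis by (simp add: app_diff)
    qed
    have "(\<lambda>k. scaleR 2 (app (?Y (Suc k)) v) - app d v) \<longlonglongrightarrow> scaleR 2 (app y v) - app d v"
      by (intro tendsto_intros LIMSEQ_Suc[OF y])
    moreover have "scaleR 2 (app (?Y (Suc k)) v) - app d v = app (?Y k) (app (?Y k) v)" for k
      by (simp add: scaleR_scaleC scaleC_scaleC scaleC_one)
    ultimately have "(\<lambda>k. app (?Y k) (app (?Y k) v)) \<longlonglongrightarrow> scaleR 2 (app y v) - app d v"
      by (simp only:)
    then show ?thesis using lim LIMSEQ_unique by blast
  qed
  define s where "s = 1 - y"
  have "s * s = x * x"
  proof (rule bop_eqI)
    fix v
    show "app (s * s) v = app (x * x) v"
      using yy[of v] by (simp add: s_def d_def app_diff scaleR_2)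
  qed
  moreover have "0 \<le> Re (cinner v (app s v))" for v
  proof -
    have "Re (cinner v (app y v)) \<le> norm v * norm v"
      using Re_cinner_le[of v "app y v"] mult_left_mono[OF y1[of v], of "norm v"] by simp
    then show ?thesis by (simp add: s_def cinner_diff_right Re_cinner_self power2_eq_square)
  qed
  moreover have "t * s = s * t" if "t * x = x * t" for t
  proof -
    have "t * (x * x) = x * x * t" using that by (metis mult.assoc)
    then have "t * d = d * t" by (simp add: d_def left_diff_distrib right_diff_distrib)
    note tY = sqrt_iter_commute[OF this]
    have "t * y = y * t"
    proof (rule bop_eqI)
      fix v
      have "app t (app (?Y k) v) = app (?Y k) (app t v)" for k using tY[of k] by (metis app_simps(5))
      then have "(\<lambda>k. app (?Y k) (app t v)) \<longlonglongrightarrow> app t (app y v)" using app_tendsto[OF y, of t v] by simp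
      then have "app t (app y v) = app y (app t v)" using y LIMSEQ_unique by blast
      then show "app (t * y) v = app (y * t) v" by simp
    qed
    then show ?thesis by (simp add: s_def left_diff_distrib right_diff_distrib)
  qed
  moreover have "star s = s" by (simp add: s_def sy)
  ultimately show ?thesis by blast
qed

section \<open>Spectral projections inside the algebra\<close>

context vna
begin

text \<open>\<open>p\<close> projects onto the kernel of \<open>s - x\<close>, where
  \<open>x\<close> agrees with its absolute value \<open>s\<close>. Since
  \<open>(s - x) * (s + x) = 0\<close>, the range of \<open>s + x\<close> lies in this kernel, so
  \<open>x\<close> agrees with \<open>- s\<close> on the complement.\<close>

lemma spectral_projection_unit:
  assumes xM: "x \<in> M" and x: "star x = x" and b: "opbound x 1"
  shows "\<exists>p\<in>M. isproj p \<and> p * x = x * p \<and> (\<forall>v. 0 \<le> Re (cinner v (app (x * p) v))) \<and>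
    (\<forall>v. Re (cinner v (app (x * (1 - p)) v)) \<le> 0)"
proof -
  obtain s where s: "star s = s" "s * s = x * x" "\<And>v. 0 \<le> Re (cinner v (app s v))"
    and sc: "\<And>t. t * x = x * t \<Longrightarrow> t * s = s * t" using selfadjoint_abs_exists[OF x b] by blast
  have xs: "x * s = s * x" using sc[of x] by simp
  define S where "S = {v. app (s - x) v \<in> {0}}"
  obtain p where p: "projects_onto p S"
    using projects_onto_exists[of S] closed_app_vimage csubspace_app_vimage csubspace_zero
    unfolding S_def by blast
  have inv: "app t v \<in> S" if "t * x = x * t" "v \<in> S" for t v
  proof -
    have "(s - x) * t = t * (s - x)" using sc[OF that(1)] that(1) by (simp add: left_diff_distrib right_diff_distrib)
    then have "app (s - x) (app t v) = app t (app (s - x) v)" by (metis app_simps(5))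
    then show ?thesis using that(2) by (simp add: S_def)
  qed
  have pM: "p \<in> M"
  proof (rule projects_onto_mem[OF p])
    fix t v assume "t \<in> cmt M" "v \<in> S"
    then show "app t v \<in> S" using cmtD[OF _ xM] by (intro inv) auto
  qed
  have xp: "x * p = p * x"
    by (rule projects_onto_commute[OF p]) (use inv x in auto)
  have sp: "s * p = p * s"
    by (rule projects_onto_commute[OF p]) (use inv s(1) xs in auto)
  have pp: "p * p = p" "star p = p" using p by (auto simp: projects_onto_def isproj_def)
  have "(s - x) * p = 0" using p by (intro bop_eqI) (auto simp: projects_onto_def S_def)
  then have xsp: "x * p = s * p" by (simp add: left_diff_distrib)
  have "(s - x) * (s + x) = 0" using s(2) xs by (simp add: distrib_left left_diff_distrib)
  then have "app (s + x) v \<in> S" for v unfolding S_def by (metis app_simps(1,5) insertI1 mem_Collect_eq)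
  then have "p * (s + x) = s + x" using p by (intro bop_eqI) (simp add: projects_onto_def)
  then have "(s + x) * (1 - p) = 0" using sp xp by (simp add: distrib_left distrib_right right_diff_distrib)
  then have xsq: "x * (1 - p) = - (s * (1 - p))" by (simp add: distrib_right eq_neg_iff_add_eq_0 add.commute)
  have pos: "0 \<le> Re (cinner v (app (s * q) v))" if "q * q = q" "star q = q" "s * q = q * s" for q v
  proof -
    have "s * q = q * (s * q)" using that by (metis mult.assoc)
    then have "cinner v (app (s * q) v) = cinner (app q v) (app s (app q v))"
      using that(2) by (metis app_simps(5) cinner_star)
    then show ?thesis using s(3) by simp
  qed
  have "(1 - p) * (1 - p) = 1 - p" using pp by (simp add: left_diff_distrib right_diff_distrib)
  moreover have "s * (1 - p) = (1 - p) * s" using sp by (simp add: left_diff_distrib right_diff_distrib)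
  ultimately have "0 \<le> Re (cinner v (app (s * (1 - p)) v))" for v using pp by (intro pos) auto
  then have "Re (cinner v (app (x * (1 - p)) v)) \<le> 0" for v unfolding xsq by (simp del: app_simps(5))
  moreover have "0 \<le> Re (cinner v (app (x * p) v))" for v unfolding xsp using pp sp by (intro pos) auto
  ultimately show ?thesis using pM pp xp unfolding isproj_def by metis
qed

lemma spectral_projection:
  assumes xM: "x \<in> M" and x: "star x = x"
  shows "\<exists>p\<in>M. isproj p \<and> p * x = x * p \<and> (\<forall>v. 0 \<le> Re (cinner v (app (x * p) v))) \<and>
    (\<forall>v. Re (cinner v (app (x * (1 - p)) v)) \<le> 0)"
proof -
  obtain K where K: "K > 0" "opbound x K" using opbound_exists by blast
  define y where "y = scaleC (of_real (1 / K)) x"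
  have xy: "x = scaleC (of_real K) y" using K(1) by (simp add: y_def scaleC_scaleC scaleC_one)
  have "opbound y 1" using opbound_scaleC[OF K(2), of "of_real (1 / K)"] K(1) by (simp add: y_def norm_divide)
  moreover have "y \<in> M" "star y = y" using xM x by (simp_all add: y_def)
  ultimately obtain p where p: "p \<in> M" "isproj p" "p * y = y * p"
    "\<And>v. 0 \<le> Re (cinner v (app (y * p) v))" "\<And>v. Re (cinner v (app (y * (1 - p)) v)) \<le> 0"
    using spectral_projection_unit by metis
  have *: "Re (cinner v (app (x * q) v)) = K * Re (cinner v (app (y * q) v))" for q v
    by (simp add: xy cinner_scaleC_right)
  have "0 \<le> Re (cinner v (app (x * p) v))" "Re (cinner v (app (x * (1 - p)) v)) \<le> 0" for v
    unfolding * using p(4,5)[of v] K(1) by (simp_all only: mult_nonneg_nonpos mult_nonneg_nonneg less_imp_le)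
  moreover have "p * x = x * p" using p(3) by (simp add: xy)
  ultimately show ?thesis using p(1,2) by blast
qed

text \<open>\<open>p\<close> separates the part of \<open>x\<close> with form values between 0 and
  \<open>L\<close> from the part with values between \<open>- L\<close> and 0. Subtracting
  \<open>L / 2\<close> on \<open>p\<close> and \<open>- L / 2\<close> on \<open>1 - p\<close>
  recentres both intervals at 0.\<close>

lemma halving:
  assumes xM: "x \<in> M" and x: "star x = x" and L: "\<And>v. \<bar>Re (cinner v (app x v))\<bar> \<le> L * (norm v)\<^sup>2"
  shows "\<exists>p\<in>M. isproj p \<and> (\<forall>v. \<bar>Re (cinner v (app (x - scaleC (of_real (L / 2)) (p + p - 1)) v))\<bar> \<le> L / 2 * (norm v)\<^sup>2)"
proof -
  obtain p where p: "p \<in> M" "isproj p" "p * x = x * p"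
    "\<And>v. 0 \<le> Re (cinner v (app (x * p) v))" "\<And>v. Re (cinner v (app (x * (1 - p)) v)) \<le> 0"
    using spectral_projection[OF xM x] by blast
  have "\<bar>Re (cinner v (app (x - scaleC (of_real (L / 2)) (p + p - 1)) v))\<bar> \<le> L / 2 * (norm v)\<^sup>2" for v
  proof -
    have q: "isproj (1 - p)" using isproj_diff[of p 1] p(2) by simp
    have form: "cinner v (app (x * q) v) = cinner (app q v) (app x (app q v))" if "isproj q" "q * x = x * q" for q
    proof -
      have "x * q = q * (x * q)" using that by (metis isproj_def mult.assoc)
      then show ?thesis using that(1) by (metis app_simps(5) cinner_star isproj_def)
    qed
    have xq: "(1 - p) * x = x * (1 - p)" using p(3) by (simp add: left_diff_distrib right_diff_distrib)
    define A where "A = Re (cinner v (app (x * p) v))"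
    define B where "B = Re (cinner v (app (x * (1 - p)) v))"
    define P where "P = (norm (app p v))\<^sup>2"
    define Q where "Q = (norm (app (1 - p) v))\<^sup>2"
    have A: "0 \<le> A" "A \<le> L * P" using p(4)[of v] L[of "app p v"] form[OF p(2,3)] by (auto simp: A_def P_def)
    have B: "B \<le> 0" "- (L * Q) \<le> B" using p(5)[of v] L[of "app (1 - p) v"] form[OF q xq] by (auto simp: B_def Q_def)
    have PQ: "P = Re (cinner v (app p v))" "Q = Re (cinner v (app (1 - p) v))"
      using isproj_norm_sq[OF p(2)] isproj_norm_sq[OF q] by (simp_all add: P_def Q_def)
    have n: "(norm v)\<^sup>2 = P + Q" by (simp add: PQ cinner_diff_right Re_cinner_self)
    have AB: "Re (cinner v (app x v)) = A + B" by (simp add: A_def B_def app_diff cinner_diff_right)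
    have "Re (cinner v (app (p + p - 1) v)) = P - Q" by (simp add: PQ cinner_diff_right cinner_add_right)
    then have R: "Re (cinner v (app (x - scaleC (of_real (L / 2)) (p + p - 1)) v)) = A + B - L / 2 * (P - Q)"
      using AB by (simp add: cinner_diff_right cinner_scaleC_right del: of_real_divide)
    have "L / 2 * (P - Q) = L * P / 2 - L * Q / 2" "L / 2 * (P + Q) = L * P / 2 + L * Q / 2"
      by (simp_all add: field_simps)
    moreover have "\<bar>A + B - (X / 2 - Y / 2)\<bar> \<le> X / 2 + Y / 2" if "A \<le> X" "- Y \<le> B" for X Y :: real
      using that A(1) B(1) by linarith
    ultimately show ?thesis unfolding n R using A(2) B(2) by (simp only:)
  qed
  with p(1,2) show ?thesis by blast
qed

text \<open>Repeated halving leaves an error \<open>L / 2 ^ n\<close>, and every correction is a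
  multiple of \<open>p + p - 1\<close>, hence in \<open>D\<close>. Keeping \<open>D\<close> abstract
  avoids forming a linear span and its closure.\<close>

lemma selfadjoint_approximation:
  assumes D: "\<And>p. p \<in> M \<Longrightarrow> isproj p \<Longrightarrow> p \<in> D" "\<And>a b. a \<in> D \<Longrightarrow> b \<in> D \<Longrightarrow> a + b \<in> D"
      "\<And>c a. a \<in> D \<Longrightarrow> scaleC c a \<in> D"
    and xM: "x \<in> M" and x: "star x = x" and e: "e > 0"
  shows "\<exists>y\<in>D. x - y \<in> M \<and> opbound (x - y) e"
proof -
  obtain L where L: "L > 0" "opbound x L" using opbound_exists by blast
  have D0: "0 \<in> D" using D(1)[of 0] by (simp add: isproj_def)
  have "\<exists>y\<in>D. x - y \<in> M \<and> star (x - y) = x - y \<and> (\<forall>v. \<bar>Re (cinner v (app (x - y) v))\<bar> \<le> L / 2 ^ n * (norm v)\<^sup>2)" for n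
  proof (induction n)
    case 0
    have "\<bar>Re (cinner v (app x v))\<bar> \<le> L * (norm v)\<^sup>2" for v
    proof -
      have "\<bar>Re (cinner v (app x v))\<bar> \<le> norm v * norm (app x v)"
        using abs_Re_le_cmod complex_Cauchy_Schwarz by (rule order_trans)
      also have "\<dots> \<le> norm v * (L * norm v)" by (intro mult_left_mono opboundD L) simp
      finally show ?thesis by (simp add: power2_eq_square mult_ac)
    qed
    then show ?case using D0 xM x by (intro bexI[of _ 0]) auto
  next
    case (Suc n)
    then obtain y where y: "y \<in> D" "x - y \<in> M" "star (x - y) = x - y"
      "\<And>v. \<bar>Re (cinner v (app (x - y) v))\<bar> \<le> L / 2 ^ n * (norm v)\<^sup>2" by blast
    obtain p where p: "p \<in> M" "isproj p"
      "\<And>v. \<bar>Re (cinner v (app (x - y - scaleC (of_real (L / 2 ^ n / 2)) (p + p - 1)) v))\<bar> \<le> L / 2 ^ n / 2 * (norm v)\<^sup>2"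
      using halving[OF y(2-4)] by blast
    define w where "w = scaleC (of_real (L / 2 ^ n / 2)) (p + p - 1)"
    have "p + p + scaleC (- 1) 1 \<in> D" using D(1)[of 1] D(1)[OF p(1,2)] by (intro D(2,3)) auto
    then have "p + p - 1 \<in> D" by (simp add: scaleC_one)
    then have "w \<in> D" unfolding w_def by (rule D(3))
    moreover have "star w = w" using p(2) by (simp add: w_def isproj_def)
    moreover have "w \<in> M" using p(1) by (simp add: w_def)
    ultimately show ?case using y p(3)[folded w_def] D(2)
      by (intro bexI[of _ "y + w"]) (auto simp: diff_diff_add[symmetric] mult.commute[of 2] simp del: app_minus_bop)
  qed
  moreover obtain n where n: "L / 2 ^ n < e"
  proof -
    obtain n where "L / e < 2 ^ n" using real_arch_pow[of 2 "L / e"] by auto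
    then have "L / 2 ^ n < e" using e by (simp add: field_simps)
    then show ?thesis by (rule that)
  qed
  ultimately obtain y where y: "y \<in> D" "x - y \<in> M" "star (x - y) = x - y"
    "\<And>v. \<bar>Re (cinner v (app (x - y) v))\<bar> \<le> L / 2 ^ n * (norm v)\<^sup>2" by blast
  have "opbound (x - y) (L / 2 ^ n)" by (rule selfadjoint_opbound[OF y(3) _ y(4)]) (use L(1) in simp)
  then have "opbound (x - y) e" unfolding opbound_def
    using n by (meson less_imp_le mult_right_mono norm_ge_zero order_trans)
  with y show ?thesis by blast
qed

end

section \<open>Zero product preserving maps\<close>

locale zero_product_map = vna M for M :: "'a::chilbert bop set" +
  fixes \<psi> :: "'a bop \<Rightarrow> 'b::chilbert bop" and K :: real
  assumes add: "a \<in> M \<Longrightarrow> b \<in> M \<Longrightarrow> \<psi> (a + b) = \<psi> a + \<psi> b"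
    and scale: "a \<in> M \<Longrightarrow> \<psi> (scaleC c a) = scaleC c (\<psi> a)"
    and zero_product: "a \<in> M \<Longrightarrow> b \<in> M \<Longrightarrow> a * b = 0 \<Longrightarrow> \<psi> a * \<psi> b = 0"
    and K: "K \<ge> 0" "a \<in> M \<Longrightarrow> 0 \<le> \<gamma> \<Longrightarrow> opbound a \<gamma> \<Longrightarrow> opbound (\<psi> a) (K * \<gamma>)"
begin

lemma diff: "a \<in> M \<Longrightarrow> b \<in> M \<Longrightarrow> \<psi> (a - b) = \<psi> a - \<psi> b"
  using add[of "a - b" b] by (simp add: eq_diff_eq)

text \<open>The elements that may be moved from the left factor to the right one. They form a linear
  set, so it suffices to treat projections and to approximate.\<close>

definition balanced :: "'a bop set" where
  "balanced = {x \<in> M. \<forall>a\<in>M. \<forall>b\<in>M. \<psi> (a * x) * \<psi> b = \<psi> a * \<psi> (x * b)}"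

text \<open>The factors \<open>a * p\<close> and \<open>(1 - p) * b\<close> have product zero, and
  so have \<open>a * (1 - p)\<close> and \<open>p * b\<close>; hence both sides equal
  \<open>\<psi> (a * p) * \<psi> (p * b)\<close>.\<close>

lemma balanced_projection:
  assumes p: "p \<in> M" "isproj p"
  shows "p \<in> balanced"
  unfolding balanced_def
proof (intro CollectI conjI ballI p(1))
  fix a b assume ab: "a \<in> M" "b \<in> M"
  have pp: "p * (1 - p) = 0" "(1 - p) * p = 0"
    using p(2) by (simp_all add: isproj_def left_diff_distrib right_diff_distrib)
  have "a * p * ((1 - p) * b) = 0" "a * (1 - p) * (p * b) = 0"
    using pp by (metis mult.assoc mult_zero_left mult_zero_right)+
  then have "\<psi> (a * p) * \<psi> ((1 - p) * b) = 0" "\<psi> (a * (1 - p)) * \<psi> (p * b) = 0"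
    using ab p(1) by (auto intro!: zero_product)
  then have "\<psi> (a * p) * (\<psi> b - \<psi> (p * b)) = 0" "(\<psi> a - \<psi> (a * p)) * \<psi> (p * b) = 0"
    using ab p(1) by (simp_all add: left_diff_distrib right_diff_distrib diff)
  then show "\<psi> (a * p) * \<psi> b = \<psi> a * \<psi> (p * b)"
    by (simp add: left_diff_distrib right_diff_distrib)
qed

lemma balanced_add: "x \<in> balanced \<Longrightarrow> y \<in> balanced \<Longrightarrow> x + y \<in> balanced"
  unfolding balanced_def by (simp add: distrib_left distrib_right add)

lemma balanced_scale: "x \<in> balanced \<Longrightarrow> scaleC c x \<in> balanced"
  unfolding balanced_def by (simp add: scale)

lemma balanced_selfadjoint:
  assumes x: "x \<in> M" "star x = x"
  shows "x \<in> balanced"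
  unfolding balanced_def
proof (intro CollectI conjI ballI x(1))
  fix a b assume ab: "a \<in> M" "b \<in> M"
  obtain \<alpha> \<beta> where \<alpha>: "\<alpha> > 0" "opbound a \<alpha>" and \<beta>: "\<beta> > 0" "opbound b \<beta>" using opbound_exists by metis
  let ?d = "\<psi> (a * x) * \<psi> b - \<psi> a * \<psi> (x * b)"
  \<comment> \<open>Replacing \<open>x\<close> by a balanced \<open>y\<close> with error bounded by
    \<open>e\<close> changes each of the two products by at most
    \<open>(K * \<alpha>) * (K * \<beta>) * e\<close>; hence the factor 2.\<close>
  define C where "C = 2 * (K * \<alpha>) * (K * \<beta>)"
  have C: "C \<ge> 0" using K(1) \<alpha> \<beta> by (simp add: C_def)
  have small: "norm (app ?d v) \<le> C * e * norm v" if e: "e > 0" for e v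
  proof -
    obtain y where y: "y \<in> balanced" "x - y \<in> M" "opbound (x - y) e"
      using selfadjoint_approximation[of balanced, OF balanced_projection balanced_add balanced_scale x e] by blast
    define r where "r = x - y"
    have rM: "r \<in> M" "opbound r e" using y by (simp_all add: r_def)
    have yM: "y \<in> M" and y': "\<psi> (a * y) * \<psi> b = \<psi> a * \<psi> (y * b)" using y(1) ab by (auto simp: balanced_def)
    have xr: "x = y + r" by (simp add: r_def)
    have d: "?d = \<psi> (a * r) * \<psi> b + scaleC (- 1) (\<psi> a * \<psi> (r * b))"
      using ab rM yM y' by (simp add: xr distrib_left distrib_right add scaleC_one)
    have b1: "opbound (\<psi> (a * r)) (K * (\<alpha> * e))"
      using opbound_mult[OF \<alpha>(2) rM(2)] \<alpha>(1) e ab rM by (intro K(2)) auto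
    have b2: "opbound (\<psi> (r * b)) (K * (e * \<beta>))"
      using opbound_mult[OF rM(2) \<beta>(2)] \<beta>(1) e ab rM by (intro K(2)) auto
    have b3: "opbound (\<psi> a) (K * \<alpha>)" "opbound (\<psi> b) (K * \<beta>)" using K(2) ab \<alpha> \<beta> by auto
    have "opbound (\<psi> (a * r) * \<psi> b) (K * (\<alpha> * e) * (K * \<beta>))"
      by (rule opbound_mult[OF b1 b3(2)]) (use K(1) \<alpha>(1) e in simp)
    moreover have "opbound (\<psi> a * \<psi> (r * b)) (K * \<alpha> * (K * (e * \<beta>)))"
      by (rule opbound_mult[OF b3(1) b2]) (use K(1) \<alpha>(1) in simp)
    ultimately have "opbound ?d (K * (\<alpha> * e) * (K * \<beta>) + cmod (- 1) * (K * \<alpha> * (K * (e * \<beta>))))"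
      unfolding d by (intro opbound_add opbound_scaleC)
    then have "opbound ?d (C * e)" by (simp add: C_def algebra_simps)
    then show ?thesis by (rule opboundD)
  qed
  have "app ?d v = 0" for v
  proof (rule ccontr)
    assume v: "app ?d v \<noteq> 0"
    \<comment> \<open>The added 1 keeps the denominator positive; the factor 2 bounds the norm of
      the vector by half of itself.\<close>
    define e where "e = norm (app ?d v) / (2 * (C * norm v + 1))"
    have pos: "2 * (C * norm v + 1) > 0" using C by (simp add: add_nonneg_pos)
    then have e: "e > 0" using v unfolding e_def by (intro divide_pos_pos) auto
    have "C * e * norm v \<le> (C * norm v + 1) * e" using e by (simp add: algebra_simps)
    also have "\<dots> = norm (app ?d v) / 2" unfolding e_def using pos by (simp add: field_simps)
    finally have "norm (app ?d v) \<le> norm (app ?d v) / 2" using small[OF e, of v] by linarith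
    then show False using v by simp
  qed
  then have "?d = 0" by (intro bop_eqI) simp
  then show "\<psi> (a * x) * \<psi> b = \<psi> a * \<psi> (x * b)" by simp
qed

lemma balanced_all:
  assumes x: "x \<in> M"
  shows "x \<in> balanced"
proof -
  have re: "x + star x \<in> balanced" and im: "scaleC \<i> (x - star x) \<in> balanced"
    using x star_mem[OF x] by (auto intro!: balanced_selfadjoint simp: add.commute scaleC_diff_right)
  have "scaleC (1/2) ((x + star x) + scaleC (- \<i>) (scaleC \<i> (x - star x))) \<in> balanced"
    by (rule balanced_scale[OF balanced_add[OF re balanced_scale[OF im]]])
  moreover have "(x + star x) + scaleC (- \<i>) (scaleC \<i> (x - star x)) = scaleC 2 x"
    using scaleC_add_left[of 1 1 x] by (simp add: scaleC_scaleC scaleC_one)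
  ultimately show ?thesis by (simp add: scaleC_scaleC scaleC_one)
qed

lemma product:
  assumes "a \<in> M" "b \<in> M"
  shows "\<psi> a * \<psi> b = \<psi> 1 * \<psi> (a * b)"
proof -
  have "\<psi> (1 * a) * \<psi> b = \<psi> 1 * \<psi> (a * b)"
    using balanced_all[OF assms(1)] assms(2) mem_simps(2) unfolding balanced_def by blast
  then show ?thesis by simp
qed

lemma unit_commutes: "a \<in> M \<Longrightarrow> \<psi> 1 * \<psi> a = \<psi> a * \<psi> 1"
  using product[of a 1] by simp

theorem surjective_factorization:
  assumes N: "vna N" and surj: "\<psi> ` M = N"
  shows "\<exists>\<rho>. (\<forall>a\<in>M. \<psi> a = \<psi> 1 * \<rho> a) \<and>
    (\<forall>a\<in>M. \<forall>b\<in>M. \<rho> (a + b) = \<rho> a + \<rho> b \<and> \<rho> (a * b) = \<rho> a * \<rho> b) \<and>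
    (\<forall>a\<in>M. \<forall>c. \<rho> (scaleC c a) = scaleC c (\<rho> a)) \<and> \<rho> ` M = N"
proof -
  interpret N: vna N by (rule N)
  define h where "h = \<psi> 1"
  have hN: "h \<in> N" using surj by (auto simp: h_def)
  have hy: "h * y = y * h" if y: "y \<in> N" for y
  proof -
    obtain a where a: "a \<in> M" "y = \<psi> a" using surj y by blast
    show ?thesis using unit_commutes[OF a(1)] by (simp only: h_def a(2))
  qed
  obtain u where u: "u \<in> M" "\<psi> u = 1" using surj N.mem_simps(2) by (metis imageE)
  \<comment> \<open>By \<open>product\<close>,
    \<open>h * \<psi> (u * u) = \<psi> u * \<psi> u = 1\<close>, so the image of
    \<open>u * u\<close> inverts \<open>h\<close>.\<close>
  define k where "k = \<psi> (u * u)"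
  have kN: "k \<in> N" using surj u(1) by (auto simp: k_def)
  have hk: "h * k = 1" using product[OF u(1) u(1)] u(2) by (simp add: h_def k_def)
  then have kh: "k * h = 1" using hy[OF kN] by simp
  have ky: "k * y = y * k" if "y \<in> N" for y
  proof -
    have "k * y = k * (y * h) * k" using hk by (simp add: mult.assoc)
    also have "\<dots> = k * h * y * k" using hy[OF that] by (metis mult.assoc)
    finally show ?thesis using kh by simp
  qed
  define \<rho> where "\<rho> a = k * \<psi> a" for a
  have "\<rho> (a * b) = \<rho> a * \<rho> b" if ab: "a \<in> M" "b \<in> M" for a b
  proof -
    have "\<psi> a \<in> N" using surj ab by blast
    then have "\<rho> a * \<rho> b = k * (k * (\<psi> a * \<psi> b))" unfolding \<rho>_def by (metis ky mult.assoc)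
    also have "\<dots> = k * (k * h * \<psi> (a * b))" using product[OF ab] by (simp add: h_def mult.assoc)
    finally show ?thesis using kh by (simp add: \<rho>_def)
  qed
  moreover have "\<psi> a = \<psi> 1 * \<rho> a" for a
    using hk unfolding \<rho>_def h_def[symmetric] by (simp flip: mult.assoc)
  moreover have "\<rho> ` M = N"
  proof (intro equalityI subsetI)
    fix y assume "y \<in> \<rho> ` M"
    then obtain a where a: "a \<in> M" "y = k * \<psi> a" by (auto simp: \<rho>_def)
    then have "\<psi> a \<in> N" using surj by blast
    then show "y \<in> N" using kN a(2) by simp
  next
    fix y assume "y \<in> N"
    then have "h * y \<in> \<psi> ` M" using hN surj by simp
    then obtain a where a: "a \<in> M" "\<psi> a = h * y" by (metis imageE)
    then have "\<rho> a = y" using kh by (simp add: \<rho>_def flip: mult.assoc)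
    then show "y \<in> \<rho> ` M" using a(1) by blast
  qed
  moreover have "\<rho> (a + b) = \<rho> a + \<rho> b" if "a \<in> M" "b \<in> M" for a b
    using that by (simp add: \<rho>_def add distrib_left)
  moreover have "\<rho> (scaleC c a) = scaleC c (\<rho> a)" if "a \<in> M" for a c
    using that by (simp add: \<rho>_def scale)
  ultimately show ?thesis by (intro exI[of _ \<rho>]) blast
qed

end

section \<open>Symmetric maps: sharp norm bound and factorization through the unit image\<close>

text \<open>For \<open>\<beta> > 0\<close>, iterating the step bounds the powers of
  \<open>\<alpha> 0 / (\<gamma> * \<beta>)\<close> with exponent \<open>2 ^ k\<close> by
  \<open>C / \<beta>\<close>, which excludes a ratio above 1. The constant \<open>C\<close> thus
  leaves no trace in the conclusion.\<close>

lemma quadratic_growth_bound: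
  fixes \<alpha> :: "nat \<Rightarrow> real"
  assumes nn: "\<And>k. 0 \<le> \<alpha> k" "0 \<le> \<beta>" and \<gamma>: "0 < \<gamma>"
    and step: "\<And>k. \<alpha> k * \<alpha> k \<le> \<alpha> (Suc k) * \<beta>" and bd: "\<And>k. \<alpha> k \<le> C * \<gamma> ^ (2 ^ k)"
  shows "\<alpha> 0 \<le> \<gamma> * \<beta>"
proof (cases "\<beta> = 0")
  case True
  then have "\<alpha> 0 * \<alpha> 0 \<le> 0" using step[of 0] by simp
  then show ?thesis using True by (simp add: mult_le_0_iff) (metis nn(1) order_antisym order_refl)
next
  case False
  then have \<beta>: "\<beta> > 0" using nn(2) by simp
  have ind: "\<beta> * \<alpha> 0 ^ (2 ^ k) \<le> \<alpha> k * \<beta> ^ (2 ^ k)" for k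
  proof (induction k)
    case 0
    then show ?case by (simp add: mult.commute)
  next
    case (Suc k)
    have "(\<beta> * \<alpha> 0 ^ (2 ^ k)) * (\<beta> * \<alpha> 0 ^ (2 ^ k)) \<le> (\<alpha> k * \<beta> ^ (2 ^ k)) * (\<alpha> k * \<beta> ^ (2 ^ k))"
      by (rule mult_mono[OF Suc Suc]) (use nn in auto)
    also have "\<dots> = (\<alpha> k * \<alpha> k) * (\<beta> ^ (2 ^ k) * \<beta> ^ (2 ^ k))" by (simp add: mult_ac)
    also have "\<dots> \<le> (\<alpha> (Suc k) * \<beta>) * (\<beta> ^ (2 ^ k) * \<beta> ^ (2 ^ k))"
      using step[of k] nn by (intro mult_right_mono) auto
    finally have "\<beta> * (\<beta> * (\<alpha> 0 ^ (2 ^ k) * \<alpha> 0 ^ (2 ^ k))) \<le> \<beta> * (\<alpha> (Suc k) * (\<beta> ^ (2 ^ k) * \<beta> ^ (2 ^ k)))"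
      by (simp add: mult_ac)
    then have "\<beta> * (\<alpha> 0 ^ (2 ^ k) * \<alpha> 0 ^ (2 ^ k)) \<le> \<alpha> (Suc k) * (\<beta> ^ (2 ^ k) * \<beta> ^ (2 ^ k))"
      using \<beta> by simp
    moreover have "x ^ (2 ^ k) * x ^ (2 ^ k) = x ^ (2 ^ Suc k)" for x :: real
      by (simp add: mult_2 power_add)
    ultimately show ?case by (simp only:)
  qed
  show ?thesis
  proof (rule ccontr)
    assume "\<not> ?thesis"
    then have "\<alpha> 0 / (\<gamma> * \<beta>) > 1" using \<gamma> \<beta> by (simp add: field_simps)
    then obtain n where n: "C / \<beta> < (\<alpha> 0 / (\<gamma> * \<beta>)) ^ n" using real_arch_pow by blast
    have "n \<le> 2 ^ n" by (simp add: less_imp_le)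
    then have "(\<alpha> 0 / (\<gamma> * \<beta>)) ^ n \<le> (\<alpha> 0 / (\<gamma> * \<beta>)) ^ (2 ^ n)"
      using \<open>\<alpha> 0 / (\<gamma> * \<beta>) > 1\<close> by (intro power_increasing) auto
    also have "\<dots> \<le> C / \<beta>"
    proof -
      have "\<beta> * \<alpha> 0 ^ (2 ^ n) \<le> \<alpha> n * \<beta> ^ (2 ^ n)" by (rule ind)
      also have "\<dots> \<le> C * \<gamma> ^ (2 ^ n) * \<beta> ^ (2 ^ n)" using bd[of n] \<beta> by (intro mult_right_mono) auto
      finally show ?thesis using \<beta> \<gamma> by (simp add: power_divide power_mult_distrib field_simps)
    qed
    finally show False using n by simp
  qed
qed

text \<open>The quotient sends \<open>app h v\<close> to \<open>app k v\<close>; the bound extends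
  it to the closed range of \<open>h\<close>, and composition with the projection \<open>P\<close>
  makes it vanish on the complement.\<close>

lemma douglas_factorization:
  fixes h k :: "'a::chilbert bop"
  assumes C: "\<And>v. norm (app k v) \<le> C * norm (app h v)"
  shows "\<exists>r. r * h = k \<and> (\<forall>w. (\<forall>v. cinner (app h v) w = 0) \<longrightarrow> app r w = 0)"
proof -
  let ?S = "closure (range (app h))"
  obtain P where P: "projects_onto P ?S"
    using projects_onto_exists[of ?S] csubspace_closure[OF csubspace_range_app] by blast
  \<comment> \<open>The graph of the quotient as a relation: linearity is checked on approximating
    sequences, and single-valuedness then follows from linearity and the bound.\<close>
  define L where "L w l \<longleftrightarrow> (\<exists>v. (\<lambda>n. app h (v n)) \<longlonglongrightarrow> app P w \<and> (\<lambda>n. app k (v n)) \<longlonglongrightarrow> l)" for w l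
  have C0: "norm (app k v) \<le> \<bar>C\<bar> * norm (app h v)" for v
    using C[of v] mult_right_mono[OF abs_ge_self[of C] norm_ge_zero[of "app h v"]] by linarith
  have total: "\<exists>l. L w l" for w
  proof -
    have "app P w \<in> ?S" using P by (simp add: projects_onto_def)
    then obtain g where g: "\<And>n. g n \<in> range (app h)" "g \<longlonglongrightarrow> app P w"
      unfolding closure_sequential by blast
    have "\<forall>n. \<exists>u. g n = app h u" using g(1) by blast
    then obtain v where "\<And>n. g n = app h (v n)" using choice[of "\<lambda>n u. g n = app h u"] by blast
    then have "g = (\<lambda>n. app h (v n))" by blast
    then have v: "(\<lambda>n. app h (v n)) \<longlonglongrightarrow> app P w" using g(2) by (simp only:)
    have "Cauchy (\<lambda>n. app k (v n))"
    proof (rule CauchyI)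
      fix e :: real assume e: "0 < e"
      then have "0 < e / (\<bar>C\<bar> + 1)" by simp
      then obtain N where N: "\<And>m n. m \<ge> N \<Longrightarrow> n \<ge> N \<Longrightarrow> norm (app h (v m) - app h (v n)) < e / (\<bar>C\<bar> + 1)"
        using CauchyD[OF LIMSEQ_imp_Cauchy[OF v]] by blast
      have "norm (app k (v m) - app k (v n)) < e" if "m \<ge> N" "n \<ge> N" for m n
      proof -
        have "norm (app k (v m) - app k (v n)) \<le> \<bar>C\<bar> * norm (app h (v m) - app h (v n))"
          using C0[of "v m - v n"] by (simp add: app_diff)
        also have "\<dots> \<le> (\<bar>C\<bar> + 1) * norm (app h (v m) - app h (v n))" by (intro mult_right_mono) auto
        also have "\<dots> < e" using N[OF that] by (simp add: pos_less_divide_eq mult.commute)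
        finally show ?thesis .
      qed
      then show "\<exists>M. \<forall>m\<ge>M. \<forall>n\<ge>M. norm (app k (v m) - app k (v n)) < e" by blast
    qed
    then obtain l where "(\<lambda>n. app k (v n)) \<longlonglongrightarrow> l" by (auto simp: Cauchy_convergent_iff convergent_def)
    with v show ?thesis unfolding L_def by blast
  qed
  have bound: "norm l \<le> \<bar>C\<bar> * norm (app P w)" if Lw: "L w l" for w l
  proof -
    obtain v where v: "(\<lambda>n. app h (v n)) \<longlonglongrightarrow> app P w" "(\<lambda>n. app k (v n)) \<longlonglongrightarrow> l"
      using Lw unfolding L_def by blast
    have "(\<lambda>n. \<bar>C\<bar> * norm (app h (v n))) \<longlonglongrightarrow> \<bar>C\<bar> * norm (app P w)" by (intro tendsto_intros v)
    then show ?thesis using tendsto_norm[OF v(2)] C0 by (intro LIMSEQ_le) auto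
  qed
  have add: "L (w + w') (l + l')" if Ls: "L w l" "L w' l'" for w w' l l'
  proof -
    obtain v v' where v: "(\<lambda>n. app h (v n)) \<longlonglongrightarrow> app P w" "(\<lambda>n. app k (v n)) \<longlonglongrightarrow> l"
      and v': "(\<lambda>n. app h (v' n)) \<longlonglongrightarrow> app P w'" "(\<lambda>n. app k (v' n)) \<longlonglongrightarrow> l'"
      using Ls unfolding L_def by blast
    have "(\<lambda>n. app h (v n + v' n)) \<longlonglongrightarrow> app P (w + w')" "(\<lambda>n. app k (v n + v' n)) \<longlonglongrightarrow> l + l'"
      unfolding app_add by (intro tendsto_add v v')+
    then show ?thesis unfolding L_def by (intro exI[of _ "\<lambda>n. v n + v' n"] conjI)
  qed
  have scale: "L (scaleC c w) (scaleC c l)" if Lw: "L w l" for c w l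
  proof -
    obtain v where v: "(\<lambda>n. app h (v n)) \<longlonglongrightarrow> app P w" "(\<lambda>n. app k (v n)) \<longlonglongrightarrow> l"
      using Lw unfolding L_def by blast
    have "(\<lambda>n. app h (scaleC c (v n))) \<longlonglongrightarrow> app P (scaleC c w)" "(\<lambda>n. app k (scaleC c (v n))) \<longlonglongrightarrow> scaleC c l"
      using app_tendsto[OF v(1), of "scaleC c 1"] app_tendsto[OF v(2), of "scaleC c 1"] by (simp_all add: app_scaleC)
    then show ?thesis unfolding L_def by (intro exI[of _ "\<lambda>n. scaleC c (v n)"] conjI)
  qed
  have uniq: "l = l'" if "L w l" "L w l'" for w l l'
  proof -
    have "L (w + scaleC (- 1) w) (l + scaleC (- 1) l')" by (intro add scale that)
    then have "norm (l - l') \<le> \<bar>C\<bar> * norm (app P (w - w))"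
      using bound by (simp add: scaleC_one) (metis app_zero mult_zero_right norm_le_zero_iff norm_zero right_minus_eq)
    then show ?thesis by simp
  qed
  obtain f where f: "\<And>w. L w (f w)" using total by metis
  have "f \<in> BH"
  proof (rule BH_I[where K = "\<bar>C\<bar>"])
    fix x y :: 'a and c
    show "f (x + y) = f x + f y" by (rule uniq[OF f add[OF f f]])
    show "f (scaleC c x) = scaleC c (f x)" by (rule uniq[OF f scale[OF f]])
    have "norm (app P x) \<le> norm x" using P isproj_norm_le by (auto simp: projects_onto_def)
    then show "norm (f x) \<le> \<bar>C\<bar> * norm x"
      using bound[OF f, of x] mult_left_mono[of "norm (app P x)" "norm x" "\<bar>C\<bar>"] by linarith
  qed
  then have f': "app (Bop f) = f" by (rule Bop_inverse)
  have "Bop f * h = k"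
  proof (rule bop_eqI)
    fix v
    have "app h v \<in> ?S" using closure_subset[of "range (app h)"] by blast
    then have "app P (app h v) = app h v" using P by (simp add: projects_onto_def)
    then have "L (app h v) (app k v)" unfolding L_def by (intro exI[of _ "\<lambda>_. v"]) simp
    then show "app (Bop f * h) v = app k v" using uniq f by (simp add: f') blast
  qed
  moreover have "app (Bop f) w = 0" if w: "\<And>v. cinner (app h v) w = 0" for w
  proof -
    have "?S \<subseteq> {u. cinner w u = 0}"
    proof (rule closure_minimal)
      show "closed {u. cinner w u = 0}"
        by (intro closed_Collect_eq linear_continuous_on bounded_linear_cinner_right continuous_on_const)
      show "range (app h) \<subseteq> {u. cinner w u = 0}" using w by (auto simp: cinner_commute[of w])
    qed
    then have "cinner w (app P w) = 0" using P by (auto simp: projects_onto_def)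
    then have "app P w = 0" using isproj_norm_sq[of P w] P by (simp add: projects_onto_def)
    then show ?thesis using bound[OF f, of w] by (simp add: f')
  qed
  ultimately show ?thesis by blast
qed

locale symmetric_zero_product_map = zero_product_map M \<psi> K + N: vna N
  for M :: "'a::chilbert bop set" and \<psi> :: "'a bop \<Rightarrow> 'b::chilbert bop" and K and N :: "'b bop set" +
  assumes maps: "a \<in> M \<Longrightarrow> \<psi> a \<in> N" and symmetric: "a \<in> M \<Longrightarrow> \<psi> (star a) = star (\<psi> a)"
begin

lemma unit_selfadjoint: "star (\<psi> 1) = \<psi> 1"
  using symmetric[of 1] by simp

text \<open>Each passage from \<open>b\<close> to \<open>star b * b\<close> costs one factor
  \<open>norm (app (\<psi> 1) v)\<close> by Cauchy-Schwarz and squares the bound on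
  \<open>b\<close>, while \<open>K\<close> stays a single factor; so \<open>K\<close> can be removed
  by \<open>quadratic_growth_bound\<close>.\<close>

lemma norm_le_unit:
  assumes a: "a \<in> M" and \<gamma>: "0 < \<gamma>" "opbound a \<gamma>"
  shows "norm (app (\<psi> a) v) \<le> \<gamma> * norm (app (\<psi> 1) v)"
proof -
  define b where "b = rec_nat a (\<lambda>_ x. star x * x)"
  have b0: "b 0 = a" and bS: "\<And>k. b (Suc k) = star (b k) * b k" by (simp_all add: b_def)
  have bM: "b k \<in> M" for k by (induction k) (auto simp: b0 bS a star_mem)
  have bb: "opbound (b k) (\<gamma> ^ (2 ^ k))" for k
  proof (induction k)
    case (Suc k)
    have "opbound (star (b k) * b k) (\<gamma> ^ (2 ^ k) * \<gamma> ^ (2 ^ k))"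
      using Suc \<gamma>(1) by (intro opbound_mult opbound_star) auto
    then show ?case by (simp add: bS mult_2 power_add)
  qed (use \<gamma> b0 in simp)
  have "norm (app (\<psi> (b 0)) v) \<le> \<gamma> * norm (app (\<psi> 1) v)"
  proof (rule quadratic_growth_bound[where \<alpha> = "\<lambda>k. norm (app (\<psi> (b k)) v)" and C = "K * norm v"])
    fix k
    show "norm (app (\<psi> (b k)) v) \<le> K * norm v * \<gamma> ^ (2 ^ k)"
      using opboundD[OF K(2)[OF bM _ bb, of k], of v] \<gamma>(1) by (simp add: mult_ac)
    have "norm (app (\<psi> (b k)) v) * norm (app (\<psi> (b k)) v) = Re (cinner v (app (star (\<psi> (b k)) * \<psi> (b k)) v))"
      unfolding cinner_star_mult by (simp add: power2_eq_square)
    also have "star (\<psi> (b k)) * \<psi> (b k) = \<psi> 1 * \<psi> (b (Suc k))"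
      using product[OF star_mem[OF bM] bM, of k k] symmetric[OF bM, of k] by (simp add: bS)
    also have "Re (cinner v (app (\<psi> 1 * \<psi> (b (Suc k))) v)) = Re (cinner (app (\<psi> 1) v) (app (\<psi> (b (Suc k))) v))"
      using cinner_star[of "\<psi> 1" v] unit_selfadjoint by simp
    also have "\<dots> \<le> norm (app (\<psi> 1) v) * norm (app (\<psi> (b (Suc k))) v)" by (rule Re_cinner_le)
    finally show "norm (app (\<psi> (b k)) v) * norm (app (\<psi> (b k)) v)
        \<le> norm (app (\<psi> (b (Suc k))) v) * norm (app (\<psi> 1) v)" by (simp add: mult.commute)
  qed (use \<gamma> in auto)
  then show ?thesis by (simp add: b0)
qed

text \<open>\<open>\<rho> a\<close> is the Douglas quotient of \<open>\<psi> a\<close> by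
  \<open>h\<close>, normalized by \<open>r * P = r\<close> with the range projection
  \<open>P\<close> of \<open>h\<close>. As \<open>h\<close> is self-adjoint, \<open>P\<close> is its
  support on both sides, so identities may be checked after multiplying by \<open>h\<close> on
  either side.\<close>

theorem symmetric_factorization:
  "\<exists>\<rho>. (\<forall>a\<in>M. \<rho> a \<in> N \<and> \<psi> a = \<psi> 1 * \<rho> a \<and> \<rho> (star a) = star (\<rho> a)) \<and>
    (\<forall>a\<in>M. \<forall>b\<in>M. \<rho> (a + b) = \<rho> a + \<rho> b \<and> \<rho> (a * b) = \<rho> a * \<rho> b) \<and>
    (\<forall>a\<in>M. \<forall>c. \<rho> (scaleC c a) = scaleC c (\<rho> a))"
proof -
  define h where "h = \<psi> 1"
  have hN: "h \<in> N" and sh: "star h = h" using maps unit_selfadjoint by (simp_all add: h_def)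
  obtain P where P: "N.is_rproj h P" and supp: "\<And>s. s * h = 0 \<Longrightarrow> s * P = 0"
    using N.rproj_exists[OF hN] by blast
  have PN: "P \<in> N" and Pp: "P * P = P" "star P = P" and Ph: "P * h = h"
    using P by (auto simp: N.is_rproj_def isproj_def)
  have hP: "h * P = h" using arg_cong[OF Ph, of star] sh Pp by simp
  have right_cancel: "s = t" if "s * h = t * h" "s * P = s" "t * P = t" for s t
  proof -
    have "(s - t) * P = 0" by (rule supp) (simp add: left_diff_distrib that)
    then show ?thesis using that by (simp add: left_diff_distrib)
  qed
  have left_cancel: "s = t" if "h * s = h * t" "P * s = s" "P * t = t" for s t
  proof -
    have "star s = star t"
    proof (rule right_cancel)
      show "star s * h = star t * h" using arg_cong[OF that(1), of star] sh by simp
      show "star s * P = star s" "star t * P = star t"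
        using arg_cong[OF that(2), of star] arg_cong[OF that(3), of star] Pp by simp_all
    qed
    then show ?thesis by (metis star_star)
  qed
  have "\<exists>r. r * h = \<psi> a \<and> r * P = r" if a: "a \<in> M" for a
  proof -
    obtain \<gamma> where \<gamma>: "\<gamma> > 0" "opbound a \<gamma>" using opbound_exists by blast
    obtain r where r: "r * h = \<psi> a" "\<And>w. (\<And>v. cinner (app h v) w = 0) \<Longrightarrow> app r w = 0"
      using douglas_factorization[of "\<psi> a" \<gamma> h] norm_le_unit[OF a \<gamma>] unfolding h_def by blast
    have "app r (w - app P w) = 0" for w
    proof (rule r(2))
      fix v
      have "cinner (app h v) (app P w) = cinner (app P (app h v)) w" using Pp by (metis cinner_star)
      then show "cinner (app h v) (w - app P w) = 0"
        using Ph by (metis app_simps(5) cancel_comm_monoid_add_class.diff_cancel cinner_diff_right)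
    qed
    then have "r * P = r" by (intro bop_eqI) (simp add: app_diff)
    with r(1) show ?thesis by blast
  qed
  then obtain r where r: "\<And>a. a \<in> M \<Longrightarrow> r a * h = \<psi> a \<and> r a * P = r a" by metis
  have rh: "r a * h = \<psi> a" and rP: "r a * P = r a" if "a \<in> M" for a using r[OF that] by auto
  \<comment> \<open>Douglas factorization provides \<open>h\<close> only on the right. Since
    \<open>\<psi> a\<close> commutes with \<open>h\<close>, both sides agree after one more right
    factor \<open>h\<close>, which cancels.\<close>
  have hr: "h * r a = \<psi> a" if a: "a \<in> M" for a
  proof (rule right_cancel)
    show "h * r a * h = \<psi> a * h" using unit_commutes[OF a] rh[OF a] by (simp add: h_def mult.assoc)
    show "h * r a * P = h * r a" using rP[OF a] by (simp add: mult.assoc)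
    show "\<psi> a * P = \<psi> a" using rh[OF a] hP by (metis mult.assoc)
  qed
  have Pr: "P * r a = r a" if a: "a \<in> M" for a
  proof (rule right_cancel)
    show "P * r a * h = r a * h" using rh[OF a] hr[OF a] Ph by (metis mult.assoc)
    show "P * r a * P = P * r a" using rP[OF a] by (simp add: mult.assoc)
  qed (use rP[OF a] in simp)
  \<comment> \<open>The quotient was built from vectors, without regard to the algebra. Every
    \<open>t\<close> in the commutant commutes with \<open>h\<close>, \<open>P\<close> and
    \<open>\<psi> a\<close>, hence with \<open>r a\<close> after cancelling
    \<open>h\<close>.\<close>
  have rN: "r a \<in> N" if a: "a \<in> M" for a
  proof (rule N.memI)
    fix t assume t: "t \<in> cmt N"
    have tP: "P * t = t * P" and th: "h * t = t * h" and tpsi: "\<psi> a * t = t * \<psi> a"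
      using N.cmtD[OF t] PN hN maps[OF a] by auto
    show "r a * t = t * r a"
    proof (rule right_cancel)
      show "r a * t * h = t * r a * h" using th tpsi rh[OF a] by (metis mult.assoc)
      show "r a * t * P = r a * t" using tP rP[OF a] by (metis mult.assoc)
      show "t * r a * P = t * r a" using rP[OF a] by (simp add: mult.assoc)
    qed
  qed
  have radd: "r (a + b) = r a + r b" if "a \<in> M" "b \<in> M" for a b
    by (rule right_cancel) (use that in \<open>simp_all add: rh rP add distrib_right\<close>)
  have rscale: "r (scaleC c a) = scaleC c (r a)" if "a \<in> M" for a c
    by (rule right_cancel) (use that in \<open>simp_all add: rh rP scale\<close>)
  \<comment> \<open>Cancelling \<open>h\<close> on the right and then on the left reduces the claim
    to \<open>\<psi> a * \<psi> b = h * \<psi> (a * b)\<close>.\<close>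
  have rmult: "r (a * b) = r a * r b" if ab: "a \<in> M" "b \<in> M" for a b
  proof (rule right_cancel)
    show "r (a * b) * h = r a * r b * h"
    proof (rule left_cancel)
      have "h * (r a * r b * h) = \<psi> a * \<psi> b" using hr[OF ab(1)] rh[OF ab(2)] by (simp flip: mult.assoc) (simp add: mult.assoc)
      also have "\<dots> = h * (r (a * b) * h)" using product[OF ab] ab by (simp add: rh flip: h_def)
      finally show "h * (r (a * b) * h) = h * (r a * r b * h)" by simp
      show "P * (r (a * b) * h) = r (a * b) * h" "P * (r a * r b * h) = r a * r b * h"
        using Pr ab by (simp_all flip: mult.assoc)
    qed
    show "r (a * b) * P = r (a * b)" "r a * r b * P = r a * r b" using rP ab by (simp_all add: mult.assoc)
  qed
  have rstar: "r (star a) = star (r a)" if a: "a \<in> M" for a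
  proof (rule left_cancel)
    have "h * star (r a) = star (r a * h)" by (simp add: sh)
    then show "h * r (star a) = h * star (r a)" using rh[OF a] hr[OF star_mem[OF a]] symmetric[OF a] by simp
    show "P * r (star a) = r (star a)" using Pr[OF star_mem[OF a]] .
    show "P * star (r a) = star (r a)" using arg_cong[OF rP[OF a], of star] Pp by simp
  qed
  show ?thesis
    by (rule exI[of _ r]) (auto simp: rN hr radd rscale rmult rstar h_def[symmetric])
qed

end

section \<open>Transfer to sets of operators\<close>

definition bops :: "('a::chilbert \<Rightarrow> 'a) set \<Rightarrow> 'a bop set" where
  "bops A = {T. app T \<in> A}"

lemma app_comp: "app (S * T) = app S \<circ> app T"
  and app_op_add: "app (S + T) = op_add (app S) (app T)"
  and app_op_scale: "app (scaleC c T) = op_scale c (app T)"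
  and app_op_zero: "app 0 = op_zero"
  by (auto simp: op_add_def op_scale_def op_zero_def)

lemma app_star: "app (star T) = adj (app T)"
  by transfer simp

lemma commutant_eq: "S \<subseteq> BH \<Longrightarrow> commutant S = app ` cmt (bops S)"
proof (intro equalityI subsetI)
  fix x assume S: "S \<subseteq> BH" and x: "x \<in> commutant S"
  then have xB: "app (Bop x) = x" by (simp add: commutant_def Bop_inverse)
  have "Bop x * s = s * Bop x" if "s \<in> bops S" for s
    using x that by (simp add: commutant_def bops_def app_comp xB flip: app_inject)
  then show "x \<in> app ` cmt (bops S)" using xB by (intro image_eqI[of _ _ "Bop x"]) (auto simp: cmt_def)
next
  fix x assume S: "S \<subseteq> BH" and "x \<in> app ` cmt (bops S)"
  then obtain t where t: "x = app t" "t \<in> cmt (bops S)" by blast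
  have "x \<circ> s = s \<circ> x" if "s \<in> S" for s
  proof -
    have "app (Bop s) = s" using S that by (simp add: Bop_inverse subset_iff)
    then have "t * Bop s = Bop s * t" using t(2) that by (simp add: cmt_def bops_def)
    then show ?thesis using \<open>app (Bop s) = s\<close> t(1) by (metis app_comp)
  qed
  then show "x \<in> commutant S" using t(1) app by (auto simp: commutant_def)
qed

lemma bops_image: "bops (app ` T) = T"
  by (auto simp: bops_def app_inject)

locale raw_vna = fixes A :: "('a::chilbert \<Rightarrow> 'a) set"
  assumes A: "von_neumann_algebra A"
begin

lemma A_BH: "A \<subseteq> BH"
  using A by (simp add: von_neumann_algebra_def)

lemma app_Bop: "a \<in> A \<Longrightarrow> app (Bop a) = a"
  using A_BH by (intro Bop_inverse) auto

lemma Bop_mem: "a \<in> A \<Longrightarrow> Bop a \<in> bops A"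
  by (simp add: bops_def app_Bop)

lemma app_bops: "T \<in> bops A \<Longrightarrow> app T \<in> A"
  by (simp add: bops_def)

sublocale vna "bops A"
proof
  show "star a \<in> bops A" if "a \<in> bops A" for a
    using that A by (simp add: bops_def app_star von_neumann_algebra_def)
  have "app ` cmt (bops A) \<subseteq> BH" using app by blast
  then have "commutant (commutant A) = app ` cmt (cmt (bops A))"
    by (simp add: commutant_eq A_BH bops_image)
  then show "cmt (cmt (bops A)) = bops A"
    using A bops_image[of "cmt (cmt (bops A))"] by (simp add: von_neumann_algebra_def)
qed

lemma is_proj_app: "is_proj A (app p) \<longleftrightarrow> p \<in> bops A \<and> isproj p"
  by (simp add: is_proj_def isproj_def bops_def app_inject flip: app_comp app_star)

lemma central_projection_app: "central_projection A (app z) \<longleftrightarrow> is_cproj z"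
proof -
  have "(\<forall>a\<in>A. app z \<circ> a = a \<circ> app z) \<longleftrightarrow> (\<forall>a\<in>bops A. z * a = a * z)"
    by (metis app_Bop app_comp app_inject app_bops Bop_mem)
  then show ?thesis by (auto simp: central_projection_def is_proj_app is_cproj_def)
qed

text \<open>One inclusion between the two sets holds for every idempotent in the algebra, as
  \<open>p * scaleC \<mu> p * p = scaleC \<mu> p\<close>; the set equality therefore amounts to the
  other one, recorded in \<open>mp\<close>.\<close>

lemma minimal_projection_app: "minimal_projection A (app p) \<longleftrightarrow> mp p"
proof -
  have "{app p \<circ> a \<circ> app p |a. a \<in> A} = {op_scale \<mu> (app p) |\<mu>. True} \<longleftrightarrow> (\<forall>a\<in>bops A. \<exists>\<mu>. p * a * p = scaleC \<mu> p)"
    if p: "p \<in> bops A" "p * p = p"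
  proof -
    have eq: "(\<exists>\<mu>. app p \<circ> a \<circ> app p = op_scale \<mu> (app p)) \<longleftrightarrow> (\<exists>\<mu>. p * Bop a * p = scaleC \<mu> p)" if "a \<in> A" for a
      using app_Bop[OF that] by (metis app_comp app_inject app_op_scale)
    have "op_scale \<mu> (app p) = app p \<circ> app (scaleC \<mu> p) \<circ> app p" for \<mu>
      using p(2) by (simp add: mult.assoc flip: app_comp app_op_scale)
    then have "{op_scale \<mu> (app p) |\<mu>. True} \<subseteq> {app p \<circ> a \<circ> app p |a. a \<in> A}"
      using p(1) app_bops mem_simps(6) by blast
    then have "{app p \<circ> a \<circ> app p |a. a \<in> A} = {op_scale \<mu> (app p) |\<mu>. True} \<longleftrightarrow>
        (\<forall>a\<in>A. \<exists>\<mu>. app p \<circ> a \<circ> app p = op_scale \<mu> (app p))" by blast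
    also have "\<dots> \<longleftrightarrow> (\<forall>a\<in>A. \<exists>\<mu>. p * Bop a * p = scaleC \<mu> p)" using eq by blast
    also have "\<dots> \<longleftrightarrow> (\<forall>a\<in>bops A. \<exists>\<mu>. p * a * p = scaleC \<mu> p)"
      using Bop_mem app_bops app_inverse by metis
    finally show ?thesis .
  qed
  moreover have "app p = op_zero \<longleftrightarrow> p = 0" by (simp only: app_op_zero[symmetric] app_inject)
  ultimately show ?thesis
    unfolding minimal_projection_def mp_def is_proj_app isproj_def by blast
qed

text \<open>The definite description is resolved by uniqueness: two commuting projections, each
  below the other, coincide.\<close>

lemma central_support_app:
  assumes "is_csupp e z"
  shows "central_support A (app e) = app z"
  unfolding central_support_def
proof (rule the_equality)
  show z: "central_projection A (app z) \<and> app z \<circ> app e = app e \<and>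
      (\<forall>w. central_projection A w \<and> w \<circ> app e = app e \<longrightarrow> app z \<circ> w = app z)"
  proof (intro conjI allI impI)
    show "central_projection A (app z)" "app z \<circ> app e = app e"
      using assms by (simp_all add: central_projection_app is_csupp_def flip: app_comp)
    fix w assume w: "central_projection A w \<and> w \<circ> app e = app e"
    then have ww: "app (Bop w) = w" by (intro app_Bop) (simp add: central_projection_def is_proj_def)
    then have "is_cproj (Bop w)" "Bop w * e = e"
      using w by (metis central_projection_app, metis app_comp app_inject)
    then have "z * Bop w = z" using assms by (simp add: is_csupp_def)
    then show "app z \<circ> w = app z" using ww by (metis app_comp)
  qed
  fix w assume w: "central_projection A w \<and> w \<circ> app e = app e \<and>
      (\<forall>v. central_projection A v \<and> v \<circ> app e = app e \<longrightarrow> w \<circ> v = w)"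
  then have ww: "app (Bop w) = w" by (intro app_Bop) (simp add: central_projection_def is_proj_def)
  have "w \<circ> app z = w" "app z \<circ> w = app z" using w z by blast+
  moreover have "app z \<circ> w = w \<circ> app z"
    using z w unfolding central_projection_def is_proj_def by blast
  ultimately show "w = app z" by simp
qed

lemma range_projection_app:
  assumes "is_rproj x r"
  shows "range_projection A (app x) = app r"
  unfolding range_projection_def
proof (rule the_equality)
  show r: "is_proj A (app r) \<and> app r \<circ> app x = app x \<and>
      (\<forall>q. is_proj A q \<and> q \<circ> app x = app x \<longrightarrow> app r \<circ> q = app r)"
  proof (intro conjI allI impI)
    show "is_proj A (app r)" "app r \<circ> app x = app x"
      using assms by (simp_all add: is_proj_app is_rproj_def flip: app_comp)
    fix q assume q: "is_proj A q \<and> q \<circ> app x = app x"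
    then have qq: "app (Bop q) = q" by (intro app_Bop) (simp add: is_proj_def)
    then have "Bop q \<in> bops A \<and> isproj (Bop q)" "Bop q * x = x"
      using q by (metis is_proj_app, metis app_comp app_inject)
    then have "r * Bop q = r" using assms by (simp add: is_rproj_def)
    then show "app r \<circ> q = app r" using qq by (metis app_comp)
  qed
  fix w assume w: "is_proj A w \<and> w \<circ> app x = app x \<and>
      (\<forall>q. is_proj A q \<and> q \<circ> app x = app x \<longrightarrow> w \<circ> q = w)"
  then have ww: "app (Bop w) = w" by (intro app_Bop) (simp add: is_proj_def)
  have "w \<circ> app r = w" "app r \<circ> w = app r" using w r by blast+
  then have "Bop w * r = Bop w" "r * Bop w = r" using ww by (metis app_comp app_inject)+
  moreover have "isproj (Bop w)" "isproj r" using w r ww is_proj_app by metis+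
  ultimately have "Bop w = r" using isproj_le_commute by metis
  then show "w = app r" using ww by simp
qed

lemma fam_atomic_dim:
  assumes "fam q F"
  shows "enat (card F) \<le> atomic_dim A (app q)"
proof -
  have "card (app ` F) = card F" by (intro card_image inj_onI) (simp add: app_inject)
  moreover have "enat (card (app ` F)) \<le> atomic_dim A (app q)"
    unfolding atomic_dim_def
    using assms by (intro SUP_upper)
      (auto simp: fam_def minimal_projection_app app_inject simp flip: app_comp app_op_zero)
  ultimately show ?thesis by simp
qed

text \<open>An infinite supremum is not attained, but every finite \<open>n\<close> below it is
  reached: if all sizes were below \<open>n = Suc m\<close>, the supremum would be at most
  \<open>m\<close>. A larger family is cut down to \<open>n\<close> members.\<close>

lemma atomic_dim_fam:
  assumes "enat n \<le> atomic_dim A (app q)"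
  shows "\<exists>F. fam q F \<and> card F = n"
proof -
  define X where "X = {F. finite F \<and> (\<forall>p\<in>F. minimal_projection A p \<and> p \<circ> app q = p) \<and>
      (\<forall>p\<in>F. \<forall>p'\<in>F. p \<noteq> p' \<longrightarrow> p \<circ> p' = op_zero)}"
  have dim: "atomic_dim A (app q) = (SUP F\<in>X. enat (card F))" by (simp add: atomic_dim_def X_def)
  have "\<exists>F\<in>X. n \<le> card F"
  proof (rule ccontr)
    assume none: "\<not> ?thesis"
    have "{} \<in> X" by (simp add: X_def)
    then have "n \<noteq> 0" using none by auto
    then obtain m where m: "n = Suc m" using not0_implies_Suc by blast
    have "atomic_dim A (app q) \<le> enat m"
      unfolding dim
    proof (rule SUP_least)
      fix F assume "F \<in> X"
      then have "\<not> n \<le> card F" using none by blast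
      then show "enat (card F) \<le> enat m" by (simp add: m)
    qed
    with assms have "enat n \<le> enat m" by (rule order_trans)
    then show False using m by simp
  qed
  then obtain F where FX: "F \<in> X" and Fn: "n \<le> card F" by blast
  have F: "finite F" "\<And>p. p \<in> F \<Longrightarrow> minimal_projection A p" "\<And>p. p \<in> F \<Longrightarrow> p \<circ> app q = p"
    "\<And>p p'. p \<in> F \<Longrightarrow> p' \<in> F \<Longrightarrow> p \<noteq> p' \<Longrightarrow> p \<circ> p' = op_zero"
    using FX unfolding X_def by blast+
  have pB: "app (Bop p) = p" if "p \<in> F" for p
    using F(2)[OF that] by (intro app_Bop) (simp add: minimal_projection_def is_proj_def)
  have "fam q (Bop ` F)"
    unfolding fam_def
  proof (intro conjI ballI impI)
    show "finite (Bop ` F)" using F(1) by simp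
    fix p assume "p \<in> Bop ` F"
    then have p: "app p \<in> F" using pB by auto
    show "mp p" using F(2)[OF p] minimal_projection_app by simp
    show "p * q = p" using F(3)[OF p] by (simp only: app_comp[symmetric] app_inject)
    fix p' assume "p' \<in> Bop ` F" and ne: "p \<noteq> p'"
    then have p': "app p' \<in> F" using pB by auto
    have "app p \<noteq> app p'" using ne by (simp add: app_inject)
    from F(4)[OF p p' this] show "p * p' = 0"
      by (simp only: app_comp[symmetric] app_op_zero[symmetric] app_inject)
  qed
  moreover have "card (Bop ` F) = card F" using pB by (intro card_image inj_onI) metis
  moreover from this obtain G where "G \<subseteq> Bop ` F" "card G = n"
    using Fn obtain_subset_with_card_n[of n "Bop ` F"] by metis
  ultimately show ?thesis using fam_subset by blast
qed

end

theorem mainTheorem19: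
  fixes A :: "('h::chilbert \<Rightarrow> 'h) set" and B :: "('k::chilbert \<Rightarrow> 'k) set"
    and \<phi> :: "('h \<Rightarrow> 'h) \<Rightarrow> ('k \<Rightarrow> 'k)" and c :: "'h \<Rightarrow> 'h"
  assumes vnA: "von_neumann_algebra A" and vnB: "von_neumann_algebra B"
    and atomic_nonzero: "\<exists>u. minimal_partial_isometry A u"
    and c_soc: "c \<in> soc A"
    and rank_cond: "\<forall>e. minimal_projection A e \<longrightarrow>
        rank_pi A (central_support A e) c + 2 \<le> dim_H A (central_support A e)"
    and lin: "linear_on A B \<phi>"
    and pp: "product_property_at A B \<phi> c"
  shows "preserves_zero_products A \<phi>
    \<and> (bounded_on A \<phi> \<and> symmetric_on A \<phi> \<longrightarrow>
         (\<exists>h\<in>B. (\<forall>a\<in>A. h \<circ> \<phi> a = \<phi> a \<circ> h) \<and>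
            (\<exists>\<rho>. star_homomorphism_on A B \<rho> \<and> (\<forall>a\<in>A. \<phi> a = h \<circ> \<rho> a))))
    \<and> (bounded_on A \<phi> \<and> \<phi> ` A = B \<longrightarrow>
         (\<exists>h\<in>B. (\<forall>a\<in>A. h \<circ> \<phi> a = \<phi> a \<circ> h) \<and>
            (\<exists>\<rho>. homomorphism_on A B \<rho> \<and> \<rho> ` A = B \<and> (\<forall>a\<in>A. \<phi> a = h \<circ> \<rho> a))))"
proof -
  interpret A: raw_vna A by unfold_locales (rule vnA)
  interpret B: raw_vna B by unfold_locales (rule vnB)
  define M where "M = bops A"
  define N where "N = bops B"
  have \<phi>B: "\<phi> a \<in> B" if "a \<in> A" for a using lin that by (auto simp: linear_on_def)
  \<comment> \<open>Off \<open>M\<close> the value of \<open>\<phi>\<close> may be unbounded, so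
    \<open>Bop\<close> is meaningful only on \<open>M\<close>; the facts on \<open>\<psi>\<close>
    carry this restriction.\<close>
  define \<psi> where "\<psi> T = Bop (\<phi> (app T))" for T
  have app_\<psi>: "app (\<psi> T) = \<phi> (app T)" if "T \<in> M" for T
    using \<phi>B[OF A.app_bops] that B.app_Bop by (simp add: \<psi>_def M_def)
  have \<phi>\<psi>: "\<phi> a = app (\<psi> (Bop a))" if "a \<in> A" for a
    using app_\<psi>[OF A.Bop_mem[OF that, folded M_def]] A.app_Bop[OF that] by simp
  have \<psi>N: "\<psi> T \<in> N" if "T \<in> M" for T
    using app_\<psi>[OF that] \<phi>B[OF A.app_bops] that by (simp add: N_def M_def bops_def)
  have \<psi>_add: "\<psi> (a + b) = \<psi> a + \<psi> b" if "a \<in> M" "b \<in> M" for a b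
  proof -
    have "app (\<psi> (a + b)) = app (\<psi> a + \<psi> b)"
      using that lin A.app_bops A.mem_simps(3)
      by (simp add: app_\<psi> M_def app_op_add linear_on_def del: app_simps)
    then show ?thesis by (simp only: app_inject)
  qed
  have \<psi>_scale: "\<psi> (scaleC s a) = scaleC s (\<psi> a)" if "a \<in> M" for a s
  proof -
    have "app (\<psi> (scaleC s a)) = app (scaleC s (\<psi> a))"
      using that lin A.app_bops A.mem_simps(6)
      by (simp add: app_\<psi> M_def app_op_scale linear_on_def del: app_simps)
    then show ?thesis by (simp only: app_inject)
  qed
  obtain P \<mu> where P: "finite P" "\<And>p. p \<in> P \<Longrightarrow> minimal_projection A p"
    and c: "c = (\<lambda>x. \<Sum>p\<in>P. scaleC (\<mu> p) (p x))" using c_soc by (auto simp: soc_def)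
  have PB: "app (Bop p) = p" if "p \<in> P" for p
    using P(2)[OF that] by (intro A.app_Bop) (auto simp: minimal_projection_def is_proj_def)
  define P' where "P' = Bop ` P"
  define c' where "c' = (\<Sum>p\<in>P'. scaleC (\<mu> (app p)) p)"
  have finP': "finite P'" using P(1) by (simp add: P'_def)
  have mpP': "A.mp p" if "p \<in> P'" for p
  proof -
    obtain q where "q \<in> P" "p = Bop q" using \<open>p \<in> P'\<close> by (auto simp: P'_def)
    then show ?thesis using P(2) PB A.minimal_projection_app by metis
  qed
  have "inj_on Bop P" using PB by (intro inj_onI) metis
  then have c'c: "app c' = c"
    using PB by (auto simp: c'_def c P'_def sum.reindex app_sum)
  obtain T where T: "\<And>a b. a \<in> A \<Longrightarrow> b \<in> A \<Longrightarrow> a \<circ> b = c \<Longrightarrow> \<phi> a \<circ> \<phi> b = T (a \<circ> b)"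
    using pp by (auto simp: product_property_at_def)
  have zero: "\<psi> a * \<psi> b = 0" if "a \<in> M" "b \<in> M" "a * b = 0" for a b
  proof (rule A.zero_products[OF finP' mpP' c'_def _ \<psi>_add[unfolded M_def] _ that[unfolded M_def]])
    \<comment> \<open>The rank condition is used at \<open>g\<close>, whose central support is
      \<open>z\<close>. The size of \<open>F\<close> is at most the rank, so
      \<open>card F + 2\<close> is at most the dimension and is realized by a family below
      \<open>z\<close>.\<close>
    fix z R F assume z: "A.cclass z" and R: "A.is_rproj (z * c') R" and F: "A.fam R F"
    obtain g where g: "A.mp g" "A.is_csupp g z" using z by (auto simp: A.cclass_def)
    have "atomic_dim A (app R) + 2 \<le> atomic_dim A (app z)"
      using rank_cond[rule_format, of "app g"] g(1) A.central_support_app[OF g(2)]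
        A.range_projection_app[OF R] c'c
      by (simp add: A.minimal_projection_app rank_pi_def dim_H_def app_comp del: app_simps)
    moreover have "enat (card F + 2) \<le> atomic_dim A (app R) + 2"
      using add_right_mono[OF A.fam_atomic_dim[OF F], of "enat 2"]
      by (simp only: plus_enat_simps(1) numeral_eq_enat)
    ultimately have "enat (card F + 2) \<le> atomic_dim A (app z)" by (rule order_trans[rotated])
    then show "\<exists>G. A.fam z G \<and> card G = card F + 2" by (rule A.atomic_dim_fam)
  next
    fix a b assume ab: "a \<in> bops A" "b \<in> bops A" "a * b = c'"
    then have "app a \<circ> app b = c" using c'c by (simp flip: app_comp)
    then have "\<phi> (app a) \<circ> \<phi> (app b) = T c" using T ab A.app_bops by metis
    then have "app (\<psi> a * \<psi> b) = T c" using ab by (simp add: app_comp app_\<psi> M_def del: app_simps)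
    then show "\<psi> a * \<psi> b = Bop (T c)" by (metis app_inverse)
  qed
  have "preserves_zero_products A \<phi>"
    unfolding preserves_zero_products_def
  proof (intro ballI impI)
    fix a b assume ab: "a \<in> A" "b \<in> A" "a \<circ> b = op_zero"
    then have "Bop a * Bop b = 0"
      by (metis A.app_Bop app_comp app_inject app_op_zero)
    then have "\<psi> (Bop a) * \<psi> (Bop b) = 0" using zero A.Bop_mem ab M_def by auto
    then show "\<phi> a \<circ> \<phi> b = op_zero" using \<phi>\<psi> ab by (metis app_comp app_op_zero)
  qed
  moreover have zpm: "\<exists>K. zero_product_map M \<psi> K" if bounded: "bounded_on A \<phi>"
  proof -
    obtain K where K: "\<And>a. a \<in> A \<Longrightarrow> onorm (\<phi> a) \<le> K * onorm a" using bounded by (auto simp: bounded_on_def)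
    \<comment> \<open>\<open>max K 0\<close> supplies the nonnegative constant that
      \<open>zero_product_map\<close> asks for.\<close>
    have bd: "opbound (\<psi> a) (max K 0 * \<gamma>)" if a: "a \<in> M" and \<gamma>: "0 \<le> \<gamma>" "opbound a \<gamma>" for a \<gamma>
      unfolding opbound_def
    proof
      fix v
      have "onorm (app a) \<le> \<gamma>" using \<gamma> by (intro onorm_bound) (auto simp: opbound_def)
      moreover have "0 \<le> onorm (app a)" by (rule onorm_pos_le[OF app_bounded_linear])
      ultimately have "K * onorm (app a) \<le> max K 0 * \<gamma>" by (intro mult_mono) auto
      then have "onorm (app (\<psi> a)) \<le> max K 0 * \<gamma>"
        using K[of "app a"] A.app_bops a by (fastforce simp: app_\<psi> M_def)
      then show "norm (app (\<psi> a) v) \<le> max K 0 * \<gamma> * norm v"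
        using onorm[OF app_bounded_linear, of "\<psi> a" v]
        by (meson mult_right_mono norm_ge_zero order_trans)
    qed
    have "zero_product_map M \<psi> (max K 0)"
      unfolding M_def by unfold_locales (use \<psi>_add \<psi>_scale zero bd in \<open>auto simp: M_def\<close>)
    then show ?thesis by blast
  qed
  have hom: "homomorphism_on A B (\<lambda>a. app (\<rho> (Bop a)))"
    if \<rho>: "\<And>a. a \<in> M \<Longrightarrow> \<rho> a \<in> N" "\<And>a b. a \<in> M \<Longrightarrow> b \<in> M \<Longrightarrow> \<rho> (a + b) = \<rho> a + \<rho> b \<and> \<rho> (a * b) = \<rho> a * \<rho> b"
      "\<And>a s. a \<in> M \<Longrightarrow> \<rho> (scaleC s a) = scaleC s (\<rho> a)" for \<rho>
  proof -
    have B1: "Bop (op_add a b) = Bop a + Bop b" "Bop (a \<circ> b) = Bop a * Bop b" if "a \<in> A" "b \<in> A" for a b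
      using A.app_Bop that by (metis app_op_add app_inverse, metis app_comp app_inverse)
    have B2: "Bop (op_scale s a) = scaleC s (Bop a)" if "a \<in> A" for a s
      using A.app_Bop that by (metis app_op_scale app_inverse)
    show ?thesis
      unfolding homomorphism_on_def linear_on_def
      using \<rho> A.Bop_mem B.app_bops
      by (auto simp: B1 B2 M_def N_def app_op_add app_op_scale app_comp simp del: app_simps)
  qed
  have unit: "app (\<psi> 1) \<in> B" using \<psi>N[of 1] A.mem_simps(2) unfolding M_def N_def by (blast intro: B.app_bops)
  have comm: "app (\<psi> 1) \<circ> \<phi> a = \<phi> a \<circ> app (\<psi> 1)" if "zero_product_map M \<psi> K" "a \<in> A" for K a
    using zero_product_map.unit_commutes[OF that(1) A.Bop_mem[OF that(2), folded M_def]] \<phi>\<psi>[OF that(2)]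
    by (metis app_comp)
  have fact: "\<phi> a = app (\<psi> 1) \<circ> app (\<rho> (Bop a))" if "\<And>a. a \<in> M \<Longrightarrow> \<psi> a = \<psi> 1 * \<rho> a" "a \<in> A" for \<rho> a
    using that(1)[OF A.Bop_mem[OF that(2), folded M_def]] \<phi>\<psi>[OF that(2)] by (metis app_comp)
  have "\<exists>h\<in>B. (\<forall>a\<in>A. h \<circ> \<phi> a = \<phi> a \<circ> h) \<and>
            (\<exists>\<rho>. star_homomorphism_on A B \<rho> \<and> (\<forall>a\<in>A. \<phi> a = h \<circ> \<rho> a))"
    if bs: "bounded_on A \<phi>" "symmetric_on A \<phi>"
  proof -
    obtain K where K: "zero_product_map M \<psi> K" using zpm[OF bs(1)] by blast
    have sym: "\<psi> (star a) = star (\<psi> a)" if "a \<in> M" for a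
    proof -
      have "app (\<psi> (star a)) = app (star (\<psi> a))"
        using bs(2) that A.star_mem A.app_bops by (simp add: symmetric_on_def app_\<psi> app_star M_def)
      then show ?thesis by (simp only: app_inject)
    qed
    interpret Z: zero_product_map M \<psi> K by (rule K)
    interpret S: symmetric_zero_product_map M \<psi> K N
      by unfold_locales (use \<psi>N sym B.star_mem B.bicommutant in \<open>auto simp: N_def\<close>)
    obtain \<rho> where \<rho>: "\<And>a. a \<in> M \<Longrightarrow> \<rho> a \<in> N \<and> \<psi> a = \<psi> 1 * \<rho> a \<and> \<rho> (star a) = star (\<rho> a)"
      "\<And>a b. a \<in> M \<Longrightarrow> b \<in> M \<Longrightarrow> \<rho> (a + b) = \<rho> a + \<rho> b \<and> \<rho> (a * b) = \<rho> a * \<rho> b"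
      "\<And>a s. a \<in> M \<Longrightarrow> \<rho> (scaleC s a) = scaleC s (\<rho> a)"
      using S.symmetric_factorization by blast
    have "Bop (adj a) = star (Bop a)" if "a \<in> A" for a
      using A.app_Bop[OF that] by (metis app_star app_inverse)
    then have "star_homomorphism_on A B (\<lambda>a. app (\<rho> (Bop a)))"
      unfolding star_homomorphism_on_def using hom[of \<rho>] \<rho> A.Bop_mem by (simp add: app_star M_def)
    moreover have "\<forall>a\<in>A. \<phi> a = app (\<psi> 1) \<circ> app (\<rho> (Bop a))" using fact \<rho>(1) by blast
    ultimately show ?thesis using unit comm[OF K] by blast
  qed
  moreover have "\<exists>h\<in>B. (\<forall>a\<in>A. h \<circ> \<phi> a = \<phi> a \<circ> h) \<and>
            (\<exists>\<rho>. homomorphism_on A B \<rho> \<and> \<rho> ` A = B \<and> (\<forall>a\<in>A. \<phi> a = h \<circ> \<rho> a))"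
    if bs: "bounded_on A \<phi>" "\<phi> ` A = B"
  proof -
    obtain K where K: "zero_product_map M \<psi> K" using zpm[OF bs(1)] by blast
    have surj: "\<psi> ` M = N"
    proof (intro equalityI subsetI)
      fix y assume "y \<in> N"
      then obtain a where a: "a \<in> A" "app y = \<phi> a" using bs(2) by (auto simp: N_def bops_def)
      then have "y = \<psi> (Bop a)" using \<phi>\<psi>[OF a(1)] by (simp add: app_inject)
      then show "y \<in> \<psi> ` M" using A.Bop_mem[OF a(1)] by (simp add: M_def)
    qed (use \<psi>N in auto)
    have vN: "vna N" unfolding N_def by (rule B.vna_axioms)
    obtain \<rho> where \<rho>: "\<And>a. a \<in> M \<Longrightarrow> \<psi> a = \<psi> 1 * \<rho> a"
      "\<And>a b. a \<in> M \<Longrightarrow> b \<in> M \<Longrightarrow> \<rho> (a + b) = \<rho> a + \<rho> b \<and> \<rho> (a * b) = \<rho> a * \<rho> b"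
      "\<And>a s. a \<in> M \<Longrightarrow> \<rho> (scaleC s a) = scaleC s (\<rho> a)" "\<rho> ` M = N"
      using zero_product_map.surjective_factorization[OF K vN surj] by blast
    have "homomorphism_on A B (\<lambda>a. app (\<rho> (Bop a)))" using hom[of \<rho>] \<rho>(2-4) by blast
    moreover have "(\<lambda>a. app (\<rho> (Bop a))) ` A = B"
    proof (intro equalityI subsetI)
      fix y assume "y \<in> (\<lambda>a. app (\<rho> (Bop a))) ` A"
      then obtain a where "a \<in> A" "y = app (\<rho> (Bop a))" by blast
      moreover from this have "\<rho> (Bop a) \<in> N" using A.Bop_mem \<rho>(4) by (auto simp: M_def)
      ultimately show "y \<in> B" by (simp add: N_def bops_def)
    next
      fix y assume y: "y \<in> B"
      then have "Bop y \<in> \<rho> ` M" using B.Bop_mem \<rho>(4) by (simp add: N_def)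
      then obtain a where a: "a \<in> M" "Bop y = \<rho> a" by blast
      have "y = app (\<rho> (Bop (app a)))" using a(2) B.app_Bop[OF y] app_inverse by metis
      then show "y \<in> (\<lambda>a. app (\<rho> (Bop a))) ` A" using A.app_bops a(1) by (auto simp: M_def)
    qed
    moreover have "\<forall>a\<in>A. \<phi> a = app (\<psi> 1) \<circ> app (\<rho> (Bop a))" using fact \<rho>(1) by blast
    ultimately show ?thesis using unit comm[OF K] by blast
  qed
  ultimately show ?thesis by blast
qed

end
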